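(* Let $\hat\Omega\subset\mathbb{C}$ be a bounded domain with $C^1$ boundary and let $\hat\sigma$ be a $C^2$-anisotropic conductivity on $\hat\Omega$ which equals the identity matrix $I$ in a neighbourhood of $\partial\hat\Omega$, extended by $\hat\sigma=I$ to $\mathbb{C}\setminus\hat\Omega$. Let $F:\mathbb{C}\to\mathbb{C}$ be the normalized quasiconformal diffeomorphism with $F_*\hat\sigma=\sigma I$, let $\Omega=F(\hat\Omega)$, and let $b(\lambda)$ and $\hat b(\lambda)$ be the isotropic and anisotropic scattering amplitudes (all defined in the context). Then, for every $\lambda\in\mathbb{C}$, $$b(\lambda)=\hat b(\lambda).$$
   Context: $\mathbb{R}^2$ is identified with $\mathbb{C}$ by $(x,y)\mapsto x+iy$. A $C^2$-anisotropic conductivity on $\hat\Omega$ is a positive definite symmetric real $2\times2$ matrix-valued function $\hat\sigma=(\hat\sigma^{ij})$ on $\overline{\hat\Omega}$ of class $C^2$. Map $F$: put $$\mu_1=\frac{-\hat\sigma^{11}+\hat\sigma^{22}-2i\hat\sigma^{12}}{\hat\sigma^{11}+\hat\sigma^{22}+2\sqrt{\det\hat\sigma}},$$ which is compactly supported in $\hat\Omega$ with $|\mu_1|\le k<1$. $F:\mathbb{C}\to\mathbb{C}$ is the quasiconformal $C^1$-diffeomorphism solving the Beltrami equation $\partial_{\bar z}F=\mu_1\partial_zF$ with $F(z)=z+O(1/z)$ as $|z|\to\infty$ (its existence is a known result). It is holomorphic on $\mathbb{C}\setminus\hat\Omega$ and near $\partial\hat\Omega$. It satisfies $F_*\hat\sigma=\sigma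 I$ with $\sigma=(\det\hat\sigma)^{1/2}\circ F^{-1}$, where $F_*\hat\sigma=\left(\frac{{}^t(DF)\hat\sigma(DF)}{|\det DF|}\right)\circ F^{-1}$ and $(DF)_{ij}=\partial F_j/\partial x_i$. In particular $\sigma=1$ on $\mathbb{C}\setminus\Omega$ and near $\partial\Omega$. Isotropic amplitude: let $q=\sigma^{-1/2}\Delta\sigma^{1/2}$ on $\mathbb{C}$ (zero outside $\Omega$). For each $\lambda\in\mathbb{C}$, $\tilde\psi(\cdot,\lambda)$ is the unique solution (known to exist) of $-\Delta\tilde\psi+q\tilde\psi=0$ on $\mathbb{C}$ with $\tilde\psi(w,\lambda)=e^{\lambda w}(1+O(1/w))$ as $w\to\infty$. Define $$b(\lambda)=\int_\Omega e^{-\bar\lambda\bar w}q(w)\tilde\psi(w,\lambda)\,dA(w).$$ Anisotropic amplitude: $\hat\psi(\cdot,\lambda)$ is the unique solution of $\nabla\cdot(\hat\sigma\nabla\hat\psi)=0$ on $\mathbb{C}$ with $\hat\psi(z,\lambda)=e^{\lambda z}(1+O(1/z))$ as $z\to\infty$; it is given by $\hat\psi(z,\lambda)=\sigma^{-1/2}(F(z))\,\tilde\psi(F(z),\lambda)$. Let $M$ be the operator defined by $-\nabla\cdot\hat\sigma\nabla=-\Delta+M$, i.e. $Mu=\Delta u-\nabla\cdot(\hat\sigma\nabla u)$, whose coefficients are compactly supported in $\hat\Omega$. Define $$\hat b(\lambda)=\int_{\hat\Omega}e^{-\bar\lambda\bar z}M\hat\psi(z,\lambda)\,dA(z).$$ Here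 $dA$ denotes two-dimensional Lebesgue measure. *)

theory Defs
  imports "HOL-Analysis.Analysis" "HOL-Library.Landau_Symbols"
begin

text \<open>The plane is the type \<^typ>\<open>complex\<close>, regarded as a real Euclidean space.\<close>

section \<open>Differential operators\<close>

definition pdx :: "(complex \<Rightarrow> 'b::real_normed_vector) \<Rightarrow> complex \<Rightarrow> 'b" where
  "pdx f z = frechet_derivative f (at z) 1"

definition pdy :: "(complex \<Rightarrow> 'b::real_normed_vector) \<Rightarrow> complex \<Rightarrow> 'b" where
  "pdy f z = frechet_derivative f (at z) \<i>"

text \<open>Real differentiability class \<open>C\<^sup>k\<close>; meant for open sets only, since the derivatives are
  taken in the whole plane.\<close>

primrec Ck_on :: "nat \<Rightarrow> complex set \<Rightarrow> (complex \<Rightarrow> 'b::real_normed_vector) \<Rightarrow> bool" where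
  "Ck_on 0 S f \<longleftrightarrow> continuous_on S f"
| "Ck_on (Suc k) S f \<longleftrightarrow>
     (\<forall>z\<in>S. f differentiable (at z)) \<and> Ck_on k S (pdx f) \<and> Ck_on k S (pdy f)"

definition wirt :: "(complex \<Rightarrow> complex) \<Rightarrow> complex \<Rightarrow> complex" where
  "wirt f z = (pdx f z - \<i> * pdy f z) / 2"

definition wirt_bar :: "(complex \<Rightarrow> complex) \<Rightarrow> complex \<Rightarrow> complex" where
  "wirt_bar f z = (pdx f z + \<i> * pdy f z) / 2"

definition laplacian :: "(complex \<Rightarrow> 'b::real_normed_vector) \<Rightarrow> complex \<Rightarrow> 'b" where
  "laplacian u z = pdx (pdx u) z + pdy (pdy u) z"

definition div_grad ::
  "(complex \<Rightarrow> real^2^2) \<Rightarrow> (complex \<Rightarrow> 'b::real_normed_vector) \<Rightarrow> complex \<Rightarrow> 'b" where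
  "div_grad sig u z =
     pdx (\<lambda>\<zeta>. (sig \<zeta> $ 1 $ 1) *\<^sub>R pdx u \<zeta> + (sig \<zeta> $ 1 $ 2) *\<^sub>R pdy u \<zeta>) z +
     pdy (\<lambda>\<zeta>. (sig \<zeta> $ 2 $ 1) *\<^sub>R pdx u \<zeta> + (sig \<zeta> $ 2 $ 2) *\<^sub>R pdy u \<zeta>) z"

section \<open>Domains and conductivities\<close>

text \<open>Locally the domain is one side of a regular level set of a \<open>C\<^sup>1\<close> function.\<close>

definition C1_boundary :: "complex set \<Rightarrow> bool" where
  "C1_boundary D \<longleftrightarrow> (\<forall>p\<in>frontier D. \<exists>U (\<rho> :: complex \<Rightarrow> real).
     open U \<and> p \<in> U \<and> Ck_on 1 U \<rho> \<and> (\<forall>z\<in>U. (pdx \<rho> z, pdy \<rho> z) \<noteq> (0, 0)) \<and>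
     D \<inter> U = {z\<in>U. \<rho> z < 0})"

definition bounded_C1_domain :: "complex set \<Rightarrow> bool" where
  "bounded_C1_domain D \<longleftrightarrow>
     open D \<and> connected D \<and> D \<noteq> {} \<and> bounded D \<and> C1_boundary D"

text \<open>Being of class \<open>C\<^sup>2\<close> on the closure means having a \<open>C\<^sup>2\<close> extension to an open
  neighbourhood of it.\<close>

definition C2_conductivity :: "complex set \<Rightarrow> (complex \<Rightarrow> real^2^2) \<Rightarrow> bool" where
  "C2_conductivity D sig \<longleftrightarrow>
     (\<exists>V g. open V \<and> closure D \<subseteq> V \<and> Ck_on 2 V g \<and> (\<forall>z\<in>closure D. g z = sig z)) \<and>
     (\<forall>z\<in>closure D. transpose (sig z) = sig z \<and> (\<forall>v. v \<noteq> 0 \<longrightarrow> v \<bullet> (sig z *v v) > 0))"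

definition identity_near_boundary :: "complex set \<Rightarrow> (complex \<Rightarrow> real^2^2) \<Rightarrow> bool" where
  "identity_near_boundary D sig \<longleftrightarrow>
     (\<exists>U. open U \<and> frontier D \<subseteq> U \<and> (\<forall>z \<in> U \<inter> closure D. sig z = mat 1))"

definition extend_by_identity ::
  "complex set \<Rightarrow> (complex \<Rightarrow> real^2^2) \<Rightarrow> complex \<Rightarrow> real^2^2" where
  "extend_by_identity D sig z = (if z \<in> D then sig z else mat 1)"

section \<open>Isothermal coordinates\<close>

definition beltrami_coeff :: "(complex \<Rightarrow> real^2^2) \<Rightarrow> complex \<Rightarrow> complex" where
  "beltrami_coeff sig z =
     (- of_real (sig z $ 1 $ 1) + of_real (sig z $ 2 $ 2) - 2 * \<i> * of_real (sig z $ 1 $ 2)) /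
     of_real (sig z $ 1 $ 1 + sig z $ 2 $ 2 + 2 * sqrt (det (sig z)))"

definition C1_diffeo :: "(complex \<Rightarrow> complex) \<Rightarrow> bool" where
  "C1_diffeo F \<longleftrightarrow> bij F \<and> Ck_on 1 UNIV F \<and> Ck_on 1 UNIV (inv F)"

text \<open>The analytic definition of quasiconformality, for maps that are already known to be
  \<open>C\<^sup>1\<close>-diffeomorphisms of the plane.\<close>

definition quasiconformal_C1_diffeo :: "(complex \<Rightarrow> complex) \<Rightarrow> bool" where
  "quasiconformal_C1_diffeo F \<longleftrightarrow> C1_diffeo F \<and>
     (\<exists>k::real. 0 \<le> k \<and> k < 1 \<and> (\<forall>z. cmod (wirt_bar F z) \<le> k * cmod (wirt F z)))"

definition normalized_beltrami_solution ::
  "(complex \<Rightarrow> complex) \<Rightarrow> (complex \<Rightarrow> complex) \<Rightarrow> bool" where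
  "normalized_beltrami_solution \<mu> F \<longleftrightarrow>
     quasiconformal_C1_diffeo F \<and>
     (\<forall>z. wirt_bar F z = \<mu> z * wirt F z) \<and>
     (\<lambda>z. F z - z) \<in> O[at_infinity](\<lambda>z. 1 / z)"

text \<open>Entry \<open>(i, j)\<close> is the derivative of the \<open>j\<close>-th component in the \<open>i\<close>-th direction, i.e. the
  transpose of the usual Jacobian matrix.\<close>

definition DF_matrix :: "(complex \<Rightarrow> complex) \<Rightarrow> complex \<Rightarrow> real^2^2" where
  "DF_matrix F z = vector [vector [Re (pdx F z), Im (pdx F z)],
                           vector [Re (pdy F z), Im (pdy F z)]]"

definition push_forward ::
  "(complex \<Rightarrow> complex) \<Rightarrow> (complex \<Rightarrow> real^2^2) \<Rightarrow> complex \<Rightarrow> real^2^2" where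
  "push_forward F sig w = (let z = inv F w in
     (1 / \<bar>det (DF_matrix F z)\<bar>) *\<^sub>R (transpose (DF_matrix F z) ** sig z ** DF_matrix F z))"

definition iso_conductivity ::
  "(complex \<Rightarrow> complex) \<Rightarrow> (complex \<Rightarrow> real^2^2) \<Rightarrow> complex \<Rightarrow> real" where
  "iso_conductivity F sig w = sqrt (det (sig (inv F w)))"

section \<open>Scattering solutions and amplitudes\<close>

text \<open>\<open>u(z) = exp (lam z) (1 + O(1/z))\<close> at infinity.\<close>

definition exp_asymptotics :: "complex \<Rightarrow> (complex \<Rightarrow> complex) \<Rightarrow> bool" where
  "exp_asymptotics lam u \<longleftrightarrow>
     (\<lambda>z. u z / exp (lam * z) - 1) \<in> O[at_infinity](\<lambda>z. 1 / z)"

definition is_unique_solution :: "('a \<Rightarrow> bool) \<Rightarrow> 'a \<Rightarrow> bool" where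
  "is_unique_solution P u \<longleftrightarrow> P u \<and> (\<forall>v. P v \<longrightarrow> v = u)"

definition potential :: "(complex \<Rightarrow> real) \<Rightarrow> complex \<Rightarrow> real" where
  "potential s w = laplacian (\<lambda>\<zeta>. sqrt (s \<zeta>)) w / sqrt (s w)"

text \<open>Solutions are classical. For \<open>C\<^sup>2\<close> conductivities weak solutions are classical as well: the
  Schroedinger solution is the square root of the isotropic conductivity times a solution of the
  conductivity equation, and the latter is \<open>C\<^sup>2\<close> by Schauder theory.\<close>

definition schroedinger_solution ::
  "(complex \<Rightarrow> real) \<Rightarrow> complex \<Rightarrow> (complex \<Rightarrow> complex) \<Rightarrow> bool" where
  "schroedinger_solution q lam u \<longleftrightarrow>
     Ck_on 2 UNIV u \<and> (\<forall>w. - laplacian u w + of_real (q w) * u w = 0) \<and> exp_asymptotics lam u"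

definition conductivity_solution ::
  "(complex \<Rightarrow> real^2^2) \<Rightarrow> complex \<Rightarrow> (complex \<Rightarrow> complex) \<Rightarrow> bool" where
  "conductivity_solution sig lam u \<longleftrightarrow>
     Ck_on 2 UNIV u \<and> (\<forall>z. div_grad sig u z = 0) \<and> exp_asymptotics lam u"

definition iso_amplitude ::
  "complex set \<Rightarrow> (complex \<Rightarrow> real) \<Rightarrow> (complex \<Rightarrow> complex \<Rightarrow> complex) \<Rightarrow> complex \<Rightarrow> complex" where
  "iso_amplitude D q \<psi> lam =
     (LINT w:D|lborel. exp (- cnj lam * cnj w) * of_real (q w) * \<psi> w lam)"

definition M_op ::
  "(complex \<Rightarrow> real^2^2) \<Rightarrow> (complex \<Rightarrow> complex) \<Rightarrow> complex \<Rightarrow> complex" where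
  "M_op sig u z = laplacian u z - div_grad sig u z"

definition aniso_amplitude ::
  "complex set \<Rightarrow> (complex \<Rightarrow> real^2^2) \<Rightarrow> (complex \<Rightarrow> complex \<Rightarrow> complex) \<Rightarrow> complex \<Rightarrow> complex" where
  "aniso_amplitude D sig \<psi> lam =
     (LINT z:D|lborel. exp (- cnj lam * cnj z) * M_op sig (\<lambda>\<zeta>. \<psi> \<zeta> lam) z)"

end

theory Submission
  imports Defs "HOL-Complex_Analysis.Cauchy_Integral_Formula"
begin

text \<open>
  Both solutions are harmonic near infinity, and the equations turn the two amplitudes into integrals of
  \<open>exp (- cnj (lam * z))\<close> against the Laplacians of \<open>psi\<close> and \<open>psi_hat\<close>. Green's formula moves these to an
  annulus of radius \<open>R\<close>. There \<open>psi_hat = psi \<circ> F\<close> with \<open>F\<close> holomorphic and \<open>F z = z + O(1/z)\<close>; the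
  integrands are antiholomorphic of size \<open>O(1/R)\<close>, and composition with \<open>F\<close> changes them only by \<open>O(1/R\<^sup>2)\<close>.
  With the gradient \<open>O(1/R)\<close> of the cutoff and the area \<open>O(R\<^sup>2)\<close>, the difference of the amplitudes is
  \<open>O(1/R)\<close>, hence zero.

  The relation between \<open>psi\<close> and \<open>psi_hat\<close> comes from the uniqueness of classical solutions, which requires
  \<open>G = inv F\<close> to be of class \<open>C\<^sup>2\<close>, while only \<open>C\<^sup>1\<close> is given. Now \<open>G\<close> solves the conjugate Beltrami
  equation \<open>wirt_bar G = - \<mu> (G z) * cnj (wirt G)\<close>. Differentiated weakly it reads \<open>wirt_bar P = Q\<close> for
  \<open>P = wirt G\<close>, with \<open>Q\<close> a continuous expression in \<open>G\<close> and \<open>P\<close>. So \<open>P\<close> is locally the Cauchy transform of a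
  continuous function, hence Hoelder continuous; then so is \<open>Q\<close>, and therefore \<open>P\<close> is of class \<open>C\<^sup>1\<close>.
\<close>

section \<open>Differential calculus in the plane\<close>

text \<open>All integrations by parts take place in the whole plane against a factor of bounded
  support, and come from translation invariance of Lebesgue measure applied to difference quotients.
  No boundary integral occurs: the circle of radius \<open>R\<close> is replaced by the annulus that
  carries the derivatives of \<open>chi R\<close>, and \<open>G\<close>, which has only one
  derivative at the outset, can be treated weakly. The Hoelder exponent is 1/2 throughout, because
  then a single majorant, |z|^(-3/2), serves twice. It lies half a power from 1/|z| and half a power
  from 1/|z|^2, and it is integrable near the origin: the half power lost from the Cauchy kernel
  pays for a difference of its values, and the half power supplied by a Hoelder factor tames its
  derivative. Differentiating the conjugate Beltrami equation couples \<open>wirt_bar P\<close> with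
  its own conjugate. The coupling is a real-linear system, solvable because |\<mu>| < 1, and the
  solution is the right-hand side \<open>Q\<close>.\<close>

definition pd :: "complex \<Rightarrow> (complex \<Rightarrow> 'b::real_normed_vector) \<Rightarrow> complex \<Rightarrow> 'b" where
  "pd e f z = frechet_derivative f (at z) e"

lemma pdx_eq_pd: "pdx f = pd 1 f" and pdy_eq_pd: "pdy f = pd \<i> f"
  by (auto simp: pdx_def pdy_def pd_def)

lemma pd_eqI: "(f has_derivative D) (at z) \<Longrightarrow> pd e f z = D e"
  unfolding pd_def by (metis frechet_derivative_at)

lemma has_derivative_pd:
  "f differentiable (at z) \<Longrightarrow> (f has_derivative (\<lambda>e. pd e f z)) (at z)"
  unfolding pd_def by (rule frechet_derivative_works[THEN iffD1])

lemma pd_linear: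
  assumes "f differentiable (at z)"
  shows "pd e f z = Re e *\<^sub>R pdx f z + Im e *\<^sub>R pdy f z"
proof -
  have l: "linear (\<lambda>e. pd e f z)"
    using has_derivative_pd[OF assms] has_derivative_linear by blast
  have "e = Re e *\<^sub>R 1 + Im e *\<^sub>R \<i>"
    by (simp add: complex_eq_iff)
  then have "pd e f z = pd (Re e *\<^sub>R 1 + Im e *\<^sub>R \<i>) f z" by simp
  also have "\<dots> = Re e *\<^sub>R pd 1 f z + Im e *\<^sub>R pd \<i> f z"
    using linear_add[OF l, of "Re e *\<^sub>R 1" "Im e *\<^sub>R \<i>"] linear_scale[OF l, of "Re e" 1]
      linear_scale[OF l, of "Im e" \<i>] by simp
  finally show ?thesis by (simp add: pdx_eq_pd pdy_eq_pd)
qed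

lemma has_derivative_pdx_pdy:
  assumes "f differentiable (at z)"
  shows "(f has_derivative (\<lambda>h. Re h *\<^sub>R pdx f z + Im h *\<^sub>R pdy f z)) (at z)"
  using has_derivative_pd[OF assms] pd_linear[OF assms] by simp

lemma pd_const [simp]: "pd e (\<lambda>_. c) = (\<lambda>_. 0)"
  by (simp add: pd_def fun_eq_iff)

lemma pd_add:
  assumes "f differentiable (at z)" "g differentiable (at z)"
  shows "pd e (\<lambda>z. f z + g z) z = pd e f z + pd e g z"
  by (rule pd_eqI[OF has_derivative_add[OF assms[THEN has_derivative_pd]]])

lemma pd_diff:
  assumes "f differentiable (at z)" "g differentiable (at z)"
  shows "pd e (\<lambda>z. f z - g z) z = pd e f z - pd e g z"
  by (rule pd_eqI[OF has_derivative_diff[OF assms[THEN has_derivative_pd]]])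

lemma pd_bounded_linear:
  assumes "bounded_linear L" "f differentiable (at z)"
  shows "pd e (\<lambda>z. L (f z)) z = L (pd e f z)"
  by (rule pd_eqI[OF bounded_linear.has_derivative[OF assms(1) has_derivative_pd[OF assms(2)]]])

lemma pd_bilinear:
  assumes "bounded_bilinear B" "f differentiable (at z)" "g differentiable (at z)"
  shows "pd e (\<lambda>z. B (f z) (g z)) z = B (f z) (pd e g z) + B (pd e f z) (g z)"
  by (rule pd_eqI[OF bounded_bilinear.FDERIV[OF assms(1) assms(2,3)[THEN has_derivative_pd]]])

lemmas pd_mult = pd_bilinear[OF bounded_bilinear_mult]

lemma differentiable_bilinear:
  fixes z :: complex
  assumes "bounded_bilinear B" "f differentiable (at z)" "g differentiable (at z)"
  shows "(\<lambda>z. B (f z) (g z)) differentiable (at z)"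
  using bounded_bilinear.FDERIV[OF assms(1) assms(2,3)[THEN has_derivative_pd]]
  unfolding differentiable_def by blast

lemma differentiable_bounded_linear:
  fixes z :: complex
  assumes "bounded_linear L" "f differentiable (at z)"
  shows "(\<lambda>z. L (f z)) differentiable (at z)"
  using bounded_linear.has_derivative[OF assms(1) has_derivative_pd[OF assms(2)]]
  unfolding differentiable_def by blast

text \<open>\<open>frechet_derivative\<close> is a choice among the derivatives at the point.
  Functions that agree nearby have the same derivatives, so the choices agree even where no
  derivative exists.\<close>

lemma pd_cong_open:
  assumes "open U" "z \<in> U" "\<And>\<zeta>. \<zeta> \<in> U \<Longrightarrow> f \<zeta> = g \<zeta>"
  shows "pd e f z = pd e g z"
proof -
  have "(f has_derivative D) (at z) \<longleftrightarrow> (g has_derivative D) (at z)" for D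
    using assms by (auto intro: has_derivative_transform_within_open)
  then show ?thesis
    by (simp add: pd_def frechet_derivative_def)
qed

lemma pdx_cong_open:
  assumes "open U" "z \<in> U" "\<And>\<zeta>. \<zeta> \<in> U \<Longrightarrow> f \<zeta> = g \<zeta>"
  shows "pdx f z = pdx g z" "pdy f z = pdy g z"
  using pd_cong_open[OF assms] by (simp_all add: pdx_eq_pd pdy_eq_pd)

lemma pd_compose_plane:
  assumes "f differentiable (at (G z))" "G differentiable (at z)"
  shows "pd e (\<lambda>z. f (G z)) z = Re (pd e G z) *\<^sub>R pdx f (G z) + Im (pd e G z) *\<^sub>R pdy f (G z)"
  using pd_eqI[OF has_derivative_compose[OF has_derivative_pd[OF assms(2)]
        has_derivative_pdx_pdy[OF assms(1)]]] .

lemma pd_compose_real: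
  fixes f :: "complex \<Rightarrow> real"
  assumes "f differentiable (at z)" "(\<phi> has_real_derivative d) (at (f z))"
  shows "pd e (\<lambda>z. \<phi> (f z)) z = d * pd e f z"
  using pd_eqI[OF has_derivative_compose[OF has_derivative_pd[OF assms(1)]
        assms(2)[unfolded has_field_derivative_def]]] .

lemma pd_compose_complex:
  fixes f :: "complex \<Rightarrow> complex"
  assumes "f differentiable (at z)" "(\<phi> has_field_derivative d) (at (f z))"
  shows "pd e (\<lambda>z. \<phi> (f z)) z = d * pd e f z"
  using pd_eqI[OF has_derivative_compose[OF has_derivative_pd[OF assms(1)]
        assms(2)[unfolded has_field_derivative_def]]] .

lemma pd_inverse:
  fixes f :: "complex \<Rightarrow> 'b::real_normed_field"
  assumes "f differentiable (at z)" "f z \<noteq> 0"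
  shows "pd e (\<lambda>z. inverse (f z)) z = - (inverse (f z) * inverse (f z) * pd e f z)"
  by (subst pd_eqI[OF Deriv.has_derivative_inverse[OF assms(2) has_derivative_pd[OF assms(1)]]])
    (simp add: algebra_simps)

lemma Ck_onD_differentiable: "Ck_on (Suc k) S f \<Longrightarrow> z \<in> S \<Longrightarrow> f differentiable (at z)"
  by simp

lemma Ck_on_continuous: "Ck_on k S f \<Longrightarrow> open S \<Longrightarrow> continuous_on S f"
proof (cases k)
  case (Suc n)
  assume "Ck_on k S f"
  then have "\<forall>z\<in>S. f differentiable (at z)" using Suc by simp
  then show ?thesis
    using continuous_at_imp_continuous_on differentiable_imp_continuous_within by blast
qed simp

lemma Ck_on_Suc_mono: "Ck_on (Suc k) S f \<Longrightarrow> open S \<Longrightarrow> Ck_on k S f"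
proof (induction k arbitrary: f)
  case 0 then show ?case using Ck_on_continuous[OF 0] by (simp del: Ck_on.simps(2))
next
  case (Suc k)
  from Suc.prems(1) have d: "\<forall>z\<in>S. f differentiable (at z)"
    and p: "Ck_on (Suc k) S (pdx f)" "Ck_on (Suc k) S (pdy f)"
    unfolding Ck_on.simps(2)[of "Suc k"] by blast+
  show ?case
    unfolding Ck_on.simps(2)[of k]
    using d Suc.IH[OF p(1) Suc.prems(2)] Suc.IH[OF p(2) Suc.prems(2)] by blast
qed

lemma Ck_on_mono: "Ck_on k S f \<Longrightarrow> j \<le> k \<Longrightarrow> open S \<Longrightarrow> Ck_on j S f"
proof (induction k)
  case (Suc k) then show ?case
    using Ck_on_Suc_mono[of k S f] by (cases "j = Suc k") (auto simp del: Ck_on.simps)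
qed auto

text \<open>Derivatives at a point see only a neighbourhood, so local models suffice. This glues the
  conductivity to the identity and turns regularity on balls into regularity on the plane.\<close>

lemma Ck_on_local:
  assumes "open S" "\<And>z. z \<in> S \<Longrightarrow> \<exists>U g. open U \<and> z \<in> U \<and> Ck_on k U g \<and> (\<forall>\<zeta>\<in>U. f \<zeta> = g \<zeta>)"
  shows "Ck_on k S f"
  using assms(2)
proof (induction k arbitrary: f)
  case 0
  have "isCont f z" if zS: "z \<in> S" for z
  proof -
    obtain U g where U: "open U" "z \<in> U" "continuous_on U g" "\<forall>\<zeta>\<in>U. f \<zeta> = g \<zeta>"
      using 0[OF zS] by auto
    then have "continuous_on U f" by (metis continuous_on_cong)
    then show ?thesis using U continuous_on_eq_continuous_at by blast
  qed
  then show ?case by (simp add: continuous_at_imp_continuous_on)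
next
  case (Suc k)
  have d: "f differentiable (at z)" if z: "z \<in> S" for z
  proof -
    obtain U g where U: "open U" "z \<in> U" "Ck_on (Suc k) U g" "\<forall>\<zeta>\<in>U. f \<zeta> = g \<zeta>"
      using Suc.prems[OF z] by (auto simp del: Ck_on.simps)
    then have "(g has_derivative (\<lambda>e. pd e g z)) (at z)"
      using has_derivative_pd by (metis Ck_onD_differentiable)
    then have "(f has_derivative (\<lambda>e. pd e g z)) (at z)"
      by (rule has_derivative_transform_within_open[OF _ U(1,2)]) (use U(4) in auto)
    then show ?thesis unfolding differentiable_def by blast
  qed
  have p: "\<exists>U g. open U \<and> z \<in> U \<and> Ck_on k U g \<and> (\<forall>\<zeta>\<in>U. pd e f \<zeta> = g \<zeta>)"
    if z: "z \<in> S" and e: "e = 1 \<or> e = \<i>" for z e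
  proof -
    obtain U g where U: "open U" "z \<in> U" "Ck_on (Suc k) U g" "\<forall>\<zeta>\<in>U. f \<zeta> = g \<zeta>"
      using Suc.prems[OF z] by (auto simp del: Ck_on.simps)
    then have "Ck_on k U (pd e g)" using e by (auto simp: pdx_eq_pd pdy_eq_pd)
    moreover have "\<forall>\<zeta>\<in>U. pd e f \<zeta> = pd e g \<zeta>"
      using pd_cong_open[OF U(1) _ U(4)[rule_format]] by (intro ballI)
    ultimately show ?thesis using U(1,2) by blast
  qed
  show ?case
    using d Suc.IH[of "pdx f"] Suc.IH[of "pdy f"] p by (simp add: pdx_eq_pd pdy_eq_pd)
qed

section \<open>Closure properties of the classes C^k on the plane\<close>

lemma Ck_SucI:
  assumes "\<And>z. f differentiable (at z)" "\<And>e. e = 1 \<or> e = \<i> \<Longrightarrow> Ck_on k UNIV (pd e f)"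
  shows "Ck_on (Suc k) UNIV f"
  using assms by (simp add: pdx_eq_pd pdy_eq_pd)

lemma Ck_pd: "Ck_on (Suc k) UNIV f \<Longrightarrow> e = 1 \<or> e = \<i> \<Longrightarrow> Ck_on k UNIV (pd e f)"
  by (auto simp: pdx_eq_pd pdy_eq_pd)

lemma Ck_diff: "Ck_on (Suc k) UNIV f \<Longrightarrow> f differentiable (at z)"
  by simp

lemma Ck_Suc_mono: "Ck_on (Suc k) UNIV f \<Longrightarrow> Ck_on k UNIV f"
  by (rule Ck_on_Suc_mono) auto

lemma Ck_const: "Ck_on k UNIV (\<lambda>_. c)"
proof (induction k arbitrary: c)
  case (Suc k)
  show ?case by (rule Ck_SucI) (use Suc in auto)
qed simp

lemma Ck_add: "Ck_on k UNIV f \<Longrightarrow> Ck_on k UNIV g \<Longrightarrow> Ck_on k UNIV (\<lambda>z. f z + g z)"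
proof (induction k arbitrary: f g)
  case 0 then show ?case by (simp add: continuous_on_add)
next
  case (Suc k)
  show ?case
  proof (rule Ck_SucI)
    show "(\<lambda>z. f z + g z) differentiable (at z)" for z
      using Suc.prems by (simp add: differentiable_add)
    fix e :: complex assume e: "e = 1 \<or> e = \<i>"
    have "pd e (\<lambda>z. f z + g z) = (\<lambda>z. pd e f z + pd e g z)"
      using Suc.prems by (auto intro!: pd_add)
    then show "Ck_on k UNIV (pd e (\<lambda>z. f z + g z))"
      using Suc.IH Ck_pd[OF _ e] Suc.prems by metis
  qed
qed

lemma Ck_bounded_linear:
  "bounded_linear L \<Longrightarrow> Ck_on k UNIV f \<Longrightarrow> Ck_on k UNIV (\<lambda>z. L (f z))"
proof (induction k arbitrary: f)
  case 0 then show ?case by (auto intro: linear_continuous_on_compose bounded_linear.continuous_on)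
next
  case (Suc k)
  show ?case
  proof (rule Ck_SucI)
    show "(\<lambda>z. L (f z)) differentiable (at z)" for z
      using Suc.prems by (simp add: differentiable_bounded_linear)
    fix e :: complex assume e: "e = 1 \<or> e = \<i>"
    have "pd e (\<lambda>z. L (f z)) = (\<lambda>z. L (pd e f z))"
      using Suc.prems by (auto intro!: pd_bounded_linear)
    then show "Ck_on k UNIV (pd e (\<lambda>z. L (f z)))"
      using Suc.IH Ck_pd[OF _ e] Suc.prems by metis
  qed
qed

lemma Ck_minus: "Ck_on k UNIV f \<Longrightarrow> Ck_on k UNIV (\<lambda>z. - f z)"
  by (rule Ck_bounded_linear[OF bounded_linear_minus[OF bounded_linear_ident]])

lemma Ck_minus_diff: "Ck_on k UNIV f \<Longrightarrow> Ck_on k UNIV g \<Longrightarrow> Ck_on k UNIV (\<lambda>z. f z - g z)"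
  using Ck_add[of k f "\<lambda>z. - g z"] Ck_minus[of k g] by simp

lemma Ck_bilinear:
  "bounded_bilinear B \<Longrightarrow> Ck_on k UNIV f \<Longrightarrow> Ck_on k UNIV g \<Longrightarrow> Ck_on k UNIV (\<lambda>z. B (f z) (g z))"
proof (induction k arbitrary: f g)
  case 0 then show ?case by (simp add: bounded_bilinear.continuous_on)
next
  case (Suc k)
  show ?case
  proof (rule Ck_SucI)
    show "(\<lambda>z. B (f z) (g z)) differentiable (at z)" for z
      using Suc.prems by (simp add: differentiable_bilinear)
    fix e :: complex assume e: "e = 1 \<or> e = \<i>"
    have "pd e (\<lambda>z. B (f z) (g z)) = (\<lambda>z. B (f z) (pd e g z) + B (pd e f z) (g z))"
      using Suc.prems by (auto intro!: pd_bilinear)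
    moreover have "Ck_on k UNIV (\<lambda>z. B (f z) (pd e g z) + B (pd e f z) (g z))"
      by (intro Ck_add Suc.IH Suc.prems Ck_pd[OF _ e] Ck_Suc_mono)
    ultimately show "Ck_on k UNIV (pd e (\<lambda>z. B (f z) (g z)))" by simp
  qed
qed

lemmas Ck_mult = Ck_bilinear[OF bounded_bilinear_mult]
lemmas Ck_scaleR = Ck_bilinear[OF bounded_bilinear_scaleR]
lemmas Ck_Re = Ck_bounded_linear[OF bounded_linear_Re]
lemmas Ck_Im = Ck_bounded_linear[OF bounded_linear_Im]
lemmas Ck_cnj = Ck_bounded_linear[OF bounded_linear_cnj]
lemmas Ck_of_real = Ck_bounded_linear[OF bounded_linear_of_real]

lemma pd_ident [simp]: "pd e (\<lambda>z. z) = (\<lambda>_. e)"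
  by (simp add: pd_def fun_eq_iff)

lemma Ck_ident: "Ck_on k UNIV (\<lambda>z::complex. z)"
proof (cases k)
  case (Suc n)
  show ?thesis unfolding Suc
    by (rule Ck_SucI) (auto simp: Ck_const)
qed simp

text \<open>The outer derivative is required on \<open>range f\<close> only, so that roots and real
  powers, which are smooth on the positive reals alone, can be composed.\<close>

lemma Ck_compose_real:
  fixes f :: "complex \<Rightarrow> real"
  assumes "Ck_on (Suc k) UNIV f" "\<And>x. x \<in> range f \<Longrightarrow> (\<phi> has_real_derivative \<phi>' x) (at x)"
    "Ck_on k UNIV (\<lambda>z. \<phi>' (f z))"
  shows "Ck_on (Suc k) UNIV (\<lambda>z. \<phi> (f z))"
proof (rule Ck_SucI)
  show "(\<lambda>z. \<phi> (f z)) differentiable (at z)" for z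
    unfolding differentiable_def
    using has_derivative_compose[OF has_derivative_pd[OF Ck_diff[OF assms(1)]]
        assms(2)[unfolded has_field_derivative_def]] by blast
  fix e :: complex assume e: "e = 1 \<or> e = \<i>"
  have "pd e (\<lambda>z. \<phi> (f z)) = (\<lambda>z. \<phi>' (f z) * pd e f z)"
    by (rule ext, rule pd_compose_real[OF Ck_diff[OF assms(1)] assms(2)]) auto
  then show "Ck_on k UNIV (pd e (\<lambda>z. \<phi> (f z)))"
    using Ck_mult[OF assms(3) Ck_pd[OF assms(1) e]] by simp
qed

lemma Ck_compose_plane:
  "Ck_on k UNIV f \<Longrightarrow> Ck_on k UNIV G \<Longrightarrow> Ck_on k UNIV (\<lambda>z. f (G z))"
proof (induction k arbitrary: f)
  case 0 then show ?case by (simp add: continuous_on_compose2)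
next
  case (Suc k)
  show ?case
  proof (rule Ck_SucI)
    show "(\<lambda>z. f (G z)) differentiable (at z)" for z
      unfolding differentiable_def
      using has_derivative_compose[OF has_derivative_pd[OF Ck_diff[OF Suc.prems(2)]]
          has_derivative_pdx_pdy[OF Ck_diff[OF Suc.prems(1)]]] by blast
    fix e :: complex assume e: "e = 1 \<or> e = \<i>"
    have "pd e (\<lambda>z. f (G z)) = (\<lambda>z. Re (pd e G z) *\<^sub>R pdx f (G z) + Im (pd e G z) *\<^sub>R pdy f (G z))"
      using Suc.prems by (auto intro!: pd_compose_plane)
    moreover have "Ck_on k UNIV (pdx f)" "Ck_on k UNIV (pdy f)"
      using Suc.prems by auto
    ultimately show "Ck_on k UNIV (pd e (\<lambda>z. f (G z)))"
      using Suc.IH[OF _ Ck_Suc_mono[OF Suc.prems(2)]] Ck_pd[OF Suc.prems(2) e]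
      by (auto intro!: Ck_add Ck_scaleR Ck_Re Ck_Im)
  qed
qed

lemma Ck_inverse:
  fixes f :: "complex \<Rightarrow> 'b::real_normed_field"
  assumes "\<And>z. f z \<noteq> 0"
  shows "Ck_on k UNIV f \<Longrightarrow> Ck_on k UNIV (\<lambda>z. inverse (f z))"
proof (induction k)
  case 0 then show ?case using assms by (simp add: continuous_on_inverse)
next
  case (Suc k)
  show ?case
  proof (rule Ck_SucI)
    show "(\<lambda>z. inverse (f z)) differentiable (at z)" for z
      unfolding differentiable_def
      using Deriv.has_derivative_inverse[OF assms has_derivative_pd[OF Ck_diff[OF Suc.prems]]] by blast
    fix e :: complex assume e: "e = 1 \<or> e = \<i>"
    have "pd e (\<lambda>z. inverse (f z)) = (\<lambda>z. - (inverse (f z) * inverse (f z) * pd e f z))"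
      by (rule ext, rule pd_inverse[OF Ck_diff[OF Suc.prems] assms])
    then show "Ck_on k UNIV (pd e (\<lambda>z. inverse (f z)))"
      using Suc.IH[OF Ck_Suc_mono[OF Suc.prems]] Ck_pd[OF Suc.prems e]
      by (auto intro!: Ck_minus Ck_mult)
  qed
qed

lemma Ck_divide:
  fixes f g :: "complex \<Rightarrow> 'b::real_normed_field"
  assumes "Ck_on k UNIV f" "Ck_on k UNIV g" "\<And>z. g z \<noteq> 0"
  shows "Ck_on k UNIV (\<lambda>z. f z / g z)"
  unfolding divide_inverse by (intro Ck_mult Ck_inverse assms)

lemma Ck_sqrt:
  fixes f :: "complex \<Rightarrow> real"
  assumes "\<And>z. f z > 0"
  shows "Ck_on k UNIV f \<Longrightarrow> Ck_on k UNIV (\<lambda>z. sqrt (f z))"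
proof (induction k)
  case 0 then show ?case by (simp add: continuous_on_real_sqrt)
next
  case (Suc k)
  have nz: "sqrt (f z) \<noteq> 0" for z using assms[of z] by simp
  have "Ck_on k UNIV (\<lambda>z. inverse (sqrt (f z)) * inverse 2)"
    by (rule Ck_mult[OF Ck_inverse[OF nz Suc.IH[OF Ck_Suc_mono[OF Suc.prems]]] Ck_const])
  then have c: "Ck_on k UNIV (\<lambda>z. inverse (sqrt (f z)) / 2)"
    by (simp only: divide_inverse)
  have "(sqrt has_real_derivative inverse (sqrt x) / 2) (at x)" if "x \<in> range f" for x
    using that assms by (intro DERIV_real_sqrt) auto
  then show ?case
    using Ck_compose_real[OF Suc.prems _ c] by blast
qed

lemma Ck_exp:
  fixes f :: "complex \<Rightarrow> complex"
  shows "Ck_on k UNIV f \<Longrightarrow> Ck_on k UNIV (\<lambda>z. exp (f z))"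
proof (induction k)
  case 0 then show ?case by (simp add: continuous_on_exp)
next
  case (Suc k)
  show ?case
  proof (rule Ck_SucI)
    show "(\<lambda>z. exp (f z)) differentiable (at z)" for z
      unfolding differentiable_def
      using has_derivative_compose[OF has_derivative_pd[OF Ck_diff[OF Suc.prems]]
          DERIV_exp[unfolded has_field_derivative_def]] by blast
    fix e :: complex assume e: "e = 1 \<or> e = \<i>"
    have "pd e (\<lambda>z. exp (f z)) = (\<lambda>z. exp (f z) * pd e f z)"
      by (rule ext, rule pd_compose_complex[OF Ck_diff[OF Suc.prems]]) (auto intro: DERIV_exp)
    then show "Ck_on k UNIV (pd e (\<lambda>z. exp (f z)))"
      using Suc.IH[OF Ck_Suc_mono[OF Suc.prems]] Ck_pd[OF Suc.prems e]
      by (auto intro!: Ck_mult)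
  qed
qed

lemmas Ck_intros = Ck_const Ck_ident Ck_add Ck_minus Ck_minus_diff Ck_mult Ck_scaleR Ck_Re Ck_Im
  Ck_cnj Ck_of_real Ck_exp

section \<open>Wirtinger derivatives\<close>

lemma wirt_diff:
  assumes "f differentiable (at z)" "g differentiable (at z)"
  shows "wirt (\<lambda>z. f z - g z) z = wirt f z - wirt g z"
    "wirt_bar (\<lambda>z. f z - g z) z = wirt_bar f z - wirt_bar g z"
  using assms by (simp_all add: wirt_def wirt_bar_def pdx_eq_pd pdy_eq_pd pd_diff field_simps)

lemma wirt_mult:
  assumes "f differentiable (at z)" "g differentiable (at z)"
  shows "wirt (\<lambda>z. f z * g z) z = f z * wirt g z + wirt f z * g z"
    "wirt_bar (\<lambda>z. f z * g z) z = f z * wirt_bar g z + wirt_bar f z * g z"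
  using assms by (simp_all add: wirt_def wirt_bar_def pdx_eq_pd pdy_eq_pd pd_mult field_simps)

lemma wirt_cnj:
  assumes "f differentiable (at z)"
  shows "wirt (\<lambda>z. cnj (f z)) z = cnj (wirt_bar f z)"
    "wirt_bar (\<lambda>z. cnj (f z)) z = cnj (wirt f z)"
  using assms by (simp_all add: wirt_def wirt_bar_def pdx_eq_pd pdy_eq_pd pd_bounded_linear bounded_linear_cnj)

lemma wirt_holomorphic:
  assumes "(f has_field_derivative d) (at z)"
  shows "wirt f z = d" "wirt_bar f z = 0"
proof -
  have "pd e f z = d * e" for e
    using pd_eqI[OF assms[unfolded has_field_derivative_def]] by simp
  then show "wirt f z = d" "wirt_bar f z = 0"
    by (simp_all add: wirt_def wirt_bar_def pdx_eq_pd pdy_eq_pd field_simps)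
qed

text \<open>The Cauchy-Riemann equations: the passage from real calculus to holomorphic functions,
  made where the conductivity is the identity and the solutions are harmonic.\<close>

lemma has_field_derivative_wirt:
  assumes "f differentiable (at z)" "wirt_bar f z = 0"
  shows "(f has_field_derivative wirt f z) (at z)"
proof -
  have y: "pdy f z = \<i> * pdx f z"
    using assms(2) by (simp add: wirt_bar_def complex_eq_iff)
  have "Re h *\<^sub>R pdx f z + Im h *\<^sub>R pdy f z = wirt f z * h" for h
    unfolding wirt_def y by (simp add: complex_eq_iff field_simps)
  then show ?thesis
    using has_derivative_pdx_pdy[OF assms(1)] by (simp add: has_field_derivative_def fun_eq_iff)
qed

lemma wirt_compose:
  assumes "f differentiable (at (G z))" "G differentiable (at z)"
  shows "wirt (\<lambda>z. f (G z)) z = wirt f (G z) * wirt G z + wirt_bar f (G z) * cnj (wirt_bar G z)"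
    "wirt_bar (\<lambda>z. f (G z)) z = wirt f (G z) * wirt_bar G z + wirt_bar f (G z) * cnj (wirt G z)"
proof -
  show "wirt (\<lambda>z. f (G z)) z = wirt f (G z) * wirt G z + wirt_bar f (G z) * cnj (wirt_bar G z)"
    unfolding wirt_def wirt_bar_def pdx_eq_pd[of "\<lambda>z. f (G z)"] pdy_eq_pd[of "\<lambda>z. f (G z)"]
    unfolding pd_compose_plane[OF assms] pdx_eq_pd[of G] pdy_eq_pd[of G]
    by (simp add: complex_eq_iff field_simps)
  show "wirt_bar (\<lambda>z. f (G z)) z = wirt f (G z) * wirt_bar G z + wirt_bar f (G z) * cnj (wirt G z)"
    unfolding wirt_def wirt_bar_def pdx_eq_pd[of "\<lambda>z. f (G z)"] pdy_eq_pd[of "\<lambda>z. f (G z)"]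
    unfolding pd_compose_plane[OF assms] pdx_eq_pd[of G] pdy_eq_pd[of G]
    by (simp add: complex_eq_iff field_simps)
qed

lemma pdx_wirt: "pdx f z = wirt f z + wirt_bar f z" "pdy f z = \<i> * (wirt f z - wirt_bar f z)"
  by (simp_all add: wirt_def wirt_bar_def field_simps)

lemma Ck_wirt:
  assumes "Ck_on (Suc k) UNIV f"
  shows "Ck_on k UNIV (wirt f)" "Ck_on k UNIV (wirt_bar f)"
proof -
  have "wirt f = (\<lambda>z. (pdx f z - \<i> * pdy f z) * (1/2))" "wirt_bar f = (\<lambda>z. (pdx f z + \<i> * pdy f z) * (1/2))"
    by (auto simp: wirt_def wirt_bar_def)
  moreover have "Ck_on k UNIV (pdx f)" "Ck_on k UNIV (pdy f)" using assms by auto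
  ultimately show "Ck_on k UNIV (wirt f)" "Ck_on k UNIV (wirt_bar f)"
    by (simp_all only: Ck_intros)
qed

section \<open>Integration by parts\<close>

text \<open>Compact support, encoded as vanishing outside a disc: it passes to products by a
  pointwise argument, and no closure has to be formed.\<close>

definition bounded_supp :: "(complex \<Rightarrow> 'b::zero) \<Rightarrow> bool" where
  "bounded_supp f \<longleftrightarrow> (\<exists>R. \<forall>z. R \<le> cmod z \<longrightarrow> f z = 0)"

lemma bounded_suppE:
  assumes "bounded_supp f"
  obtains R where "R > 0" "\<And>z. R \<le> cmod z \<Longrightarrow> f z = 0"
proof -
  from assms obtain R where "\<forall>z. R \<le> cmod z \<longrightarrow> f z = 0" by (auto simp: bounded_supp_def)
  then show ?thesis using that[of "max R 1"] by auto
qed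

lemma bounded_supp_mono: "bounded_supp f \<Longrightarrow> (\<And>z. f z = 0 \<Longrightarrow> g z = 0) \<Longrightarrow> bounded_supp g"
  unfolding bounded_supp_def by blast

lemma bounded_supp_shift:
  assumes "bounded_supp f" shows "bounded_supp (\<lambda>z. f (z + a))"
proof -
  obtain R where "R > 0" and RR: "\<And>z. R \<le> cmod z \<Longrightarrow> f z = 0" using bounded_suppE[OF assms] by blast
  then have "f (z + a) = 0" if "R + cmod a \<le> cmod z" for z
    using that norm_triangle_ineq4[of "z + a" a] by (intro RR) simp
  then show ?thesis unfolding bounded_supp_def by blast
qed

lemma bounded_supp_reflect:
  assumes "bounded_supp f" shows "bounded_supp (\<lambda>z. f (a - z))"
proof -
  obtain R where "R > 0" and RR: "\<And>z. R \<le> cmod z \<Longrightarrow> f z = 0" using bounded_suppE[OF assms] by blast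
  then have "f (a - z) = 0" if "R + cmod a \<le> cmod z" for z
    using that norm_triangle_ineq4[of a "a - z"] by (intro RR) simp
  then show ?thesis unfolding bounded_supp_def by blast
qed

lemma bounded_supp_add: "bounded_supp f \<Longrightarrow> bounded_supp g \<Longrightarrow> bounded_supp (\<lambda>z. f z + (g z :: 'b::monoid_add))"
  unfolding bounded_supp_def
proof (elim exE)
  fix R S assume "\<forall>z. R \<le> cmod z \<longrightarrow> f z = 0" "\<forall>z. S \<le> cmod z \<longrightarrow> g z = 0"
  then show "\<exists>R. \<forall>z. R \<le> cmod z \<longrightarrow> f z + g z = 0"
    by (intro exI[of _ "max R S"]) auto
qed

lemma bounded_supp_pd:
  assumes "bounded_supp f" shows "bounded_supp (pd e f)"
proof -
  obtain R where "R > 0" and R: "\<And>z. R \<le> cmod z \<Longrightarrow> f z = 0" using bounded_suppE[OF assms] by blast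
  \<comment> \<open>One unit beyond \<open>R\<close>, so that \<open>z\<close> lies in the open set
    outside \<open>cball 0 R\<close>, on which \<open>f\<close> vanishes.\<close>
  have "pd e f z = 0" if "R + 1 \<le> cmod z" for z
  proof -
    have "pd e f z = pd e (\<lambda>_. 0) z"
      using that R by (intro pd_cong_open[of "- cball 0 R"]) auto
    then show ?thesis by simp
  qed
  then show ?thesis unfolding bounded_supp_def by blast
qed

lemma integrable_bounded_supp:
  fixes f :: "complex \<Rightarrow> 'b::{banach, second_countable_topology}"
  assumes "continuous_on UNIV f" "bounded_supp f"
  shows "integrable lborel f"
proof -
  obtain R where "R > 0" and R: "\<And>z. R \<le> cmod z \<Longrightarrow> f z = 0" using bounded_suppE[OF assms(2)] by blast
  have "integrable lborel (\<lambda>z. indicator (cball 0 R) z *\<^sub>R f z)"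
    using assms(1) by (intro borel_integrable_compact) (auto intro: continuous_on_subset)
  moreover have "(\<lambda>z. indicator (cball 0 R) z *\<^sub>R f z) = f"
    using R by (auto simp: indicator_def fun_eq_iff)
  ultimately show ?thesis by simp
qed

lemma bounded_bounded_supp:
  fixes f :: "complex \<Rightarrow> 'b::real_normed_vector"
  assumes "continuous_on UNIV f" "bounded_supp f"
  obtains M where "M > 0" "\<And>z. norm (f z) \<le> M"
proof -
  obtain R where "R > 0" and R: "\<And>z. R \<le> cmod z \<Longrightarrow> f z = 0" using bounded_suppE[OF assms(2)] by blast
  have "compact (f ` cball 0 R)"
    using assms(1) by (intro compact_continuous_image) (auto intro: continuous_on_subset)
  then obtain M where M: "M > 0" "\<And>z. z \<in> cball 0 R \<Longrightarrow> norm (f z) \<le> M"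
    by (auto dest!: compact_imp_bounded simp: bounded_pos)
  have "norm (f z) \<le> M" for z
    using M R[of z] by (cases "cmod z \<le> R") auto
  with M(1) show ?thesis using that by blast
qed

section \<open>Translations, reflections and difference quotients\<close>

lemma lborel_distr_affine1:
  fixes t :: complex
  assumes "c = 1 \<or> c = -1"
  shows "distr lborel borel (\<lambda>x. t + c *\<^sub>R x) = (lborel :: complex measure)"
  using assms lborel_affine[of c t] by (auto simp: density_1)

lemma lebesgue_integral_shift:
  fixes f :: "complex \<Rightarrow> 'b::{banach, second_countable_topology}"
  assumes [measurable]: "f \<in> borel_measurable borel"
  shows "(LINT z|lborel. f (z + a)) = (LINT z|lborel. f z)"
  using integral_distr[of "\<lambda>x. a + 1 *\<^sub>R x" lborel borel f] lborel_distr_affine1[of 1 a]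
  by (simp add: add.commute)

lemma lebesgue_integral_reflect:
  fixes f :: "complex \<Rightarrow> 'b::{banach, second_countable_topology}"
  assumes [measurable]: "f \<in> borel_measurable borel"
  shows "(LINT z|lborel. f (a - z)) = (LINT z|lborel. f z)"
  using integral_distr[of "\<lambda>x. a + (-1) *\<^sub>R x" lborel borel f] lborel_distr_affine1[of "-1" a]
  by simp

lemma integrable_reflect:
  fixes f :: "complex \<Rightarrow> 'b::{banach, second_countable_topology}"
  assumes [measurable]: "f \<in> borel_measurable borel" and "integrable lborel f"
  shows "integrable lborel (\<lambda>z. f (a - z))"
  using integrable_distr_eq[of "\<lambda>x. a + (-1) *\<^sub>R x" lborel borel f] lborel_distr_affine1[of "-1" a] assms(2)
  by simp

text \<open>The mean value inequality on a convex ball. It supplies the dominating constant for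
  difference quotients, and later the Hoelder continuity of C^1 functions.\<close>

lemma Ck1_lipschitz_cball:
  fixes f :: "complex \<Rightarrow> 'b::real_normed_vector"
  assumes "Ck_on 1 UNIV f"
  obtains M where "M > 0" "\<And>x y. x \<in> cball 0 R \<Longrightarrow> y \<in> cball 0 R \<Longrightarrow> norm (f x - f y) \<le> M * cmod (x - y)"
proof -
  have d: "f differentiable (at z)" and c: "continuous_on UNIV (pdx f)" "continuous_on UNIV (pdy f)" for z
    using assms by (auto simp: One_nat_def)
  have "continuous_on UNIV (\<lambda>z. norm (pdx f z) + norm (pdy f z))"
    by (intro continuous_intros c)
  then have "compact ((\<lambda>z. norm (pdx f z) + norm (pdy f z)) ` cball 0 R)"
    by (intro compact_continuous_image) (auto intro: continuous_on_subset)
  then obtain M where M: "M > 0" "\<And>z. z \<in> cball 0 R \<Longrightarrow> norm (pdx f z) + norm (pdy f z) \<le> M"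
    by (auto dest!: compact_imp_bounded simp: bounded_pos)
  have "norm (f x - f y) \<le> M * cmod (x - y)" if "x \<in> cball 0 R" "y \<in> cball 0 R" for x y
  proof (rule differentiable_bound[of "cball 0 R" f "\<lambda>z h. Re h *\<^sub>R pdx f z + Im h *\<^sub>R pdy f z", OF _ _ _ that])
    fix z :: complex assume z: "z \<in> cball 0 R"
    show "(f has_derivative (\<lambda>h. Re h *\<^sub>R pdx f z + Im h *\<^sub>R pdy f z)) (at z within cball 0 R)"
      using has_derivative_at_withinI[OF has_derivative_pdx_pdy[OF d]] .
    show "onorm (\<lambda>h. Re h *\<^sub>R pdx f z + Im h *\<^sub>R pdy f z) \<le> M"
    proof (rule onorm_bound)
      fix h :: complex
      have "norm (Re h *\<^sub>R pdx f z + Im h *\<^sub>R pdy f z) \<le> \<bar>Re h\<bar> * norm (pdx f z) + \<bar>Im h\<bar> * norm (pdy f z)"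
        by (rule order_trans[OF norm_triangle_ineq]) simp
      also have "\<dots> \<le> cmod h * norm (pdx f z) + cmod h * norm (pdy f z)"
        by (intro add_mono mult_right_mono abs_Re_le_cmod abs_Im_le_cmod) auto
      also have "\<dots> \<le> M * cmod h"
        using mult_right_mono[OF M(2)[OF z], of "cmod h"] by (simp add: algebra_simps)
      finally show "norm (Re h *\<^sub>R pdx f z + Im h *\<^sub>R pdy f z) \<le> M * cmod h" .
    qed (use M in auto)
  qed auto
  with M(1) show ?thesis using that by blast
qed

lemma diff_quot_tendsto:
  fixes f :: "complex \<Rightarrow> 'b::real_normed_vector"
  assumes d: "f differentiable (at z)" and h: "h \<longlonglongrightarrow> 0" "\<And>n. h n \<noteq> 0" and e: "cmod e = 1"
  shows "(\<lambda>n. (f (z + of_real (h n) * e) - f z) /\<^sub>R h n) \<longlonglongrightarrow> pd e f z"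
proof -
  have D: "(f has_derivative (\<lambda>e. pd e f z)) (at z)" by (rule has_derivative_pd[OF d])
  have "((\<lambda>y. (f y - f z - pd (y - z) f z) /\<^sub>R norm (y - z)) \<longlongrightarrow> 0) (at z)"
    using D by (simp add: has_derivative_def Lim_ident_at)
  moreover have "filterlim (\<lambda>n. z + of_real (h n) * e) (at z) sequentially"
    unfolding filterlim_at
    using h(2) e by (auto intro!: tendsto_eq_intros h(1))
  ultimately have "(\<lambda>n. (f (z + of_real (h n) * e) - f z - pd (of_real (h n) * e) f z) /\<^sub>R norm (of_real (h n) * e)) \<longlonglongrightarrow> 0"
    using filterlim_compose by fastforce
  moreover have "pd (of_real (h n) * e) f z = h n *\<^sub>R pd e f z" for n
    using linear_scale[OF has_derivative_linear[OF D], of "h n" e] by (simp add: scaleR_conv_of_real)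
  ultimately have "(\<lambda>n. norm ((f (z + of_real (h n) * e) - f z - h n *\<^sub>R pd e f z) /\<^sub>R \<bar>h n\<bar>)) \<longlonglongrightarrow> 0"
    using e tendsto_norm_zero by (auto simp: norm_mult simp del: norm_scaleR)
  moreover have "norm ((f (z + of_real (h n) * e) - f z - h n *\<^sub>R pd e f z) /\<^sub>R \<bar>h n\<bar>)
      = norm ((f (z + of_real (h n) * e) - f z) /\<^sub>R h n - pd e f z)" for n
  proof -
    have "norm ((f (z + of_real (h n) * e) - f z) /\<^sub>R h n - pd e f z)
       = norm ((1 / h n) *\<^sub>R (f (z + of_real (h n) * e) - f z - h n *\<^sub>R pd e f z))"
      using h(2)[of n] by (simp add: scaleR_diff_right divide_inverse)
    then show ?thesis by (simp add: divide_inverse)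
  qed
  ultimately have "(\<lambda>n. norm ((f (z + of_real (h n) * e) - f z) /\<^sub>R h n - pd e f z)) \<longlonglongrightarrow> 0"
    by simp
  then show ?thesis
    by (simp add: LIM_zero_cancel tendsto_norm_zero_iff)
qed

lemma diff_quot_integral_tendsto:
  fixes f g :: "complex \<Rightarrow> complex"
  assumes f: "Ck_on 1 UNIV f" and g: "continuous_on UNIV g" "bounded_supp g \<or> bounded_supp f"
    and h: "h \<longlonglongrightarrow> 0" "\<And>n. h n \<noteq> 0" "\<And>n. \<bar>h n\<bar> \<le> 1" and e: "e = 1 \<or> e = \<i>"
  shows "(\<lambda>n. LINT z|lborel. g z * ((f (z + of_real (h n) * e) - f z) /\<^sub>R h n)) \<longlonglongrightarrow> (LINT z|lborel. g z * pd e f z)"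
proof -
  have e1: "cmod e = 1" using e by auto
  \<comment> \<open>The radius belongs to whichever factor has bounded support. Integration by parts
    uses both versions, once with the bounded support on the multiplier and once on the function
    that is differenced.\<close>
  have "\<exists>R>0. (bounded_supp g \<longrightarrow> (\<forall>z. R \<le> cmod z \<longrightarrow> g z = 0)) \<and> (\<not> bounded_supp g \<longrightarrow> (\<forall>z. R \<le> cmod z \<longrightarrow> f z = 0))"
  proof (cases "bounded_supp g")
    case True then show ?thesis using bounded_suppE[OF True] by metis
  next
    case False then show ?thesis using g(2) bounded_suppE[of f] by metis
  qed
  then obtain R where R: "R > 0"
    and R': "\<And>z. bounded_supp g \<Longrightarrow> R \<le> cmod z \<Longrightarrow> g z = 0" "\<And>z. \<not> bounded_supp g \<Longrightarrow> R \<le> cmod z \<Longrightarrow> f z = 0"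
    by blast
  obtain M where M: "M > 0" "\<And>x y. x \<in> cball 0 (R+2) \<Longrightarrow> y \<in> cball 0 (R+2) \<Longrightarrow> norm (f x - f y) \<le> M * cmod (x - y)"
    using Ck1_lipschitz_cball[OF f] by blast
  have fc: "continuous_on UNIV f" using Ck_on_continuous[OF f] by simp
  have pc: "continuous_on UNIV (pd e f)" using f e by (auto simp: One_nat_def pdx_eq_pd pdy_eq_pd)
  have bm: "u \<in> borel_measurable lborel" if "continuous_on UNIV u" for u :: "complex \<Rightarrow> complex"
    using borel_measurable_continuous_onI[OF that] by simp
  have ze: "cmod (z + of_real (h n) * e) \<le> cmod z + 1" "cmod z - 1 \<le> cmod (z + of_real (h n) * e)" for z n
    using h(3)[of n] norm_triangle_ineq[of z "of_real (h n) * e"]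
      norm_triangle_ineq2[of z "- (of_real (h n) * e)"] e1 by (simp_all add: norm_mult)
  show ?thesis
  \<comment> \<open>When \<open>f\<close> carries the bounded support, its difference quotient can
    reach out to \<open>R + 1\<close>. The Lipschitz constant was taken on radius
    \<open>R + 2\<close>, which contains a point of that ball together with its shift by at most
    1.\<close>
  proof (rule integral_dominated_convergence[where w="\<lambda>z. indicator (cball 0 (R+1)) z *\<^sub>R (norm (g z) * M)"])
    show "(\<lambda>z. g z * pd e f z) \<in> borel_measurable lborel"
      by (intro bm continuous_intros g pc)
    show "(\<lambda>z. g z * ((f (z + of_real (h n) * e) - f z) /\<^sub>R h n)) \<in> borel_measurable lborel" for n
      by (intro bm continuous_intros g fc continuous_on_compose2[OF fc]) auto
    show "integrable lborel (\<lambda>z. indicator (cball 0 (R+1)) z *\<^sub>R (norm (g z) * M))"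
      by (intro borel_integrable_compact compact_cball continuous_intros continuous_on_subset[OF g(1)]) auto
    show "AE z in lborel. (\<lambda>n. g z * ((f (z + of_real (h n) * e) - f z) /\<^sub>R h n)) \<longlonglongrightarrow> g z * pd e f z"
      by (intro AE_I2 tendsto_mult[OF tendsto_const] diff_quot_tendsto h e1)
        (use f in \<open>simp add: One_nat_def\<close>)
    show "AE z in lborel. norm (g z * ((f (z + of_real (h n) * e) - f z) /\<^sub>R h n)) \<le> indicator (cball 0 (R+1)) z *\<^sub>R (norm (g z) * M)" for n
    proof (rule AE_I2)
      fix z
      show "norm (g z * ((f (z + of_real (h n) * e) - f z) /\<^sub>R h n)) \<le> indicator (cball 0 (R+1)) z *\<^sub>R (norm (g z) * M)"
      proof (cases "R + 1 < cmod z")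
        case False
        have "norm (f (z + of_real (h n) * e) - f z) \<le> M * cmod (of_real (h n) * e)"
          using M(2)[of "z + of_real (h n) * e" z] False ze[where z=z and n=n] by simp
        then have "norm (f (z + of_real (h n) * e) - f z) \<le> M * \<bar>h n\<bar>" using e1 by (simp add: norm_mult)
        then have "norm ((f (z + of_real (h n) * e) - f z) /\<^sub>R h n) \<le> M"
          using h(2)[of n] by (simp add: divide_simps mult.commute)
        then have "norm (g z * ((f (z + of_real (h n) * e) - f z) /\<^sub>R h n)) \<le> norm (g z) * M"
          unfolding norm_mult by (intro mult_left_mono) auto
        then show ?thesis using False by simp
      next
        case True
        have eq: "g z * ((f (z + of_real (h n) * e) - f z) /\<^sub>R h n) = 0"
        proof (cases "bounded_supp g")
          case True then show ?thesis using R'(1)[of z] \<open>R + 1 < cmod z\<close> by simp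
        next
          case bg: False
          have "f z = 0" "f (z + of_real (h n) * e) = 0"
            using True ze(2)[of z n] by (auto intro!: R'(2)[OF bg])
          then show ?thesis by simp
        qed
        show ?thesis unfolding eq using M(1) by simp
      qed
    qed
  qed
qed

lemma Ck1_cont: "Ck_on 1 UNIV f \<Longrightarrow> continuous_on UNIV f"
  using Ck_on_continuous by blast

lemma Ck1_pd_cont: "Ck_on 1 UNIV f \<Longrightarrow> e = 1 \<or> e = \<i> \<Longrightarrow> continuous_on UNIV (pd e f)"
  by (auto simp: One_nat_def pdx_eq_pd pdy_eq_pd)

lemma Ck1_diff: "Ck_on 1 UNIV f \<Longrightarrow> f differentiable (at z)"
  by (simp add: One_nat_def)

text \<open>Discrete integration by parts: translation invariance moves the difference operator to
  the other factor and reverses the shift. Continuity of \<open>f\<close> is enough, so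
  \<open>f\<close> may itself be a first derivative of a C^1 function.\<close>

lemma integral_shift_swap:
  fixes f g :: "complex \<Rightarrow> complex"
  assumes f: "continuous_on UNIV f" and g: "continuous_on UNIV g" "bounded_supp g"
  shows "(LINT z|lborel. g z * ((f (z + a) - f z) /\<^sub>R h)) = (LINT z|lborel. f z * ((g (z + - a) - g z) /\<^sub>R h))"
proof -
  have c: "continuous_on UNIV (\<lambda>z. u (z + b))" if "continuous_on UNIV u" for u :: "complex \<Rightarrow> complex" and b
    by (intro continuous_on_compose2[OF that] continuous_intros) auto
  have bs: "bounded_supp (\<lambda>z. g z * u z)" for u using g(2) by (rule bounded_supp_mono) auto
  have bs': "bounded_supp (\<lambda>z. f z * g (z + - a))" by (rule bounded_supp_mono[OF bounded_supp_shift[OF g(2), of "-a"]]) auto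
  have i: "integrable lborel (\<lambda>z. g z * f (z + a))" "integrable lborel (\<lambda>z. g z * f z)"
      "integrable lborel (\<lambda>z. f z * g (z + - a))"
    by (intro integrable_bounded_supp continuous_intros f g c bs bs')+
  have m: "(\<lambda>z. f z * g (z + - a)) \<in> borel_measurable borel"
    by (intro borel_measurable_continuous_onI continuous_intros f g c)
  have s: "(LINT z|lborel. g z * f (z + a)) = (LINT z|lborel. f z * g (z + - a))"
    using lebesgue_integral_shift[OF m, of a] by (simp add: mult.commute)
  have "(LINT z|lborel. g z * ((f (z + a) - f z) /\<^sub>R h)) = (LINT z|lborel. (g z * f (z + a) - g z * f z) /\<^sub>R h)"
    by (intro Bochner_Integration.integral_cong refl) (simp add: algebra_simps)
  also have "\<dots> = ((LINT z|lborel. f z * g (z + - a)) - (LINT z|lborel. g z * f z)) /\<^sub>R h"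
    using i s by simp
  also have "\<dots> = (LINT z|lborel. (f z * g (z + - a) - g z * f z) /\<^sub>R h)"
    using i by simp
  also have "\<dots> = (LINT z|lborel. f z * ((g (z + - a) - g z) /\<^sub>R h))"
    by (intro Bochner_Integration.integral_cong refl) (simp add: algebra_simps)
  finally show ?thesis .
qed

lemma inverse_Suc_seq: "(\<lambda>n. inverse (real (Suc n))) \<longlonglongrightarrow> 0" "inverse (real (Suc n)) \<noteq> 0"
   "\<bar>inverse (real (Suc n))\<bar> \<le> 1"
  using LIMSEQ_inverse_real_of_nat by (auto simp: divide_simps)

text \<open>The limit of the discrete identity: step \<open>h n\<close> for \<open>f\<close> turns
  into step \<open>- h n\<close> for \<open>g\<close>, which accounts for the sign.\<close>

lemma integral_pd_parts:
  fixes f g :: "complex \<Rightarrow> complex"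
  assumes f: "Ck_on 1 UNIV f" and g: "Ck_on 1 UNIV g" "bounded_supp g" and e: "e = 1 \<or> e = \<i>"
  shows "(LINT z|lborel. g z * pd e f z) = - (LINT z|lborel. pd e g z * f z)"
proof -
  define h where "h n = inverse (real (Suc n))" for n
  note h = inverse_Suc_seq[folded h_def]
  have mh: "(\<lambda>n. - h n) \<longlonglongrightarrow> 0" "- h n \<noteq> 0" "\<bar>- h n\<bar> \<le> 1" for n
    using tendsto_minus[OF h(1)] h(2,3) by auto
  have 1: "(\<lambda>n. LINT z|lborel. g z * ((f (z + of_real (h n) * e) - f z) /\<^sub>R h n)) \<longlonglongrightarrow> (LINT z|lborel. g z * pd e f z)"
    by (rule diff_quot_integral_tendsto[OF f Ck1_cont[OF g(1)] disjI1[OF g(2)] h e])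
  have 2: "(\<lambda>n. LINT z|lborel. f z * ((g (z + of_real (- h n) * e) - g z) /\<^sub>R (- h n))) \<longlonglongrightarrow> (LINT z|lborel. f z * pd e g z)"
    by (rule diff_quot_integral_tendsto[OF g(1) Ck1_cont[OF f] disjI2[OF g(2)] mh e])
  have "(LINT z|lborel. f z * ((g (z + of_real (- h n) * e) - g z) /\<^sub>R (- h n)))
      = - (LINT z|lborel. g z * ((f (z + of_real (h n) * e) - f z) /\<^sub>R h n))" for n
    using integral_shift_swap[OF Ck1_cont[OF f] Ck1_cont[OF g(1)] g(2), where a = "of_real (h n) * e" and h = "h n"]
    by auto
  then have "(\<lambda>n. - (LINT z|lborel. g z * ((f (z + of_real (h n) * e) - f z) /\<^sub>R h n))) \<longlonglongrightarrow> (LINT z|lborel. f z * pd e g z)"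
    using 2 by (simp only:)
  then have "(LINT z|lborel. f z * pd e g z) = - (LINT z|lborel. g z * pd e f z)"
    using LIMSEQ_unique tendsto_minus[OF 1] by blast
  then show ?thesis by (simp add: mult.commute)
qed

text \<open>Weak symmetry of the mixed second derivatives, for functions that have only first ones.
  The derivative of \<open>f\<close> along \<i> is replaced by the difference quotient
  \<open>A n\<close>, which is still C^1; its derivative along 1 is a difference quotient of
  \<open>pd 1 f\<close>, and the difference is then shifted to \<open>g\<close>.\<close>

lemma integral_pd_commute:
  fixes f g :: "complex \<Rightarrow> complex"
  assumes f: "Ck_on 1 UNIV f" and g: "Ck_on 1 UNIV g" "bounded_supp g"
  shows "(LINT z|lborel. pdx g z * pdy f z) = (LINT z|lborel. pdy g z * pdx f z)"
proof -
  define h where "h n = inverse (real (Suc n))" for n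
  note h = inverse_Suc_seq[folded h_def]
  have mh: "(\<lambda>n. - h n) \<longlonglongrightarrow> 0" "- h n \<noteq> 0" "\<bar>- h n\<bar> \<le> 1" for n
    using tendsto_minus[OF h(1)] h(2,3) by auto
  define A where "A n z = (f (z + of_real (h n) * \<i>) - f z) /\<^sub>R h n" for n z
  have sh: "Ck_on 1 UNIV (\<lambda>z. f (z + a))" for a
    by (rule Ck_compose_plane[OF f Ck_add[OF Ck_ident Ck_const]])
  have pdsh: "pd 1 (\<lambda>z. f (z + a)) z = pd 1 f (z + a)" for a z
  proof -
    have "pd 1 (\<lambda>z. z + a) z = (1::complex)"
      by (subst pd_add) auto
    then show ?thesis
      using pd_compose_plane[of f "\<lambda>z. z + a" z 1] Ck1_diff[OF f] by (simp add: pdx_eq_pd)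
  qed
  have A1: "Ck_on 1 UNIV (A n)" for n
    unfolding A_def by (intro Ck_bounded_linear[OF bounded_linear_scaleR_right] Ck_minus_diff sh f)
  have pdA: "pd 1 (A n) z = (pd 1 f (z + of_real (h n) * \<i>) - pd 1 f z) /\<^sub>R h n" for n z
    unfolding A_def
    by (subst pd_bounded_linear[OF bounded_linear_scaleR_right])
       (auto intro!: derivative_intros Ck1_diff[OF sh] Ck1_diff[OF f] simp: pd_diff pdsh Ck1_diff[OF sh] Ck1_diff[OF f])
  have c1: "continuous_on UNIV (pd 1 f)" using Ck1_pd_cont[OF f] by simp
  have 1: "(\<lambda>n. LINT z|lborel. pd 1 g z * A n z) \<longlonglongrightarrow> (LINT z|lborel. pd 1 g z * pd \<i> f z)"
    unfolding A_def
    by (rule diff_quot_integral_tendsto[OF f Ck1_pd_cont[OF g(1)] disjI1[OF bounded_supp_pd[OF g(2)]] h]) auto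
  have 2: "(\<lambda>n. LINT z|lborel. pd 1 f z * ((g (z + of_real (- h n) * \<i>) - g z) /\<^sub>R (- h n))) \<longlonglongrightarrow> (LINT z|lborel. pd 1 f z * pd \<i> g z)"
    by (rule diff_quot_integral_tendsto[OF g(1) c1 disjI2[OF g(2)] mh]) auto
  have "(LINT z|lborel. pd 1 f z * ((g (z + of_real (- h n) * \<i>) - g z) /\<^sub>R (- h n)))
     = (LINT z|lborel. pd 1 g z * A n z)" for n
  proof -
    have "(LINT z|lborel. pd 1 f z * ((g (z + of_real (- h n) * \<i>) - g z) /\<^sub>R (- h n)))
      = - (LINT z|lborel. g z * ((pd 1 f (z + of_real (h n) * \<i>) - pd 1 f z) /\<^sub>R h n))"
      using integral_shift_swap[OF c1 Ck1_cont[OF g(1)] g(2), where a = "of_real (h n) * \<i>" and h = "h n"] by auto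
    also have "\<dots> = - (LINT z|lborel. g z * pd 1 (A n) z)" by (simp add: pdA)
    also have "\<dots> = (LINT z|lborel. pd 1 g z * A n z)"
      using integral_pd_parts[OF A1 g, of 1 n] by simp
    finally show ?thesis .
  qed
  then show ?thesis
    using LIMSEQ_unique[OF 1] 2 by (simp add: pdx_eq_pd pdy_eq_pd mult.commute)
qed

lemma integrable_mult_bounded_supp:
  fixes f g :: "complex \<Rightarrow> complex"
  assumes "continuous_on UNIV f" "continuous_on UNIV g" "bounded_supp g"
  shows "integrable lborel (\<lambda>z. f z * g z)" "integrable lborel (\<lambda>z. g z * f z)"
  using assms by (auto intro!: integrable_bounded_supp continuous_intros elim: bounded_supp_mono)

lemma bounded_supp_wirt:
  assumes "bounded_supp g" shows "bounded_supp (wirt g)" "bounded_supp (wirt_bar g)"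
proof -
  have "bounded_supp (\<lambda>z. norm (pd e g z))" for e
    using bounded_supp_pd[OF assms] by (rule bounded_supp_mono) simp
  then have b: "bounded_supp (\<lambda>z. norm (pd 1 g z) + norm (pd \<i> g z))"
    by (intro bounded_supp_add)
  show "bounded_supp (wirt g)" "bounded_supp (wirt_bar g)"
    by (rule bounded_supp_mono[OF b];
        simp add: wirt_def wirt_bar_def pdx_eq_pd pdy_eq_pd add_nonneg_eq_0_iff)+
qed

lemma Ck1_wirt_cont:
  "Ck_on 1 UNIV f \<Longrightarrow> continuous_on UNIV (wirt f)" "Ck_on 1 UNIV f \<Longrightarrow> continuous_on UNIV (wirt_bar f)"
  using Ck_wirt[of 0 f] by (auto simp: One_nat_def)

lemma integral_wirt_parts:
  fixes f g :: "complex \<Rightarrow> complex"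
  assumes f: "Ck_on 1 UNIV f" and g: "Ck_on 1 UNIV g" "bounded_supp g"
  shows "(LINT z|lborel. g z * wirt f z) = - (LINT z|lborel. wirt g z * f z)"
    "(LINT z|lborel. g z * wirt_bar f z) = - (LINT z|lborel. wirt_bar g z * f z)"
proof -
  note i = integrable_mult_bounded_supp[OF Ck1_pd_cont[OF f] Ck1_cont[OF g(1)] g(2)]
    integrable_mult_bounded_supp[OF Ck1_cont[OF f] Ck1_pd_cont[OF g(1)] bounded_supp_pd[OF g(2)]]
  have *: "(LINT z|lborel. g z * (pd 1 f z + c * pd \<i> f z)) = - (LINT z|lborel. (pd 1 g z + c * pd \<i> g z) * f z)" for c
  proof -
    have "(LINT z|lborel. g z * (pd 1 f z + c * pd \<i> f z)) = (LINT z|lborel. g z * pd 1 f z + c * (g z * pd \<i> f z))"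
      by (simp add: algebra_simps)
    also have "\<dots> = (LINT z|lborel. g z * pd 1 f z) + c * (LINT z|lborel. g z * pd \<i> f z)"
      using i(2)[of 1] i(2)[of \<i>] by simp
    also have "\<dots> = - ((LINT z|lborel. pd 1 g z * f z) + c * (LINT z|lborel. pd \<i> g z * f z))"
      using integral_pd_parts[OF f g] by simp
    also have "(LINT z|lborel. pd 1 g z * f z) + c * (LINT z|lborel. pd \<i> g z * f z) = (LINT z|lborel. pd 1 g z * f z + c * (pd \<i> g z * f z))"
      using i(4)[of 1] i(4)[of \<i>] by simp
    finally show ?thesis by (simp add: algebra_simps)
  qed
  have w: "(LINT z|lborel. u z / 2) = (LINT z|lborel. u z) / 2" for u :: "complex \<Rightarrow> complex" by simp
  show "(LINT z|lborel. g z * wirt f z) = - (LINT z|lborel. wirt g z * f z)"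
    using *[of "-\<i>"] w[of "\<lambda>z. g z * (pd 1 f z + (-\<i>) * pd \<i> f z)"] w[of "\<lambda>z. (pd 1 g z + (-\<i>) * pd \<i> g z) * f z"]
    by (simp add: wirt_def pdx_eq_pd pdy_eq_pd)
  show "(LINT z|lborel. g z * wirt_bar f z) = - (LINT z|lborel. wirt_bar g z * f z)"
    using *[of "\<i>"] w[of "\<lambda>z. g z * (pd 1 f z + (\<i>) * pd \<i> f z)"] w[of "\<lambda>z. (pd 1 g z + (\<i>) * pd \<i> g z) * f z"]
    by (simp add: wirt_bar_def pdx_eq_pd pdy_eq_pd)
qed

text \<open>The two integrands differ by \<i>/2 times \<open>pdx g * pdy f - pdy g * pdx f\<close>.
  This is what allows the Beltrami equation for the C^1 map \<open>G\<close> to be differentiated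
  weakly.\<close>

lemma integral_wirt_commute:
  fixes f g :: "complex \<Rightarrow> complex"
  assumes f: "Ck_on 1 UNIV f" and g: "Ck_on 1 UNIV g" "bounded_supp g"
  shows "(LINT z|lborel. wirt g z * wirt_bar f z) = (LINT z|lborel. wirt_bar g z * wirt f z)"
proof -
  have i: "integrable lborel (\<lambda>z. pd e g z * pd e' f z)" if "e = 1 \<or> e = \<i>" "e' = 1 \<or> e' = \<i>" for e e'
    using integrable_mult_bounded_supp(2)[OF Ck1_pd_cont[OF f] Ck1_pd_cont[OF g(1)] bounded_supp_pd[OF g(2)]] that by blast
  have iw: "integrable lborel (\<lambda>z. wirt g z * wirt_bar f z)" "integrable lborel (\<lambda>z. wirt_bar g z * wirt f z)"
    using integrable_mult_bounded_supp(2)[OF Ck1_wirt_cont(2)[OF f] Ck1_wirt_cont(1)[OF g(1)] bounded_supp_wirt(1)[OF g(2)]]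
      integrable_mult_bounded_supp(2)[OF Ck1_wirt_cont(1)[OF f] Ck1_wirt_cont(2)[OF g(1)] bounded_supp_wirt(2)[OF g(2)]] by auto
  have "(LINT z|lborel. wirt g z * wirt_bar f z) - (LINT z|lborel. wirt_bar g z * wirt f z)
     = (LINT z|lborel. wirt g z * wirt_bar f z - wirt_bar g z * wirt f z)"
    using iw by simp
  also have "\<dots> = (LINT z|lborel. (\<i>/2) * (pd 1 g z * pd \<i> f z - pd \<i> g z * pd 1 f z))"
    by (intro Bochner_Integration.integral_cong refl)
      (simp add: wirt_def wirt_bar_def pdx_eq_pd pdy_eq_pd field_simps)
  also have "\<dots> = (\<i>/2) * ((LINT z|lborel. pd 1 g z * pd \<i> f z) - (LINT z|lborel. pd \<i> g z * pd 1 f z))"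
    using i by simp
  also have "\<dots> = 0" using integral_pd_commute[OF f g] by (simp add: pdx_eq_pd pdy_eq_pd)
  finally show ?thesis by simp
qed

section \<open>Radial cutoff functions\<close>

text \<open>A spline, equal to 1 up to t = 1 and to 0 from t = 2 on. The cube of a positive part is
  C^2: the inner cube lets the function leave the value 1 smoothly, the outer one lets it arrive at
  0 smoothly. Class C^2 makes the first derivatives of the cutoff Hoelder continuous.\<close>

definition cutoff :: "real \<Rightarrow> real" where
  "cutoff t = (max 0 (1 - (max 0 (t - 1)) ^ 3)) ^ 3"

definition cutoff' :: "real \<Rightarrow> real" where
  "cutoff' t = - 9 * (max 0 (1 - (max 0 (t - 1)) ^ 3)) ^ 2 * (max 0 (t - 1)) ^ 2"

lemma has_real_derivative_max0_power:
  "((\<lambda>x::real. (max 0 x) ^ Suc (Suc n)) has_real_derivative real (n + 2) * (max 0 x) ^ Suc n) (at x)"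
proof -
  consider "x < 0" | "x = 0" | "x > 0" by linarith
  then show ?thesis
  proof cases
    case 1
    have "((\<lambda>x::real. 0) has_real_derivative 0) (at x)" by simp
    then show ?thesis
      by (subst DERIV_cong_ev[OF refl _ refl, of _ "\<lambda>_. 0"])
        (use 1 in \<open>auto intro!: eventually_mono[OF eventually_nhds_in_open[of "{..<0}" x]]\<close>)
  next
    case 3
    have "((\<lambda>x::real. x ^ Suc (Suc n)) has_real_derivative real (n + 2) * x ^ Suc n) (at x)"
      using DERIV_pow[of "Suc (Suc n)" x] by simp
    then show ?thesis
      by (subst DERIV_cong_ev[OF refl _ refl, of _ "\<lambda>x. x ^ Suc (Suc n)"])
        (use 3 in \<open>auto intro!: eventually_mono[OF eventually_nhds_in_open[of "{0<..}" x]]\<close>)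
  next
    case 2
    have "(\<lambda>h::real. (max 0 h) ^ Suc (Suc n) / h) \<midarrow>0\<rightarrow> 0"
    proof (rule Lim_null_comparison)
      show "\<forall>\<^sub>F h in at 0. norm ((max 0 h) ^ Suc (Suc n) / h) \<le> \<bar>h\<bar> ^ Suc n"
      proof (intro always_eventually allI)
        fix h :: real
        show "norm ((max 0 h) ^ Suc (Suc n) / h) \<le> \<bar>h\<bar> ^ Suc n"
        proof (cases "h > 0")
          case False
          then have "max 0 h = 0" by simp
          then show ?thesis by (simp del: power_Suc add: power_0_left)
        qed simp
      qed
      show "(\<lambda>h::real. \<bar>h\<bar> ^ Suc n) \<midarrow>0\<rightarrow> 0"
        using tendsto_power[OF tendsto_rabs[OF tendsto_ident_at[of "0::real" UNIV]], of "Suc n"] by simp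
    qed
    then show ?thesis using 2 by (simp add: DERIV_def)
  qed
qed

lemma cutoff_deriv: "(cutoff has_real_derivative cutoff' t) (at t)"
proof -
  have c: "((\<lambda>t. (max 0 t) ^ 3) has_real_derivative 3 * (max 0 t)^2) (at t)" for t :: real
    using has_real_derivative_max0_power[of 1 t] by (simp add: numeral_3_eq_3 numeral_2_eq_2)
  have a: "((\<lambda>t. (max 0 (t - 1)) ^ 3) has_real_derivative 3 * (max 0 (t - 1))^2) (at t)" for t :: real
  proof -
    have "((\<lambda>t. t - 1) has_real_derivative 1) (at t)" by (auto intro!: derivative_eq_intros)
    from DERIV_chain2[where f="\<lambda>t. (max 0 t) ^ 3" and g="\<lambda>t. t - 1" and x=t, OF c this]
    show ?thesis unfolding mult_1_right .
  qed
  have b: "((\<lambda>t. 1 - (max 0 (t - 1)) ^ 3) has_real_derivative - (3 * (max 0 (t - 1))^2)) (at t)"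
    by (rule DERIV_cong[OF DERIV_diff[OF DERIV_const a]]) simp
  show ?thesis
    using DERIV_chain2[where f="\<lambda>t. (max 0 t) ^ 3" and g="\<lambda>t. 1 - (max 0 (t - 1)) ^ 3", OF c b]
    by (simp add: cutoff_def[abs_def] cutoff'_def mult.assoc)
qed

lemma cutoff'_Ck: 
  fixes f :: "complex \<Rightarrow> real"
  assumes "Ck_on 1 UNIV f" shows "Ck_on 1 UNIV (\<lambda>z. cutoff' (f z))"
proof -
  have m: "Ck_on 1 UNIV (\<lambda>z. (max 0 (g z)) ^ Suc (Suc n))" if g: "Ck_on 1 UNIV g" for g :: "complex \<Rightarrow> real" and n
    unfolding One_nat_def
    by (rule Ck_compose_real[OF g[unfolded One_nat_def] has_real_derivative_max0_power])
       (auto intro!: continuous_intros Ck1_cont[OF g])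
  have 1: "Ck_on 1 UNIV (\<lambda>z. - 9 * (max 0 (1 - (max 0 (f z - 1)) ^ Suc (Suc 1))) ^ Suc (Suc 0) * (max 0 (f z - 1)) ^ Suc (Suc 0))"
    by (intro Ck_mult Ck_const m Ck_minus_diff assms)
  then show ?thesis by (simp add: cutoff'_def numeral_3_eq_3 numeral_2_eq_2)
qed

lemma cutoff_Ck: 
  fixes f :: "complex \<Rightarrow> real"
  assumes f: "Ck_on 2 UNIV f" shows "Ck_on 2 UNIV (\<lambda>z. cutoff (f z))"
  unfolding numeral_2_eq_2
  by (rule Ck_compose_real[OF f[unfolded numeral_2_eq_2] cutoff_deriv])
    (use cutoff'_Ck[of f] Ck_on_mono[OF f, of 1] in auto)

text \<open>The bound 9 is the coefficient in \<open>cutoff'\<close>, whose other factors are at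
  most 1 for t < 2. The value at 3/2 is the witness that the constant \<open>c0\<close> below is not
  zero.\<close>

lemma cutoff_simps: "t \<le> 1 \<Longrightarrow> cutoff t = 1" "t \<ge> 2 \<Longrightarrow> cutoff t = 0" "0 \<le> cutoff t" "cutoff t \<le> 1"
  and cutoff'_simps: "t \<le> 1 \<Longrightarrow> cutoff' t = 0" "t \<ge> 2 \<Longrightarrow> cutoff' t = 0" "cutoff' t \<le> 0" "\<bar>cutoff' t\<bar> \<le> 9"
    "cutoff' (3/2) \<noteq> 0"
proof -
  show "t \<le> 1 \<Longrightarrow> cutoff t = 1" by (simp add: cutoff_def)
  have 2: "max 0 (1 - (max 0 (t - 1)) ^ 3) = 0" if "t \<ge> 2"
    using that one_le_power[of "t - 1" 3] by (simp add: max_absorb1 max_absorb2)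
  then show "t \<ge> 2 \<Longrightarrow> cutoff t = 0" "t \<ge> 2 \<Longrightarrow> cutoff' t = 0" by (simp_all add: cutoff_def cutoff'_def)
  show "t \<le> 1 \<Longrightarrow> cutoff' t = 0" "cutoff' t \<le> 0" by (simp_all add: cutoff'_def)
  have 3: "max 0 (1 - (max 0 (t - 1)) ^ 3) \<le> 1" by simp
  show "0 \<le> cutoff t" "cutoff t \<le> 1" by (simp_all add: cutoff_def power_le_one)
  show "\<bar>cutoff' t\<bar> \<le> 9"
  proof (cases "t \<ge> 2")
    case False
    have "(max 0 (1 - (max 0 (t - 1)) ^ 3)) ^ 2 * (max 0 (t - 1)) ^ 2 \<le> 1 * 1"
      using False by (intro mult_mono power_le_one) auto
    moreover have "\<bar>cutoff' t\<bar> = 9 * ((max 0 (1 - (max 0 (t - 1)) ^ 3)) ^ 2 * (max 0 (t - 1)) ^ 2)"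
      by (simp add: cutoff'_def abs_mult)
    ultimately show ?thesis by simp
  qed (use 2 in \<open>simp add: cutoff'_def\<close>)
  show "cutoff' (3/2) \<noteq> 0" by (simp add: cutoff'_def max_def field_simps power_divide)
qed

text \<open>A function of |z|^2 rather than |z|: it is smooth at the origin, and its Wirtinger
  derivatives are radial factors times \<open>cnj z\<close> and \<open>z\<close>. It vanishes from
  |z| = sqrt 2 * R on; the bound 2 * R is used to keep roots out.\<close>

definition chi :: "real \<Rightarrow> complex \<Rightarrow> complex" where
  "chi R z = of_real (cutoff (((Re z)\<^sup>2 + (Im z)\<^sup>2) / R\<^sup>2))"

lemma Ck_normsq: "Ck_on k UNIV (\<lambda>z. ((Re z)\<^sup>2 + (Im z)\<^sup>2) / c)"
  unfolding divide_inverse power2_eq_square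
  by (intro Ck_mult[OF Ck_add[OF Ck_mult Ck_mult]] Ck_const Ck_Re Ck_Im Ck_ident)

lemma pd_normsq: "pd e (\<lambda>z. ((Re z)\<^sup>2 + (Im z)\<^sup>2) / c) z = 2 * (Re z * Re e + Im z * Im e) / c"
proof -
  have "((\<lambda>z. ((Re z)\<^sup>2 + (Im z)\<^sup>2) / c) has_derivative (\<lambda>e. 2 * (Re z * Re e + Im z * Im e) / c)) (at z)"
    unfolding divide_inverse
    by (auto intro!: derivative_eq_intros bounded_linear_imp_has_derivative bounded_linear_Re bounded_linear_Im simp: algebra_simps)
  then show ?thesis by (rule pd_eqI)
qed

lemma wirt_radial:
  assumes \<phi>: "(\<phi> has_real_derivative d) (at (((Re z)\<^sup>2 + (Im z)\<^sup>2) / c))"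
  shows "wirt (\<lambda>z. of_real (\<phi> (((Re z)\<^sup>2 + (Im z)\<^sup>2) / c))) z = of_real (d / c) * cnj z"
    "wirt_bar (\<lambda>z. of_real (\<phi> (((Re z)\<^sup>2 + (Im z)\<^sup>2) / c))) z = of_real (d / c) * z"
proof -
  have df: "(\<lambda>z. ((Re z)\<^sup>2 + (Im z)\<^sup>2) / c) differentiable (at z)"
    using Ck_normsq[of "Suc 0"] by (rule Ck_diff)
  have d2: "(\<lambda>z. \<phi> (((Re z)\<^sup>2 + (Im z)\<^sup>2) / c)) differentiable (at z)"
    unfolding differentiable_def
    using has_derivative_compose[OF has_derivative_pd[OF df] \<phi>[unfolded has_field_derivative_def]] by blast
  have p: "pd e (\<lambda>z. complex_of_real (\<phi> (((Re z)\<^sup>2 + (Im z)\<^sup>2) / c))) z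
      = of_real (d * (2 * (Re z * Re e + Im z * Im e) / c))" for e
    by (subst pd_bounded_linear[OF bounded_linear_of_real d2], subst pd_compose_real[OF df \<phi>], subst pd_normsq) simp
  show "wirt (\<lambda>z. of_real (\<phi> (((Re z)\<^sup>2 + (Im z)\<^sup>2) / c))) z = of_real (d / c) * cnj z"
    "wirt_bar (\<lambda>z. of_real (\<phi> (((Re z)\<^sup>2 + (Im z)\<^sup>2) / c))) z = of_real (d / c) * z"
    unfolding wirt_def wirt_bar_def pdx_eq_pd pdy_eq_pd p by (simp_all add: complex_eq_iff)
qed

lemma chi_Ck: "Ck_on 2 UNIV (chi R)" "Ck_on 1 UNIV (chi R)"
proof -
  show "Ck_on 2 UNIV (chi R)"
    unfolding chi_def[abs_def] by (intro Ck_of_real cutoff_Ck Ck_normsq)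
  then show "Ck_on 1 UNIV (chi R)" by (rule Ck_on_mono) auto
qed

lemma chi_eq_1: "R > 0 \<Longrightarrow> cmod z \<le> R \<Longrightarrow> chi R z = 1"
  using power_mono[of "cmod z" R 2] by (simp add: chi_def cutoff_simps cmod_power2)

lemma normsq_ratio_ge:
  assumes "R > 0" "2 * R \<le> cmod z"
  shows "2 \<le> ((Re z)\<^sup>2 + (Im z)\<^sup>2) / R\<^sup>2"
proof -
  have "4 * R\<^sup>2 \<le> (Re z)\<^sup>2 + (Im z)\<^sup>2"
    using power_mono[of "2 * R" "cmod z" 2] assms by (simp add: cmod_power2 power_mult_distrib)
  then have "2 * R\<^sup>2 \<le> (Re z)\<^sup>2 + (Im z)\<^sup>2"
    using zero_le_power2[of R] by linarith
  then show ?thesis using assms(1) by (simp add: pos_le_divide_eq)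
qed

lemma chi_eq_0: "R > 0 \<Longrightarrow> 2 * R \<le> cmod z \<Longrightarrow> chi R z = 0"
  unfolding chi_def by (subst cutoff_simps(2)[OF normsq_ratio_ge]) auto

lemma chi_bounded_supp: "R > 0 \<Longrightarrow> bounded_supp (chi R)"
  unfolding bounded_supp_def using chi_eq_0 by blast

lemma cmod_chi_le: "cmod (chi R z) \<le> 1"
  by (simp add: chi_def cutoff_simps)

lemma wirt_chi:
  "wirt (chi R) z = of_real (cutoff' (((Re z)\<^sup>2 + (Im z)\<^sup>2) / R\<^sup>2) / R\<^sup>2) * cnj z"
  "wirt_bar (chi R) z = of_real (cutoff' (((Re z)\<^sup>2 + (Im z)\<^sup>2) / R\<^sup>2) / R\<^sup>2) * z"
  unfolding chi_def[abs_def] by (rule wirt_radial[OF cutoff_deriv])+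

lemma cutoff'_normsq_eq_0:
  assumes "R > 0" "cmod z \<le> R \<or> 2 * R \<le> cmod z"
  shows "cutoff' (((Re z)\<^sup>2 + (Im z)\<^sup>2) / R\<^sup>2) = 0"
proof (cases "cmod z \<le> R")
  case True
  then show ?thesis using assms(1) power_mono[of "cmod z" R 2]
    by (intro cutoff'_simps(1)) (simp add: cmod_power2)
next
  case False
  then show ?thesis using assms normsq_ratio_ge by (intro cutoff'_simps(2)) auto
qed

lemma wirt_chi_bounds:
  assumes "R > 0"
  shows "cmod (wirt (chi R) z) \<le> 18 / R" "cmod (z) \<le> R \<or> 2 * R \<le> cmod z \<Longrightarrow> wirt (chi R) z = 0"
    "cmod (z) \<le> R \<or> 2 * R \<le> cmod z \<Longrightarrow> wirt_bar (chi R) z = 0"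
proof -
  show z: "cmod (z) \<le> R \<or> 2 * R \<le> cmod z \<Longrightarrow> wirt (chi R) z = 0"
    "cmod (z) \<le> R \<or> 2 * R \<le> cmod z \<Longrightarrow> wirt_bar (chi R) z = 0"
    using cutoff'_normsq_eq_0[OF assms] by (simp_all add: wirt_chi)
  show "cmod (wirt (chi R) z) \<le> 18 / R"
  proof (cases "2 * R \<le> cmod z")
    case False
    have "cmod (wirt (chi R) z) = \<bar>cutoff' (((Re z)\<^sup>2 + (Im z)\<^sup>2) / R\<^sup>2)\<bar> / R\<^sup>2 * cmod z"
      by (simp add: wirt_chi norm_mult norm_divide norm_power del: of_real_divide of_real_power)
    also have "\<dots> \<le> 9 / R\<^sup>2 * (2 * R)"
      using False assms by (intro mult_mono divide_right_mono cutoff'_simps) auto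
    also have "\<dots> = 18 / R" using assms by (simp add: power2_eq_square)
    finally show ?thesis .
  qed (use z assms in simp)
qed

section \<open>Regularized Cauchy kernels\<close>

abbreviation nsq :: "complex \<Rightarrow> real" where "nsq z \<equiv> (Re z)\<^sup>2 + (Im z)\<^sup>2"

lemma wirt_ident [simp]: "wirt (\<lambda>z. z) z = 1" "wirt_bar (\<lambda>z. z) z = 0"
  by (simp_all add: wirt_def wirt_bar_def pdx_eq_pd pdy_eq_pd)

lemma wirt_cnj_ident [simp]: "wirt cnj z = 0" "wirt_bar cnj z = 1"
  using wirt_cnj[of "\<lambda>z. z" z] by simp_all

lemma wirt_eq_pd: "e = 1 \<or> e = \<i> \<Longrightarrow> pd e f z = e * wirt f z + cnj e * wirt_bar f z"
  by (auto simp: wirt_def wirt_bar_def pdx_eq_pd pdy_eq_pd field_simps)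

lemma nsq_pos: "\<delta> \<noteq> 0 \<Longrightarrow> 0 < nsq z + \<delta>\<^sup>2"
  by (simp add: add_nonneg_pos)

lemma sq_le_nsq: "0 \<le> R \<Longrightarrow> R \<le> cmod z \<Longrightarrow> R\<^sup>2 \<le> nsq z + \<delta>\<^sup>2"
  using power_mono[of R "cmod z" 2] add_mono[of "R\<^sup>2" "nsq z" 0 "\<delta>\<^sup>2"]
  by (simp add: cmod_power2)

text \<open>If \<open>f\<close> is not integrable, its integral is 0 by convention, while
  \<open>g\<close> dominates a norm and so has a nonnegative integral. Callers therefore owe
  integrability of the majorant alone.\<close>

lemma norm_integral_le:
  fixes f :: "complex \<Rightarrow> complex"
  assumes "integrable lborel g" "\<And>z. norm (f z) \<le> g z"
  shows "norm (LINT z|lborel. f z) \<le> (LINT z|lborel. g z)"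
proof (cases "integrable lborel f")
  case True
  then show ?thesis
    using integral_norm_bound[of lborel f] integral_mono[OF integrable_norm[OF True] assms(1) assms(2)]
    by linarith
next
  case False
  have "0 \<le> (LINT z|lborel. g z)"
    by (intro integral_nonneg_AE AE_I2 order_trans[OF norm_ge_zero assms(2)])
  then show ?thesis using False by (simp add: not_integrable_integral_eq)
qed

context
  fixes \<delta> :: real assumes \<delta>: "\<delta> \<noteq> 0"
begin

lemma Ck_nsq_powr: "Ck_on 1 UNIV (\<lambda>z. (nsq z + \<delta>\<^sup>2) powr a)"
proof -
  have 1: "Ck_on 1 UNIV (\<lambda>z. nsq z + \<delta>\<^sup>2)"
    using Ck_add[OF Ck_normsq[of 1 1] Ck_const] by simp
  show ?thesis
    unfolding One_nat_def
  proof (rule Ck_compose_real[OF 1[unfolded One_nat_def]])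
    fix x assume "x \<in> range (\<lambda>z. nsq z + \<delta>\<^sup>2)"
    then have "x > 0" using nsq_pos[OF \<delta>] by auto
    then show "((\<lambda>x. x powr a) has_real_derivative a * x powr (a - 1)) (at x)"
      by (rule has_real_derivative_powr)
  next
    show "Ck_on 0 UNIV (\<lambda>z. a * (nsq z + \<delta>\<^sup>2) powr (a - 1))"
      using nsq_pos[OF \<delta>] by (auto intro!: continuous_intros simp: less_imp_neq[symmetric])
  qed
qed

lemma wirt_nsq_powr:
  "wirt (\<lambda>z. of_real ((nsq z + \<delta>\<^sup>2) powr a)) z = of_real (a * (nsq z + \<delta>\<^sup>2) powr (a - 1)) * cnj z"
  "wirt_bar (\<lambda>z. of_real ((nsq z + \<delta>\<^sup>2) powr a)) z = of_real (a * (nsq z + \<delta>\<^sup>2) powr (a - 1)) * z"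
proof -
  have "((\<lambda>t. (t + \<delta>\<^sup>2) powr a) has_real_derivative a * (nsq z + \<delta>\<^sup>2) powr (a - 1)) (at (nsq z / 1))"
    using nsq_pos[OF \<delta>, of z] by (auto intro!: derivative_eq_intros)
  from wirt_radial[OF this] show 
    "wirt (\<lambda>z. of_real ((nsq z + \<delta>\<^sup>2) powr a)) z = of_real (a * (nsq z + \<delta>\<^sup>2) powr (a - 1)) * cnj z"
    "wirt_bar (\<lambda>z. of_real ((nsq z + \<delta>\<^sup>2) powr a)) z = of_real (a * (nsq z + \<delta>\<^sup>2) powr (a - 1)) * z"
    by simp_all
qed

end

text \<open>\<open>reg_kernel\<close> is \<open>1 / z\<close> with \<open>\<bar>z\<bar>\<^sup>2\<close> replaced by \<open>\<bar>z\<bar>\<^sup>2 + \<delta>\<^sup>2\<close>; its \<open>wirt_bar\<close>-derivative is the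
  approximate identity \<open>reg_delta\<close>, up to the factor \<open>c0\<close> below.\<close>

definition reg_kernel :: "real \<Rightarrow> complex \<Rightarrow> complex" where
  "reg_kernel \<delta> z = cnj z * of_real ((nsq z + \<delta>\<^sup>2) powr (-1))"

definition reg_delta :: "real \<Rightarrow> complex \<Rightarrow> real" where
  "reg_delta \<delta> z = \<delta>\<^sup>2 * (nsq z + \<delta>\<^sup>2) powr (-2)"

lemma reg_kernel_Ck: "\<delta> \<noteq> 0 \<Longrightarrow> Ck_on 1 UNIV (reg_kernel \<delta>)"
  unfolding reg_kernel_def[abs_def] by (intro Ck_mult Ck_cnj Ck_ident Ck_of_real Ck_nsq_powr)

lemma powr_m1_m2: "x > 0 \<Longrightarrow> (x::real) powr (-1) = x * x powr (-2)"
  using powr_add[of x 1 "-2"] by simp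

lemma wirt_reg_kernel:
  assumes "\<delta> \<noteq> 0"
  shows "wirt_bar (reg_kernel \<delta>) z = of_real (reg_delta \<delta> z)"
    "wirt (reg_kernel \<delta>) z = - (cnj z)\<^sup>2 * of_real ((nsq z + \<delta>\<^sup>2) powr (-2))"
proof -
  have d: "cnj differentiable (at z)" "(\<lambda>z. complex_of_real ((nsq z + \<delta>\<^sup>2) powr (-1))) differentiable (at z)"
    by (rule Ck1_diff[OF Ck_cnj[OF Ck_ident]], rule Ck1_diff[OF Ck_of_real[OF Ck_nsq_powr[OF assms]]])
  have cc: "cnj z * z = of_real (nsq z)" by (simp add: complex_eq_iff power2_eq_square)
  have "wirt_bar (reg_kernel \<delta>) z = cnj z * (of_real (- 1 * (nsq z + \<delta>\<^sup>2) powr (-1 - 1)) * z) + of_real ((nsq z + \<delta>\<^sup>2) powr (-1))"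
    unfolding reg_kernel_def[abs_def] wirt_mult[OF d] wirt_nsq_powr[OF assms] by simp
  also have "\<dots> = of_real ((nsq z + \<delta>\<^sup>2) powr (-1)) - (cnj z * z) * of_real ((nsq z + \<delta>\<^sup>2) powr (-2))"
    by simp
  also have "\<dots> = of_real ((nsq z + \<delta>\<^sup>2) powr (-1) - nsq z * (nsq z + \<delta>\<^sup>2) powr (-2))"
    unfolding cc by simp
  also have "\<dots> = of_real (reg_delta \<delta> z)"
    unfolding reg_delta_def powr_m1_m2[OF nsq_pos[OF assms]] by (simp add: algebra_simps)
  finally show "wirt_bar (reg_kernel \<delta>) z = of_real (reg_delta \<delta> z)" .
  have "wirt (reg_kernel \<delta>) z = cnj z * (of_real (- 1 * (nsq z + \<delta>\<^sup>2) powr (-1 - 1)) * cnj z)"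
    unfolding reg_kernel_def[abs_def] wirt_mult[OF d] wirt_nsq_powr[OF assms] by simp
  then show "wirt (reg_kernel \<delta>) z = - (cnj z)\<^sup>2 * of_real ((nsq z + \<delta>\<^sup>2) powr (-2))"
    by (simp add: power2_eq_square)
qed

lemma nsq_powr_half: "nsq z powr a = cmod z powr (2 * a)"
  using powr_powr[of "cmod z" 2 a] by (cases "z = 0") (simp_all add: cmod_power2[symmetric])

text \<open>With \<open>\<rho> = (\<bar>z\<bar>\<^sup>2 + \<delta>\<^sup>2) powr (-3/4)\<close> the derivative \<open>wirt (\<lambda>z. z * \<rho> z)\<close> has real part at least \<open>\<rho> / 4\<close>,
  so integration by parts bounds the integral of \<open>\<rho>\<close> over a disc uniformly in \<open>\<delta>\<close>; polar coordinates are avoided.\<close>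

lemma integrable_cmod_powr:
  assumes "R > 0"
  shows "integrable lborel (\<lambda>z. indicator (cball 0 R) z *\<^sub>R (cmod z powr (- (3/2))))"
proof -
  define d where "d n = inverse (real (Suc n))" for n
  have d: "d \<longlonglongrightarrow> 0" "d n \<noteq> 0" "d n > 0" for n
    using LIMSEQ_inverse_real_of_nat by (auto simp: d_def[abs_def] d_def)
  define X where "X z = Re (chi R z)" for z
  have X: "0 \<le> X z" "continuous_on UNIV X" "bounded_supp X" "chi R z = of_real (X z)" for z
    using Ck1_cont[OF Ck_Re[OF chi_Ck(2)]] bounded_supp_mono[OF chi_bounded_supp[OF assms], of X]
    by (auto simp: X_def[abs_def] X_def chi_def cutoff_simps)
  define \<rho> where "\<rho> n z = (nsq z + (d n)\<^sup>2) powr (-(3/4))" for n z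
  have \<rho>: "Ck_on 1 UNIV (\<rho> n)" "0 \<le> \<rho> n z" for n z
    using Ck_nsq_powr[OF d(2)] by (auto simp: \<rho>_def[abs_def])
  define f where "f n z = X z * \<rho> n z" for n z
  have fc: "continuous_on UNIV (f n)" for n
    unfolding f_def[abs_def] by (intro continuous_intros X Ck1_cont \<rho>)
  have fb: "bounded_supp (f n)" for n
    using X(3) by (rule bounded_supp_mono) (simp add: f_def)
  have fi: "integrable lborel (f n)" for n by (rule integrable_bounded_supp[OF fc fb])
  \<comment> \<open>Bounds the term left by integration by parts uniformly in \<open>n\<close>:
    \<open>wirt (chi R)\<close> vanishes for |z| <= R, and beyond that radius
    \<open>\<rho> n\<close> is at most R^(-3/2).\<close>
  define B where "B = (LINT z|lborel. norm (wirt (chi R) z) * (cmod z * (R\<^sup>2) powr (-(3/4))))"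
  have le4B: "(LINT z|lborel. f n z) \<le> 4 * B" for n
  proof -
    define g where "g z = z * complex_of_real (\<rho> n z)" for z
    have g1: "Ck_on 1 UNIV g"
      unfolding g_def[abs_def] by (intro Ck_mult Ck_ident Ck_of_real \<rho>)
    have wg: "wirt g z = of_real (\<rho> n z - 3/4 * (nsq z * (nsq z + (d n)\<^sup>2) powr (-(7/4))))" for z
    proof -
      have cc: "z * cnj z = of_real (nsq z)" by (simp add: complex_eq_iff power2_eq_square)
      have "wirt g z = z * (of_real (-(3/4) * (nsq z + (d n)\<^sup>2) powr (-(3/4) - 1)) * cnj z) + of_real (\<rho> n z)"
        unfolding g_def[abs_def]
        by (subst wirt_mult) (use Ck1_diff[OF Ck_of_real[OF \<rho>(1)[of n]]] wirt_nsq_powr(1)[OF d(2)[of n], of "-(3/4)" z] in \<open>auto simp: \<rho>_def[abs_def]\<close>)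
      also have "\<dots> = of_real (\<rho> n z) - of_real (3/4 * (nsq z + (d n)\<^sup>2) powr (-(7/4))) * (z * cnj z)"
        by (simp add: algebra_simps)
      finally show ?thesis unfolding cc of_real_diff[symmetric] of_real_mult[symmetric]
        by (simp only: mult.assoc mult.commute mult.left_commute)
    qed
    have wg4: "\<rho> n z / 4 \<le> Re (wirt g z)" for z
    proof -
      have p: "nsq z + (d n)\<^sup>2 > 0" by (rule nsq_pos[OF d(2)])
      have "nsq z * (nsq z + (d n)\<^sup>2) powr (-(7/4)) \<le> (nsq z + (d n)\<^sup>2) * (nsq z + (d n)\<^sup>2) powr (-(7/4))"
        by (intro mult_right_mono) auto
      also have "\<dots> = \<rho> n z"
        using powr_add[of "nsq z + (d n)\<^sup>2" 1 "-(7/4)"] p by (simp add: \<rho>_def)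
      finally show ?thesis unfolding wg by simp
    qed
    have i1: "integrable lborel (\<lambda>z. chi R z * wirt g z)"
      by (rule integrable_mult_bounded_supp(2)[OF Ck1_wirt_cont(1)[OF g1] Ck1_cont[OF chi_Ck(2)] chi_bounded_supp[OF assms]])
    have i2: "integrable lborel (\<lambda>z. norm (wirt (chi R) z) * (cmod z * (R\<^sup>2) powr (-(3/4))))"
      by (rule integrable_bounded_supp) (auto intro!: continuous_intros Ck1_wirt_cont chi_Ck bounded_supp_mono[OF bounded_supp_wirt(1)[OF chi_bounded_supp[OF assms]]])
    have "(LINT z|lborel. f n z) \<le> (LINT z|lborel. 4 * Re (chi R z * wirt g z))"
    proof (rule integral_mono[OF fi])
      show "integrable lborel (\<lambda>z. 4 * Re (chi R z * wirt g z))"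
        by (intro integrable_mult_right integrable_Re i1)
      show "f n z \<le> 4 * Re (chi R z * wirt g z)" for z
        using mult_left_mono[OF wg4[of z] X(1)[of z]] by (simp add: f_def X(4))
    qed
    also have "\<dots> = 4 * Re (LINT z|lborel. chi R z * wirt g z)"
      unfolding integral_Re[OF i1, symmetric] by (rule integral_mult_right_zero)
    also have "\<dots> = - 4 * Re (LINT z|lborel. wirt (chi R) z * g z)"
      using integral_wirt_parts(1)[OF g1 chi_Ck(2) chi_bounded_supp[OF assms]] by simp
    also have "\<dots> \<le> 4 * norm (LINT z|lborel. wirt (chi R) z * g z)"
      using abs_Re_le_cmod[of "LINT z|lborel. wirt (chi R) z * g z"] by linarith
    also have "norm (LINT z|lborel. wirt (chi R) z * g z) \<le> B"
      unfolding B_def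
    proof (rule norm_integral_le[OF i2])
      fix z
      show "norm (wirt (chi R) z * g z) \<le> norm (wirt (chi R) z) * (cmod z * (R\<^sup>2) powr (-(3/4)))"
      proof (cases "cmod z \<le> R")
        case False
        then have "R\<^sup>2 \<le> nsq z + (d n)\<^sup>2"
          using assms by (intro sq_le_nsq) auto
        then have "\<rho> n z \<le> (R\<^sup>2) powr (-(3/4))"
          unfolding \<rho>_def using assms by (intro powr_mono2') auto
        then show ?thesis using \<rho>(2)[of n z]
          by (simp add: norm_mult g_def mult_left_mono)
      qed (use wirt_chi_bounds(2)[OF assms, of z] in simp)
    qed
    finally show ?thesis by simp
  qed
  have inc: "f m z \<le> f n z" if "m \<le> n" for m n z
  proof -
    have "d n \<le> d m" using that by (simp add: d_def divide_simps)
    then have "(d n)\<^sup>2 \<le> (d m)\<^sup>2" using d(3)[of n] by (intro power_mono) auto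
    then have "\<rho> m z \<le> \<rho> n z"
      unfolding \<rho>_def using nsq_pos[OF d(2)[of n], of z] by (intro powr_mono2') auto
    then show ?thesis unfolding f_def using X(1)[of z] by (rule mult_left_mono)
  qed
  \<comment> \<open>Monotone convergence: \<open>f n\<close> grows as \<open>d n\<close> decreases,
    and the integrals stay below \<open>4 * B\<close>. The limit is identified off the origin, which
    is a null set; at the origin \<open>f n\<close> tends to infinity, whereas \<open>powr\<close>
    gives 0 there.\<close>
  have "incseq (\<lambda>n. LINT z|lborel. f n z)"
    by (intro incseq_SucI integral_mono fi inc) auto
  then obtain x where x: "(\<lambda>n. LINT z|lborel. f n z) \<longlonglongrightarrow> x"
    using incseq_convergent[of "\<lambda>n. LINT z|lborel. f n z" "4 * B"] le4B by blast
  have lim: "(\<lambda>n. f n z) \<longlonglongrightarrow> X z * cmod z powr (-(3/2))" if "z \<noteq> 0" for z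
  proof -
    have "nsq z \<noteq> 0" using that by (simp add: complex_eq_iff)
    then have "(\<lambda>n. f n z) \<longlonglongrightarrow> X z * (nsq z + 0\<^sup>2) powr (-(3/4))"
      unfolding f_def \<rho>_def by (intro tendsto_intros d(1)) auto
    then show ?thesis using nsq_powr_half[of z "-(3/4)"] by simp
  qed
  have Xi: "integrable lborel (\<lambda>z. X z * cmod z powr (-(3/2)))"
  proof (rule integrable_monotone_convergence[of lborel f, OF fi _ _ x])
    show "AE z in lborel. mono (\<lambda>n. f n z)" by (auto intro!: AE_I2 monoI inc)
    have "AE z in lborel. z \<noteq> (0::complex)" by (rule AE_lborel_singleton)
    then show "AE z in lborel. (\<lambda>n. f n z) \<longlonglongrightarrow> X z * cmod z powr (-(3/2))"
      by eventually_elim (rule lim)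
    show "(\<lambda>z. X z * cmod z powr (-(3/2))) \<in> borel_measurable lborel"
      using borel_measurable_continuous_onI[OF X(2)] by measurable
  qed
  show ?thesis
  proof (rule Bochner_Integration.integrable_bound[OF Xi])
    show "AE z in lborel. norm (indicator (cball 0 R) z *\<^sub>R (cmod z powr (- (3/2)))) \<le> norm (X z * cmod z powr (-(3/2)))"
      using X(1) chi_eq_1[OF assms] by (auto intro!: AE_I2 simp: X_def indicator_def)
    show "(\<lambda>z. indicator (cball 0 R) z *\<^sub>R (cmod z powr (- (3/2)))) \<in> borel_measurable lborel"
      by (intro borel_measurable_scaleR borel_measurable_indicator powr_real_measurable) auto
  qed
qed

text \<open>The common majorant. It exceeds 1/|z| by the factor |z|^(-1/2), and it is what remains
  of 1/|z|^2 after multiplication by a Hoelder factor sqrt |z|. Its value at 0 is 0.\<close>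

abbreviation weight :: "complex \<Rightarrow> real" where "weight z \<equiv> cmod z powr (-(3/2))"

section \<open>The Cauchy kernel as a limit of regularized kernels\<close>

definition eps :: "nat \<Rightarrow> real" where "eps n = inverse (real (Suc n))"

lemma eps: "eps \<longlonglongrightarrow> 0" "eps n \<noteq> 0" "eps n > 0"
  using LIMSEQ_inverse_real_of_nat by (auto simp: eps_def[abs_def] eps_def)

lemma integrable_weight_bounded:
  fixes f :: "complex \<Rightarrow> complex"
  assumes "f \<in> borel_measurable borel" "\<And>z. cmod (f z) \<le> C * (indicator (cball 0 R) z * weight z)"
  shows "integrable lborel f"
proof (rule Bochner_Integration.integrable_bound)
  have "integrable lborel (\<lambda>z. indicator (cball 0 (max R 1)) z *\<^sub>R weight z)"
    by (rule integrable_cmod_powr) simp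
  then show "integrable lborel (\<lambda>z. \<bar>C\<bar> * (indicator (cball 0 (max R 1)) z *\<^sub>R weight z))"
    by (rule integrable_mult_right)
  show "AE z in lborel. norm (f z) \<le> norm (\<bar>C\<bar> * (indicator (cball 0 (max R 1)) z *\<^sub>R weight z))"
  proof (rule AE_I2)
    fix z
    have "cmod (f z) \<le> \<bar>C\<bar> * (indicator (cball 0 R) z * weight z)"
      by (rule order_trans[OF assms(2)]) (auto intro!: mult_right_mono)
    also have "\<dots> \<le> \<bar>C\<bar> * (indicator (cball 0 (max R 1)) z * weight z)"
      by (intro mult_left_mono mult_right_mono) (auto simp: indicator_def)
    finally show "norm (f z) \<le> norm (\<bar>C\<bar> * (indicator (cball 0 (max R 1)) z *\<^sub>R weight z))"
      by (simp add: abs_mult)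
  qed
qed (use assms in simp)

lemma cmod_inverse_le_weight:
  assumes "cmod z \<le> S"
  shows "cmod (inverse z) \<le> sqrt S * weight z"
proof (cases "z = 0")
  case False
  have "cmod (inverse z) = cmod z powr (1/2) * weight z"
    using False powr_add[of "cmod z" "1/2" "-(3/2)"] by (simp add: norm_inverse powr_minus)
  also have "\<dots> \<le> sqrt S * weight z"
    using assms by (intro mult_right_mono) (auto simp: powr_half_sqrt)
  finally show ?thesis .
qed simp

lemma cmod_reg_kernel_le: "cmod (reg_kernel \<delta> z) \<le> cmod (inverse z)"
proof (cases "z = 0")
  case False
  have p: "0 < (cmod z)\<^sup>2" "(cmod z)\<^sup>2 \<le> nsq z + \<delta>\<^sup>2" using False by (simp_all add: cmod_power2 del: zero_less_power2)
     (simp add: cmod_power2[symmetric])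
  then have "(nsq z + \<delta>\<^sup>2) powr (-1) \<le> inverse ((cmod z)\<^sup>2)"
    by (simp add: powr_minus le_imp_inverse_le del: zero_less_power2)
  then have "cmod z * (nsq z + \<delta>\<^sup>2) powr (-1) \<le> cmod z * inverse ((cmod z)\<^sup>2)"
    by (intro mult_left_mono) auto
  moreover have "cmod (reg_kernel \<delta> z) = cmod z * (nsq z + \<delta>\<^sup>2) powr (-1)"
    by (simp only: reg_kernel_def norm_mult complex_mod_cnj norm_of_real abs_of_nonneg[OF powr_ge_zero])
  ultimately have "cmod (reg_kernel \<delta> z) \<le> cmod z * inverse ((cmod z)\<^sup>2)" by simp
  also have "\<dots> = cmod (inverse z)" using False by (simp add: norm_inverse power2_eq_square)
  finally show ?thesis .
qed (simp add: reg_kernel_def)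

lemma reg_kernel_tendsto: "(\<lambda>n. reg_kernel (eps n) z) \<longlonglongrightarrow> inverse z"
proof (cases "z = 0")
  case False
  then have n: "nsq z \<noteq> 0" by (simp add: complex_eq_iff)
  then have "(\<lambda>n. reg_kernel (eps n) z) \<longlonglongrightarrow> cnj z * of_real ((nsq z + 0\<^sup>2) powr (-1))"
    unfolding reg_kernel_def by (intro tendsto_intros eps) auto
  moreover have "cnj z * of_real ((nsq z + 0\<^sup>2) powr (-1)) = inverse z"
  proof -
    have "z * cnj z = of_real (nsq z)" by (simp add: complex_eq_iff power2_eq_square)
    moreover have "0 < nsq z" using n by (simp add: less_le)
    ultimately show ?thesis using False n
      by (simp add: powr_minus powr_one field_simps del: of_real_add of_real_power)
  qed
  ultimately show ?thesis by simp
qed (simp add: reg_kernel_def)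

lemma borel_cont: "continuous_on UNIV f \<Longrightarrow> f \<in> borel_measurable borel"
  by (rule borel_measurable_continuous_onI)

text \<open>Without the customary factor 1/pi, which reappears as the inverse of \<open>c0\<close>.
  At y = w the kernel is \<open>inverse 0 = 0\<close>.\<close>

definition cauchy_transform :: "(complex \<Rightarrow> complex) \<Rightarrow> complex \<Rightarrow> complex" where
  "cauchy_transform h w = (LINT y|lborel. inverse (w - y) * h y)"

lemma cauchy_kernel_dom:
  assumes "continuous_on UNIV h" "bounded_supp h"
  obtains C R where "C \<ge> 0" "R > 0" "\<And>z. cmod (inverse z * h (w - z)) \<le> C * (indicator (cball 0 R) z * weight z)"
proof -
  have hc: "continuous_on UNIV (\<lambda>z. h (w - z))"
    by (intro continuous_on_compose2[OF assms(1)] continuous_intros) auto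
  obtain M where M: "M > 0" "\<And>z. norm (h (w - z)) \<le> M"
    using bounded_bounded_supp[OF hc bounded_supp_reflect[OF assms(2)]] by blast
  obtain R where R: "R > 0" "\<And>z. R \<le> cmod z \<Longrightarrow> h (w - z) = 0"
    using bounded_suppE[OF bounded_supp_reflect[OF assms(2), of w]] by blast
  have "cmod (inverse z * h (w - z)) \<le> (sqrt R * M) * (indicator (cball 0 R) z * weight z)" for z
  proof (cases "cmod z \<le> R")
    case True
    have "cmod (inverse z * h (w - z)) \<le> (sqrt R * weight z) * M"
      unfolding norm_mult by (intro mult_mono cmod_inverse_le_weight True M) (use R in auto)
    then show ?thesis using True by (simp add: algebra_simps)
  qed (use R in simp)
  then show ?thesis using that[of "sqrt R * M" R] M R by simp
qed

lemma cauchy_kernel_integrable: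
  assumes "continuous_on UNIV h" "bounded_supp h"
  shows "integrable lborel (\<lambda>y. inverse (w - y) * h y)"
proof -
  have hc: "continuous_on UNIV (\<lambda>z. h (w - z))"
    by (intro continuous_on_compose2[OF assms(1)] continuous_intros) auto
  have m: "(\<lambda>z. inverse z * h (w - z)) \<in> borel_measurable borel"
    using borel_cont[OF hc] by measurable
  have "integrable lborel (\<lambda>z. inverse z * h (w - z))"
    using cauchy_kernel_dom[OF assms, of w] integrable_weight_bounded[OF m] by metis
  from integrable_reflect[OF m this, of w] show ?thesis by simp
qed

lemma reg_kernel_conv_tendsto:
  assumes "continuous_on UNIV h" "bounded_supp h"
  shows "(\<lambda>n. LINT y|lborel. reg_kernel (eps n) (w - y) * h y) \<longlonglongrightarrow> cauchy_transform h w"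
  unfolding cauchy_transform_def
proof (rule integral_dominated_convergence[where w="\<lambda>y. cmod (inverse (w - y) * h y)"])
  note [measurable] = borel_cont[OF assms(1)]
  show "(\<lambda>y. inverse (w - y) * h y) \<in> borel_measurable lborel" by measurable
  show "(\<lambda>y. reg_kernel (eps n) (w - y) * h y) \<in> borel_measurable lborel" for n
  proof -
    have [measurable]: "reg_kernel (eps n) \<in> borel_measurable borel"
      by (intro borel_cont Ck1_cont reg_kernel_Ck eps)
    show ?thesis by measurable
  qed
  show "integrable lborel (\<lambda>y. cmod (inverse (w - y) * h y))"
    by (intro integrable_norm cauchy_kernel_integrable assms)
  show "AE y in lborel. (\<lambda>n. reg_kernel (eps n) (w - y) * h y) \<longlonglongrightarrow> inverse (w - y) * h y"
    by (intro AE_I2 tendsto_mult reg_kernel_tendsto tendsto_const)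
  show "AE y in lborel. norm (reg_kernel (eps n) (w - y) * h y) \<le> cmod (inverse (w - y) * h y)" for n
    unfolding norm_mult by (intro AE_I2 mult_right_mono cmod_reg_kernel_le) auto
qed

text \<open>The value is \<open>pi\<close>, but only its positivity matters.\<close>

definition c0 :: real where "c0 = - (LINT y|lborel. cutoff' (nsq y))"

lemma cutoff'_nsq: "Ck_on 1 UNIV (\<lambda>y. cutoff' (nsq y))" "bounded_supp (\<lambda>y. cutoff' (nsq y))"
proof -
  show "Ck_on 1 UNIV (\<lambda>y. cutoff' (nsq y))" using cutoff'_Ck[OF Ck_normsq[of 1 1]] by simp
  show "bounded_supp (\<lambda>y. cutoff' (nsq y))"
    unfolding bounded_supp_def using cutoff'_normsq_eq_0[of 1] by (intro exI[of _ 2]) simp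
qed

text \<open>The integrand is continuous and nonnegative, and it is nonzero at the real point sqrt
  (3/2), hence on an open set, which cannot be negligible.\<close>

lemma c0_pos: "c0 > 0"
proof -
  have c: "continuous_on UNIV (\<lambda>y. - cutoff' (nsq y))"
    by (intro continuous_intros Ck1_cont[OF cutoff'_nsq(1)])
  have i: "integrable lborel (\<lambda>y. - cutoff' (nsq y))"
    by (rule integrable_bounded_supp[OF c bounded_supp_mono[OF cutoff'_nsq(2)]]) simp
  have nn: "0 \<le> - cutoff' (nsq y)" for y using cutoff'_simps(3) by simp
  have "0 \<le> c0"
    unfolding c0_def using integral_nonneg_AE[OF AE_I2[OF nn]] by simp
  moreover have "c0 \<noteq> 0"
  proof
    assume "c0 = 0"
    then have "AE y in lborel. - cutoff' (nsq y) = 0"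
      using integral_nonneg_eq_0_iff_AE[OF i AE_I2[OF nn]] by (simp add: c0_def)
    moreover have o: "open {y. - cutoff' (nsq y) \<noteq> 0}"
      using c open_Collect_neq[OF c continuous_on_const[of UNIV 0]] by simp
    ultimately have "{y. - cutoff' (nsq y) \<noteq> 0} \<in> null_sets lborel"
      by (subst AE_iff_null_sets) auto
    then have "negligible {y. - cutoff' (nsq y) \<noteq> 0}"
      by (simp add: negligible_iff_null_sets null_sets_completionI)
    then have "{y. - cutoff' (nsq y) \<noteq> 0} = {}" using open_not_negligible[OF o] by blast
    moreover have "of_real (sqrt (3/2)) \<in> {y. - cutoff' (nsq y) \<noteq> 0}"
      using cutoff'_simps(5) by simp
    ultimately show False by blast
  qed
  ultimately show ?thesis by simp
qed

lemma reg_delta_pos: "reg_delta \<delta> z \<ge> 0" by (simp add: reg_delta_def)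

lemma reg_delta_cont: "\<delta> \<noteq> 0 \<Longrightarrow> continuous_on UNIV (reg_delta \<delta>)"
  unfolding reg_delta_def[abs_def] by (intro continuous_intros Ck1_cont Ck_nsq_powr)

text \<open>The mass of the approximate identity. Integration by parts moves the derivative to the
  cutoff, whose gradient lives where |z| >= 1 and the kernels are bounded; there they tend to 1/z,
  and \<open>wirt_bar (chi 1) z / z\<close> is the radial function that defines
  \<open>c0\<close>.\<close>

lemma chi_reg_delta_tendsto:
  "(\<lambda>n. LINT z|lborel. chi 1 z * of_real (reg_delta (eps n) z)) \<longlonglongrightarrow> of_real c0"
proof -
  have eq: "(LINT z|lborel. chi 1 z * of_real (reg_delta (eps n) z)) = - (LINT z|lborel. wirt_bar (chi 1) z * reg_kernel (eps n) z)" for n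
    using integral_wirt_parts(2)[OF reg_kernel_Ck[OF eps(2)] chi_Ck(2) chi_bounded_supp[of 1]] by (simp add: wirt_reg_kernel eps)
  have "(\<lambda>n. LINT z|lborel. wirt_bar (chi 1) z * reg_kernel (eps n) z) \<longlonglongrightarrow> (LINT z|lborel. wirt_bar (chi 1) z * inverse z)"
  proof (rule integral_dominated_convergence[where w="\<lambda>z. cmod (wirt_bar (chi 1) z)"])
    note c = Ck1_wirt_cont(2)[OF chi_Ck(2)[of 1]]
    note [measurable] = borel_cont[OF c]
    show "(\<lambda>z. wirt_bar (chi 1) z * inverse z) \<in> borel_measurable lborel" by measurable
    show "(\<lambda>z. wirt_bar (chi 1) z * reg_kernel (eps n) z) \<in> borel_measurable lborel" for n
    proof -
      have [measurable]: "reg_kernel (eps n) \<in> borel_measurable borel"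
        by (intro borel_cont Ck1_cont reg_kernel_Ck eps)
      show ?thesis by measurable
    qed
    show "integrable lborel (\<lambda>z. cmod (wirt_bar (chi 1) z))"
      by (intro integrable_norm integrable_bounded_supp c bounded_supp_wirt chi_bounded_supp) simp
    show "AE y in lborel. (\<lambda>n. wirt_bar (chi 1) y * reg_kernel (eps n) y) \<longlonglongrightarrow> wirt_bar (chi 1) y * inverse y"
      by (intro AE_I2 tendsto_mult reg_kernel_tendsto tendsto_const)
    show "AE y in lborel. norm (wirt_bar (chi 1) y * reg_kernel (eps n) y) \<le> cmod (wirt_bar (chi 1) y)" for n
    proof (rule AE_I2)
      fix y
      show "norm (wirt_bar (chi 1) y * reg_kernel (eps n) y) \<le> cmod (wirt_bar (chi 1) y)"
      proof (cases "cmod y \<le> 1")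
        case False
        then have "cmod (reg_kernel (eps n) y) \<le> 1"
          by (intro order_trans[OF cmod_reg_kernel_le]) (simp add: norm_inverse inverse_le_1_iff)
        then show ?thesis unfolding norm_mult by (intro mult_left_le) auto
      qed (use wirt_chi_bounds(3)[of 1 y] in simp)
    qed
  qed
  moreover have "wirt_bar (chi 1) z * inverse z = of_real (cutoff' (nsq z))" for z
    by (cases "z = 0") (simp_all add: wirt_chi cutoff'_simps)
  ultimately have "(\<lambda>n. - (LINT z|lborel. wirt_bar (chi 1) z * reg_kernel (eps n) z)) \<longlonglongrightarrow> - (LINT z|lborel. complex_of_real (cutoff' (nsq z)))"
    by (intro tendsto_minus) simp
  moreover have "- (LINT z|lborel. complex_of_real (cutoff' (nsq z))) = of_real c0"
    unfolding c0_def by (simp add: integral_complex_of_real)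
  ultimately show ?thesis unfolding eq by (simp only:)
qed

text \<open>Near 0 the function \<open>e\<close> is small and the mass \<open>I n\<close> stays
  bounded; away from 0 the kernel is uniformly of order \<open>(eps n)\<^sup>2\<close>.\<close>

lemma integral_reg_delta_tendsto_0:
  fixes e :: "complex \<Rightarrow> complex"
  assumes e: "continuous_on UNIV e" "bounded_supp e" "e 0 = 0"
  shows "(\<lambda>n. LINT z|lborel. of_real (reg_delta (eps n) z) * e z) \<longlonglongrightarrow> 0"
proof (rule LIMSEQ_I)
  fix r :: real assume r: "r > 0"
  define X where "X z = Re (chi 1 z)" for z
  have X: "0 \<le> X z" "continuous_on UNIV X" "bounded_supp X" "chi 1 z = of_real (X z)" for z
  proof -
    show "continuous_on UNIV X" unfolding X_def[abs_def] by (rule Ck1_cont[OF Ck_Re[OF chi_Ck(2)]])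
    show "bounded_supp X" by (rule bounded_supp_mono[OF chi_bounded_supp[of 1]]) (simp_all add: X_def)
  qed (simp_all add: X_def chi_def cutoff_simps)
  define I where "I n = (LINT z|lborel. X z * reg_delta (eps n) z)" for n
  have "(\<lambda>n. LINT z|lborel. complex_of_real (X z * reg_delta (eps n) z)) \<longlonglongrightarrow> of_real c0"
    using chi_reg_delta_tendsto by (simp add: X(4))
  then have I: "I \<longlonglongrightarrow> c0"
    unfolding I_def[abs_def] integral_complex_of_real by (simp add: tendsto_of_real_iff)
  have ie: "integrable lborel (\<lambda>z. norm (e z))"
    by (intro integrable_norm integrable_bounded_supp e)
  define E where "E = (LINT z|lborel. norm (e z))"
  \<comment> \<open>Makes the limit \<open>\<epsilon> * c0\<close> of the bound smaller than
    \<open>r\<close>.\<close>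
  define \<epsilon> where "\<epsilon> = r / (2 * c0 + 2)"
  have \<epsilon>: "\<epsilon> > 0" using r c0_pos by (simp add: \<epsilon>_def)
  have "isCont e 0" using e(1) by (simp add: continuous_on_eq_continuous_at)
  then obtain \<eta>0 where \<eta>0: "\<eta>0 > 0" "\<And>z. cmod z < \<eta>0 \<Longrightarrow> cmod (e z) < \<epsilon>"
    using \<epsilon> e(3) unfolding continuous_at_eps_delta by (metis diff_zero dist_norm)
  \<comment> \<open>At most 1, so that \<open>X\<close> is 1 on the inner disc and the mass there
    can be counted by \<open>I n\<close>.\<close>
  define \<eta> where "\<eta> = min \<eta>0 1"
  have \<eta>: "\<eta> > 0" "\<eta> \<le> 1" "\<And>z. cmod z < \<eta> \<Longrightarrow> cmod (e z) < \<epsilon>"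
    using \<eta>0 by (auto simp: \<eta>_def)
  have bound: "norm (LINT z|lborel. of_real (reg_delta (eps n) z) * e z) \<le> \<epsilon> * I n + (eps n)\<^sup>2 * (\<eta>\<^sup>2) powr (-2) * E" for n
  proof -
    have iX: "integrable lborel (\<lambda>z. X z * reg_delta (eps n) z)"
      by (intro integrable_bounded_supp continuous_intros X reg_delta_cont eps bounded_supp_mono[OF X(3)]) simp
    have "norm (LINT z|lborel. of_real (reg_delta (eps n) z) * e z)
        \<le> (LINT z|lborel. \<epsilon> * (X z * reg_delta (eps n) z) + (eps n)\<^sup>2 * (\<eta>\<^sup>2) powr (-2) * norm (e z))"
    proof (rule norm_integral_le)
      show "integrable lborel (\<lambda>z. \<epsilon> * (X z * reg_delta (eps n) z) + (eps n)\<^sup>2 * (\<eta>\<^sup>2) powr (-2) * norm (e z))"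
        by (intro Bochner_Integration.integrable_add integrable_mult_right iX ie)
      fix z
      show "norm (of_real (reg_delta (eps n) z) * e z) \<le> \<epsilon> * (X z * reg_delta (eps n) z) + (eps n)\<^sup>2 * (\<eta>\<^sup>2) powr (-2) * norm (e z)"
      proof (cases "cmod z < \<eta>")
        case True
        then have "X z = 1" using chi_eq_1[of 1 z] \<eta>(2) by (simp add: X_def)
        moreover have "norm (of_real (reg_delta (eps n) z) * e z) \<le> reg_delta (eps n) z * \<epsilon>"
          using \<eta>(3)[OF True] reg_delta_pos[of "eps n" z] by (simp add: norm_mult mult_left_mono)
        ultimately show ?thesis by (simp add: mult.commute add_increasing2)
      next
        case False
        then have "\<eta>\<^sup>2 \<le> nsq z + (eps n)\<^sup>2"
          using \<eta>(1) by (intro sq_le_nsq) auto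
        then have "reg_delta (eps n) z \<le> (eps n)\<^sup>2 * (\<eta>\<^sup>2) powr (-2)"
          unfolding reg_delta_def using \<eta>(1) by (intro mult_left_mono powr_mono2') auto
        then have "norm (of_real (reg_delta (eps n) z) * e z) \<le> (eps n)\<^sup>2 * (\<eta>\<^sup>2) powr (-2) * norm (e z)"
          using reg_delta_pos[of "eps n" z] by (simp add: norm_mult mult_right_mono)
        moreover have "0 \<le> \<epsilon> * (X z * reg_delta (eps n) z)" using \<epsilon> X(1) reg_delta_pos by simp
        ultimately show ?thesis by linarith
      qed
    qed
    also have "\<dots> = \<epsilon> * I n + (eps n)\<^sup>2 * (\<eta>\<^sup>2) powr (-2) * E"
      unfolding I_def E_def using iX ie by simp
    finally show ?thesis .
  qed
  have "(\<lambda>n. \<epsilon> * I n + (eps n)\<^sup>2 * (\<eta>\<^sup>2) powr (-2) * E) \<longlonglongrightarrow> \<epsilon> * c0 + 0\<^sup>2 * (\<eta>\<^sup>2) powr (-2) * E"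
    by (intro tendsto_intros I eps)
  moreover have "\<epsilon> * c0 + 0\<^sup>2 * (\<eta>\<^sup>2) powr (-2) * E < r"
    using r c0_pos by (simp add: \<epsilon>_def divide_simps)
  ultimately have "\<forall>\<^sub>F n in sequentially. \<epsilon> * I n + (eps n)\<^sup>2 * (\<eta>\<^sup>2) powr (-2) * E < r"
    by (rule order_tendstoD(2))
  then obtain N where "\<And>n. n \<ge> N \<Longrightarrow> \<epsilon> * I n + (eps n)\<^sup>2 * (\<eta>\<^sup>2) powr (-2) * E < r"
    unfolding eventually_sequentially by blast
  then show "\<exists>no. \<forall>n\<ge>no. norm ((LINT z|lborel. of_real (reg_delta (eps n) z) * e z) - 0) < r"
    using bound by (intro exI[of _ N]) (auto intro: le_less_trans)
qed

lemma reg_delta_conv_tendsto: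
  fixes f :: "complex \<Rightarrow> complex"
  assumes f: "continuous_on UNIV f" "bounded_supp f"
  shows "(\<lambda>n. LINT y|lborel. of_real (reg_delta (eps n) (w - y)) * f y) \<longlonglongrightarrow> of_real c0 * f w"
proof -
  have fc: "continuous_on UNIV (\<lambda>z. f (w - z))"
    by (intro continuous_on_compose2[OF f(1)] continuous_intros) auto
  have cc: "continuous_on UNIV (chi 1)" by (rule Ck1_cont[OF chi_Ck(2)])
  \<comment> \<open>Subtracting \<open>f w * chi 1\<close> leaves a function that vanishes at 0 and
    keeps bounded support; the subtracted part contributes the mass \<open>c0\<close>.\<close>
  define e where "e z = f (w - z) - f w * chi 1 z" for z
  have e: "continuous_on UNIV e" "e 0 = 0" "bounded_supp e"
  proof -
    show "continuous_on UNIV e" unfolding e_def[abs_def] by (intro continuous_intros fc cc)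
    show "e 0 = 0" using chi_eq_1[of 1 0] by (simp add: e_def)
    have "bounded_supp (\<lambda>z. - (f w * chi 1 z))" by (rule bounded_supp_mono[OF chi_bounded_supp[of 1]]) auto
    from bounded_supp_add[OF bounded_supp_reflect[OF f(2), of w] this] show "bounded_supp e" by (simp add: e_def[abs_def])
  qed
  have jc: "continuous_on UNIV (\<lambda>z. complex_of_real (reg_delta (eps n) z))" for n
    by (intro continuous_intros reg_delta_cont eps)
  have i: "integrable lborel (\<lambda>z. complex_of_real (reg_delta (eps n) z) * e z)"
      "integrable lborel (\<lambda>z. chi 1 z * complex_of_real (reg_delta (eps n) z))" for n
    using integrable_mult_bounded_supp(1)[OF jc e(1,3)] integrable_mult_bounded_supp(2)[OF jc cc chi_bounded_supp] by auto
  have "(LINT y|lborel. of_real (reg_delta (eps n) (w - y)) * f y) =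
      (LINT z|lborel. of_real (reg_delta (eps n) z) * e z) + f w * (LINT z|lborel. chi 1 z * of_real (reg_delta (eps n) z))" for n
  proof -
    have "(LINT y|lborel. of_real (reg_delta (eps n) (w - y)) * f y) = (LINT z|lborel. of_real (reg_delta (eps n) z) * f (w - z))"
    proof -
      have "(\<lambda>y. of_real (reg_delta (eps n) y) * f (w - y)) \<in> borel_measurable borel"
        by (intro borel_cont continuous_intros jc fc)
      from lebesgue_integral_reflect[OF this, of w] show ?thesis by simp
    qed
    also have "\<dots> = (LINT z|lborel. of_real (reg_delta (eps n) z) * e z + f w * (chi 1 z * of_real (reg_delta (eps n) z)))"
      by (simp add: e_def algebra_simps)
    also have "\<dots> = (LINT z|lborel. of_real (reg_delta (eps n) z) * e z) + f w * (LINT z|lborel. chi 1 z * of_real (reg_delta (eps n) z))"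
      using i by simp
    finally show ?thesis .
  qed
  moreover have "(\<lambda>n. (LINT z|lborel. of_real (reg_delta (eps n) z) * e z) + f w * (LINT z|lborel. chi 1 z * of_real (reg_delta (eps n) z)))
     \<longlonglongrightarrow> 0 + f w * of_real c0"
    by (intro tendsto_intros integral_reg_delta_tendsto_0 e chi_reg_delta_tendsto)
  ultimately show ?thesis by (simp add: mult.commute)
qed

text \<open>The weak equation is tested with the regularized kernel centred at \<open>w\<close>,
  times \<open>X\<close>. As the regularization is removed, the derivative of the kernel
  concentrates at \<open>w\<close> and yields the left-hand side, so that mere continuity of
  \<open>P\<close> suffices.\<close>

lemma cauchy_pompeiu_weak:
  fixes P Q :: "complex \<Rightarrow> complex"
  assumes P: "continuous_on UNIV P" and Q: "continuous_on UNIV Q"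
    and weak: "\<And>\<phi>. Ck_on 1 UNIV \<phi> \<Longrightarrow> bounded_supp \<phi> \<Longrightarrow> (LINT z|lborel. wirt_bar \<phi> z * P z) = - (LINT z|lborel. \<phi> z * Q z)"
    and X: "Ck_on 1 UNIV X" "bounded_supp X"
  shows "of_real c0 * (X w * P w) = cauchy_transform (\<lambda>y. X y * Q y + wirt_bar X y * P y) w"
proof -
  note cc = Ck1_cont[OF X(1)] Ck1_wirt_cont(2)[OF X(1)]
  have hb: "bounded_supp (\<lambda>y. X y * Q y)" "bounded_supp (\<lambda>y. wirt_bar X y * P y)" "bounded_supp (\<lambda>y. X y * P y)"
    by (rule bounded_supp_mono[OF X(2)], simp) (rule bounded_supp_mono[OF bounded_supp_wirt(2)[OF X(2)]], simp, rule bounded_supp_mono[OF X(2)], simp)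
  have hc: "continuous_on UNIV (\<lambda>y. X y * Q y)" "continuous_on UNIV (\<lambda>y. wirt_bar X y * P y)" "continuous_on UNIV (\<lambda>y. X y * P y)"
    by (intro continuous_intros cc P Q)+
  have r1: "Ck_on 1 UNIV (\<lambda>y. reg_kernel (eps n) (w - y))" for n
    by (intro Ck_compose_plane[OF reg_kernel_Ck[OF eps(2)]] Ck_minus_diff Ck_const Ck_ident)
  \<comment> \<open>The sign comes from the reflection y \<mapsto> w - y.\<close>
  have wr: "wirt_bar (\<lambda>y. reg_kernel (eps n) (w - y)) y = - of_real (reg_delta (eps n) (w - y))" for n y
  proof -
    have d: "(\<lambda>y. w - y) differentiable (at y)" by simp
    have "wirt (\<lambda>y. w - y) y = - 1" "wirt_bar (\<lambda>y. w - y) y = 0"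
      by (subst wirt_diff; simp add: wirt_def wirt_bar_def pdx_eq_pd pdy_eq_pd)+
    then show ?thesis
      using wirt_compose(2)[of "reg_kernel (eps n)" "\<lambda>y. w - y" y, OF Ck1_diff[OF reg_kernel_Ck[OF eps(2)]] d]
      by (simp add: wirt_reg_kernel eps)
  qed
  have eq: "(LINT y|lborel. of_real (reg_delta (eps n) (w - y)) * (X y * P y)) = (LINT y|lborel. reg_kernel (eps n) (w - y) * (X y * Q y + wirt_bar X y * P y))" for n
  proof -
    let ?\<phi> = "\<lambda>y. reg_kernel (eps n) (w - y) * X y"
    have \<phi>: "Ck_on 1 UNIV ?\<phi>" "bounded_supp ?\<phi>"
      by (intro Ck_mult r1 X) (rule bounded_supp_mono[OF X(2)], simp)
    have w\<phi>: "wirt_bar ?\<phi> y = reg_kernel (eps n) (w - y) * wirt_bar X y - of_real (reg_delta (eps n) (w - y)) * X y" for y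
      using wirt_mult(2)[OF Ck1_diff[OF r1] Ck1_diff[OF X(1)]] by (simp add: wr)
    have jc: "continuous_on UNIV (\<lambda>y. complex_of_real (reg_delta (eps n) (w - y)))"
      by (intro continuous_intros continuous_on_compose2[OF reg_delta_cont[OF eps(2)]]) auto
    note i = integrable_mult_bounded_supp(1)[OF Ck1_cont[OF r1] hc(1) hb(1)] integrable_mult_bounded_supp(1)[OF Ck1_cont[OF r1] hc(2) hb(2)]
      integrable_mult_bounded_supp(1)[OF jc hc(3) hb(3)]
    have "(LINT y|lborel. reg_kernel (eps n) (w - y) * (wirt_bar X y * P y)) - (LINT y|lborel. of_real (reg_delta (eps n) (w - y)) * (X y * P y))
       = (LINT y|lborel. wirt_bar ?\<phi> y * P y)"
      unfolding w\<phi> using i(2,3) by (subst Bochner_Integration.integral_diff[symmetric]) (auto simp: algebra_simps)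
    also have "\<dots> = - (LINT y|lborel. reg_kernel (eps n) (w - y) * (X y * Q y))"
      unfolding weak[OF \<phi>] by (simp add: mult.assoc)
    finally have fin: "(LINT y|lborel. reg_kernel (eps n) (w - y) * (wirt_bar X y * P y)) - (LINT y|lborel. of_real (reg_delta (eps n) (w - y)) * (X y * P y))
      = - (LINT y|lborel. reg_kernel (eps n) (w - y) * (X y * Q y))" .
    have "(LINT y|lborel. reg_kernel (eps n) (w - y) * (X y * Q y + wirt_bar X y * P y))
       = (LINT y|lborel. reg_kernel (eps n) (w - y) * (X y * Q y)) + (LINT y|lborel. reg_kernel (eps n) (w - y) * (wirt_bar X y * P y))"
      using i(1,2) by (simp add: distrib_left)
    also have "\<dots> = (LINT y|lborel. of_real (reg_delta (eps n) (w - y)) * (X y * P y))"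
    proof -
      have "A + B = C" if "B - C = - A" for A B C :: complex using that by algebra
      then show ?thesis using fin by blast
    qed
    finally show ?thesis by simp
  qed
  have "(\<lambda>n. LINT y|lborel. of_real (reg_delta (eps n) (w - y)) * (X y * P y)) \<longlonglongrightarrow> of_real c0 * (X w * P w)"
    by (rule reg_delta_conv_tendsto[OF hc(3) hb(3)])
  moreover have "(\<lambda>n. LINT y|lborel. of_real (reg_delta (eps n) (w - y)) * (X y * P y)) \<longlonglongrightarrow> cauchy_transform (\<lambda>y. X y * Q y + wirt_bar X y * P y) w"
    unfolding eq by (rule reg_kernel_conv_tendsto) (intro continuous_intros hc bounded_supp_add hb)+
  ultimately show ?thesis by (rule LIMSEQ_unique)
qed

section \<open>The Cauchy transform\<close>

text \<open>The exponent is fixed at 1/2: the Cauchy transform produces it when its kernel is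
  compared with \<open>weight\<close>, and it is enough to make the kernel derivative
  integrable.\<close>

definition locally_hoelder :: "(complex \<Rightarrow> complex) \<Rightarrow> bool" where
  "locally_hoelder f \<longleftrightarrow> (\<forall>R. \<exists>L\<ge>0. \<forall>x\<in>cball 0 R. \<forall>y\<in>cball 0 R. cmod (f x - f y) \<le> L * sqrt (cmod (x - y)))"

lemma locally_hoelderE:
  assumes "locally_hoelder f"
  obtains L where "L \<ge> 0" "\<And>x y. cmod x \<le> R \<Longrightarrow> cmod y \<le> R \<Longrightarrow> cmod (f x - f y) \<le> L * sqrt (cmod (x - y))"
  using assms[unfolded locally_hoelder_def, rule_format, of R] by auto

lemma locally_hoelderI:
  assumes "\<And>R. R > 0 \<Longrightarrow> \<exists>L. \<forall>x y. cmod x \<le> R \<longrightarrow> cmod y \<le> R \<longrightarrow> cmod (f x - f y) \<le> L * sqrt (cmod (x - y))"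
  shows "locally_hoelder f"
  unfolding locally_hoelder_def
proof
  fix R :: real
  obtain L where L: "\<And>x y. cmod x \<le> max R 1 \<Longrightarrow> cmod y \<le> max R 1 \<Longrightarrow> cmod (f x - f y) \<le> L * sqrt (cmod (x - y))"
  proof -
    have "0 < max R 1" by (simp add: less_max_iff_disj)
    from assms[OF this] show ?thesis using that by blast
  qed
  have "cmod (f x - f y) \<le> \<bar>L\<bar> * sqrt (cmod (x - y))" if "x \<in> cball 0 R" "y \<in> cball 0 R" for x y
    using that by (intro order_trans[OF L mult_right_mono]) auto
  then show "\<exists>L\<ge>0. \<forall>x\<in>cball 0 R. \<forall>y\<in>cball 0 R. cmod (f x - f y) \<le> L * sqrt (cmod (x - y))"
    by (intro exI[of _ "\<bar>L\<bar>"]) auto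
qed

lemma locally_hoelder_add: "locally_hoelder f \<Longrightarrow> locally_hoelder g \<Longrightarrow> locally_hoelder (\<lambda>z. f z + g z)"
proof (rule locally_hoelderI)
  fix R :: real assume f: "locally_hoelder f" and g: "locally_hoelder g"
  obtain L where L: "L \<ge> 0" "\<And>x y. cmod x \<le> R \<Longrightarrow> cmod y \<le> R \<Longrightarrow> cmod (f x - f y) \<le> L * sqrt (cmod (x - y))"
    using locally_hoelderE[OF f] by metis
  obtain M where M: "M \<ge> 0" "\<And>x y. cmod x \<le> R \<Longrightarrow> cmod y \<le> R \<Longrightarrow> cmod (g x - g y) \<le> M * sqrt (cmod (x - y))"
    using locally_hoelderE[OF g] by metis
  have "cmod (f x + g x - (f y + g y)) \<le> (L + M) * sqrt (cmod (x - y))" if "cmod x \<le> R" "cmod y \<le> R" for x y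
    using norm_triangle_ineq[of "f x - f y" "g x - g y"] L(2)[OF that] M(2)[OF that]
    by (simp add: algebra_simps)
  then show "\<exists>L. \<forall>x y. cmod x \<le> R \<longrightarrow> cmod y \<le> R \<longrightarrow> cmod (f x + g x - (f y + g y)) \<le> L * sqrt (cmod (x - y))"
    by blast
qed

lemma locally_hoelder_mult: "locally_hoelder f \<Longrightarrow> locally_hoelder g \<Longrightarrow> locally_hoelder (\<lambda>z. f z * g z)"
proof (rule locally_hoelderI)
  fix R :: real assume f: "locally_hoelder f" and g: "locally_hoelder g" and R: "R > 0"
  obtain L where L: "L \<ge> 0" "\<And>x y. cmod x \<le> R \<Longrightarrow> cmod y \<le> R \<Longrightarrow> cmod (f x - f y) \<le> L * sqrt (cmod (x - y))"
    using locally_hoelderE[OF f] by metis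
  obtain M where M: "M \<ge> 0" "\<And>x y. cmod x \<le> R \<Longrightarrow> cmod y \<le> R \<Longrightarrow> cmod (g x - g y) \<le> M * sqrt (cmod (x - y))"
    using locally_hoelderE[OF g] by metis
  \<comment> \<open>Products need bounds on the factors themselves: the value at 0 plus the
    oscillation over the ball.\<close>
  have bd: "cmod (u x) \<le> cmod (u 0) + K * sqrt R"
    if "cmod x \<le> R" "K \<ge> 0" "\<And>x y. cmod x \<le> R \<Longrightarrow> cmod y \<le> R \<Longrightarrow> cmod (u x - u y) \<le> K * sqrt (cmod (x - y))" for u x K
  proof -
    have "cmod (u x) \<le> cmod (u 0) + cmod (u x - u 0)" by norm
    also have "cmod (u x - u 0) \<le> K * sqrt (cmod x)" using that(3)[of x 0] that(1) R by simp
    also have "\<dots> \<le> K * sqrt R" using that by (intro mult_left_mono) auto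
    finally show ?thesis by simp
  qed
  define A where "A = cmod (f 0) + L * sqrt R"
  define B where "B = cmod (g 0) + M * sqrt R"
  have "cmod (f x * g x - f y * g y) \<le> (A * M + L * B) * sqrt (cmod (x - y))" if "cmod x \<le> R" "cmod y \<le> R" for x y
  proof -
    have "cmod (f x * g x - f y * g y) = cmod (f x * (g x - g y) + (f x - f y) * g y)"
      by (simp add: algebra_simps)
    also have "\<dots> \<le> cmod (f x) * cmod (g x - g y) + cmod (f x - f y) * cmod (g y)"
      by (rule order_trans[OF norm_triangle_ineq]) (simp add: norm_mult)
    also have "\<dots> \<le> A * (M * sqrt (cmod (x - y))) + (L * sqrt (cmod (x - y))) * B"
      unfolding A_def B_def
      by (intro add_mono mult_mono bd[OF that(1) L] bd[OF that(2) M] L(2) M(2) that) (use L M R in auto)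
    finally show ?thesis by (simp add: algebra_simps)
  qed
  then show "\<exists>L. \<forall>x y. cmod x \<le> R \<longrightarrow> cmod y \<le> R \<longrightarrow> cmod (f x * g x - f y * g y) \<le> L * sqrt (cmod (x - y))"
    by blast
qed

lemma locally_hoelder_C1:
  assumes "Ck_on 1 UNIV f" shows "locally_hoelder f"
proof (rule locally_hoelderI)
  fix R :: real assume R: "R > 0"
  obtain M where M: "M > 0" "\<And>x y. x \<in> cball 0 R \<Longrightarrow> y \<in> cball 0 R \<Longrightarrow> norm (f x - f y) \<le> M * cmod (x - y)"
    using Ck1_lipschitz_cball[OF assms] by metis
  have "cmod (f x - f y) \<le> (M * sqrt (2 * R)) * sqrt (cmod (x - y))" if "cmod x \<le> R" "cmod y \<le> R" for x y
  proof -
    have "cmod (x - y) \<le> 2 * R" using norm_triangle_ineq4[of x y] that by simp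
    then have "sqrt (cmod (x - y)) * sqrt (cmod (x - y)) \<le> sqrt (2 * R) * sqrt (cmod (x - y))"
      by (intro mult_right_mono) auto
    then have "M * cmod (x - y) \<le> M * (sqrt (2 * R) * sqrt (cmod (x - y)))"
      using M(1) by (intro mult_left_mono) auto
    then show ?thesis using M(2)[of x y] that by simp
  qed
  then show "\<exists>L. \<forall>x y. cmod x \<le> R \<longrightarrow> cmod y \<le> R \<longrightarrow> cmod (f x - f y) \<le> L * sqrt (cmod (x - y))"
    by blast
qed

lemma locally_hoelder_cnj: "locally_hoelder f \<Longrightarrow> locally_hoelder (\<lambda>z. cnj (f z))"
  unfolding locally_hoelder_def complex_cnj_diff[symmetric] complex_mod_cnj .

text \<open>With p = |a|^(-1/2) and q = |b|^(-1/2) the left-hand side is |a - b| p^2 q^2. One root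
  of |a - b| is kept and the other is at most 1/p + 1/q, which leaves p q^2 + p^2 q <= p^3 + q^3.
  The conventions \<open>inverse 0 = 0\<close> and \<open>weight 0 = 0\<close> keep the bound valid
  at the origin.\<close>

lemma inverse_diff_bound:
  "cmod (inverse a - inverse b) \<le> 2 * sqrt (cmod (a - b)) * (weight a + weight b)"
proof -
  have one: "cmod (inverse a) \<le> 2 * sqrt (cmod a) * weight a" for a
  proof -
    have "cmod (inverse a) \<le> sqrt (cmod a) * weight a" by (rule cmod_inverse_le_weight) simp
    also have "\<dots> \<le> 2 * sqrt (cmod a) * weight a" by (intro mult_right_mono) auto
    finally show ?thesis .
  qed
  consider "a = 0" | "b = 0" | "a \<noteq> 0" "b \<noteq> 0" by blast
  then show ?thesis
  proof cases
    case 1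
    then show ?thesis using one[of b] by simp
  next
    case 2
    then show ?thesis using one[of a] by simp
  next
    case 3
    define p where "p = cmod a powr (-(1/2))"
    define q where "q = cmod b powr (-(1/2))"
    have pq: "p > 0" "q > 0" using 3 by (simp_all add: p_def q_def)
    have pw: "(cmod a powr (-(1/2))) ^ 2 = cmod a powr (-1)" "(cmod a powr (-(1/2))) ^ 3 = weight a" if "a \<noteq> 0" for a
      using that powr_power[where z="cmod a" and n=2 and u="-(1/2)"] powr_power[where z="cmod a" and n=3 and u="-(1/2)"] by simp_all
    have A: "inverse (cmod a) = p\<^sup>2" "weight a = p ^ 3" "sqrt (cmod a) = inverse p"
      and B: "inverse (cmod b) = q\<^sup>2" "weight b = q ^ 3" "sqrt (cmod b) = inverse q"
      using 3 pw[of a] pw[of b] by (simp_all add: p_def q_def powr_minus powr_half_sqrt)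
    have d: "cmod (a - b) = sqrt (cmod (a - b)) * sqrt (cmod (a - b))" by simp
    have s: "sqrt (cmod (a - b)) \<le> inverse p + inverse q"
    proof -
      have "sqrt (cmod (a - b)) \<le> sqrt (cmod a + cmod b)" by (simp add: norm_triangle_ineq4)
      also have "\<dots> \<le> sqrt (cmod a) + sqrt (cmod b)" by (rule sqrt_add_le_add_sqrt) auto
      finally show ?thesis unfolding A B .
    qed
    have "(inverse p + inverse q) * (p\<^sup>2 * q\<^sup>2) = p * q\<^sup>2 + p\<^sup>2 * q"
      using pq by (simp add: field_simps power2_eq_square)
    also have "\<dots> \<le> p ^ 3 + q ^ 3"
    proof -
      have "p ^ 3 + q ^ 3 - (p * q\<^sup>2 + p\<^sup>2 * q) = (p + q) * (p - q)\<^sup>2"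
        by (simp add: power2_eq_square power3_eq_cube algebra_simps)
      moreover have "0 \<le> (p + q) * (p - q)\<^sup>2" using pq by simp
      ultimately show ?thesis by linarith
    qed
    also have "\<dots> \<le> 2 * (p ^ 3 + q ^ 3)" using pq by simp
    finally have poly: "(inverse p + inverse q) * (p\<^sup>2 * q\<^sup>2) \<le> 2 * (p ^ 3 + q ^ 3)" .
    have "inverse a - inverse b = (b - a) * (inverse a * inverse b)" using 3 by (simp add: field_simps)
    then have "cmod (inverse a - inverse b) = cmod (a - b) * (p\<^sup>2 * q\<^sup>2)"
      using A(1) B(1) by (simp add: norm_mult norm_inverse norm_minus_commute)
    also have "\<dots> = sqrt (cmod (a - b)) * (sqrt (cmod (a - b)) * (p\<^sup>2 * q\<^sup>2))"
      using d by (metis mult.assoc)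
    also have "\<dots> \<le> sqrt (cmod (a - b)) * ((inverse p + inverse q) * (p\<^sup>2 * q\<^sup>2))"
      using s by (intro mult_left_mono mult_right_mono) auto
    also have "\<dots> \<le> sqrt (cmod (a - b)) * (2 * (p ^ 3 + q ^ 3))"
      using poly by (intro mult_left_mono) auto
    finally show ?thesis unfolding A B by (simp add: algebra_simps)
  qed
qed

text \<open>The preceding bound is integrated against the bounded function \<open>h\<close>. For
  points of the ball of radius \<open>S\<close> and \<open>z\<close> in the support of
  \<open>h\<close>, both x - z and y - z stay in the ball of radius \<open>R + S\<close>, so each
  weight integrates to at most \<open>W\<close> and the constant is 2 * M * (W + W).\<close>

lemma cauchy_transform_locally_hoelder:
  assumes h: "continuous_on UNIV h" "bounded_supp h"
  shows "locally_hoelder (cauchy_transform h)"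
proof (rule locally_hoelderI)
  fix S :: real assume S: "S > 0"
  obtain R where R: "R > 0" "\<And>z. R \<le> cmod z \<Longrightarrow> h z = 0" using bounded_suppE[OF h(2)] by blast
  obtain M where M: "M > 0" "\<And>z. norm (h z) \<le> M" using bounded_bounded_supp[OF h] by blast
  define W where "W = (LINT z|lborel. indicator (cball 0 (R + S)) z *\<^sub>R weight z)"
  define g where "g = (\<lambda>z. indicator (cball 0 (R + S)) z *\<^sub>R weight z)"
  have gi: "integrable lborel g" unfolding g_def using R S by (intro integrable_cmod_powr) simp
  have gm: "g \<in> borel_measurable borel"
    unfolding g_def by (intro borel_measurable_scaleR borel_measurable_indicator powr_real_measurable) auto
  have gr: "integrable lborel (\<lambda>y. g (w - y))" "(LINT y|lborel. g (w - y)) = W" for w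
    using integrable_reflect[OF gm gi] lebesgue_integral_reflect[OF gm] by (auto simp: W_def g_def)
  have "cmod (cauchy_transform h x - cauchy_transform h y) \<le> (4 * M * W) * sqrt (cmod (x - y))" if xy: "cmod x \<le> S" "cmod y \<le> S" for x y
  proof -
    have "cauchy_transform h x - cauchy_transform h y = (LINT z|lborel. inverse (x - z) * h z - inverse (y - z) * h z)"
      unfolding cauchy_transform_def using cauchy_kernel_integrable[OF h] by simp
    also have "cmod \<dots> \<le> (LINT z|lborel. (2 * M * sqrt (cmod (x - y))) * (g (x - z) + g (y - z)))"
    proof (rule norm_integral_le)
      show "integrable lborel (\<lambda>z. (2 * M * sqrt (cmod (x - y))) * (g (x - z) + g (y - z)))"
        by (intro integrable_mult_right Bochner_Integration.integrable_add gr)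
      fix z
      show "norm (inverse (x - z) * h z - inverse (y - z) * h z) \<le> (2 * M * sqrt (cmod (x - y))) * (g (x - z) + g (y - z))"
      proof (cases "R \<le> cmod z")
        case True
        then show ?thesis using R(2)[OF True] M(1) by (simp add: g_def)
      next
        case False
        then have g: "g (x - z) = weight (x - z)" "g (y - z) = weight (y - z)"
          using xy norm_triangle_ineq4[of x z] norm_triangle_ineq4[of y z] by (simp_all add: g_def)
        have "norm (inverse (x - z) * h z - inverse (y - z) * h z) = cmod (inverse (x - z) - inverse (y - z)) * cmod (h z)"
          by (simp add: norm_mult[symmetric] algebra_simps)
        also have "\<dots> \<le> (2 * sqrt (cmod (x - y)) * (weight (x - z) + weight (y - z))) * M"
          using inverse_diff_bound[of "x - z" "y - z"] M by (intro mult_mono) auto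
        finally show ?thesis unfolding g by (simp add: algebra_simps)
      qed
    qed
    also have "\<dots> = (2 * M * sqrt (cmod (x - y))) * (W + W)"
      using gr by simp
    finally show ?thesis by (simp add: algebra_simps)
  qed
  then show "\<exists>L. \<forall>x y. cmod x \<le> S \<longrightarrow> cmod y \<le> S \<longrightarrow> cmod (cauchy_transform h x - cauchy_transform h y) \<le> L * sqrt (cmod (x - y))"
    by blast
qed

section \<open>Differentiability of the Cauchy transform\<close>

lemma LINT_eq_integral_cbox:
  fixes f :: "complex \<Rightarrow> complex"
  assumes "continuous_on UNIV f" "\<And>z. R \<le> cmod z \<Longrightarrow> f z = 0" 
  shows "(LINT z|lborel. f z) = integral (cbox (Complex (-R) (-R)) (Complex R R)) f"
proof -
  have b: "bounded_supp f" unfolding bounded_supp_def using assms(2) by blast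
  have "cmod z \<ge> R" if "z \<notin> cbox (Complex (-R) (-R)) (Complex R R)" for z
    using that abs_Re_le_cmod[of z] abs_Im_le_cmod[of z] by (auto simp: in_cbox_complex_iff)
  then have e: "(\<lambda>z. if z \<in> cbox (Complex (-R) (-R)) (Complex R R) then f z else 0) = f"
    using assms(2) by fastforce
  have "(LINT z|lborel. f z) = integral UNIV f"
    using integral_lborel[OF integrable_bounded_supp[OF assms(1) b]] by simp
  also have "\<dots> = integral (cbox (Complex (-R) (-R)) (Complex R R)) f"
    using integral_restrict_UNIV[of "cbox (Complex (-R) (-R)) (Complex R R)" f] unfolding e .
  finally show ?thesis .
qed

text \<open>As \<open>h\<close> is only continuous, the derivative must fall on the kernel. Bounded
  support reduces the integral to a gauge integral over a fixed box, where the Leibniz rule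
  differentiates under the integral sign.\<close>

lemma conv_derivative:
  fixes k h :: "complex \<Rightarrow> complex"
  assumes k: "Ck_on 1 UNIV k" and h: "continuous_on UNIV h" "bounded_supp h"
  shows "((\<lambda>w. LINT y|lborel. k (w - y) * h y) has_derivative
      (\<lambda>d. Re d *\<^sub>R (LINT y|lborel. pdx k (w - y) * h y) + Im d *\<^sub>R (LINT y|lborel. pdy k (w - y) * h y))) (at w)"
    and "e = 1 \<or> e = \<i> \<Longrightarrow> continuous_on UNIV (\<lambda>w. LINT y|lborel. pd e k (w - y) * h y)"
proof -
  obtain R where R: "R > 0" "\<And>z. R \<le> cmod z \<Longrightarrow> h z = 0" using bounded_suppE[OF h(2)] by blast
  define B where "B = cbox (Complex (-R) (-R)) (Complex R R)"
  have kc: "continuous_on UNIV k" "continuous_on UNIV (pdx k)" "continuous_on UNIV (pdy k)"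
    using k Ck1_cont[OF k] by (auto simp: One_nat_def)
  have c1: "continuous_on UNIV (\<lambda>y. u (w - y))" if "continuous_on UNIV u" for u :: "complex \<Rightarrow> complex" and w
    by (intro continuous_on_compose2[OF that] continuous_intros) auto
  have I: "(LINT y|lborel. u (w - y) * h y) = integral B (\<lambda>y. u (w - y) * h y)" if "continuous_on UNIV u" for u w
    unfolding B_def by (rule LINT_eq_integral_cbox) (use R in \<open>auto intro!: continuous_intros c1 that h\<close>)
  have c2: "continuous_on (UNIV \<times> B) (\<lambda>(x, t). u (x - t) * h t)" if "continuous_on UNIV u" for u
    unfolding case_prod_beta
    by (intro continuous_intros continuous_on_compose2[OF that] continuous_on_compose2[OF h(1)]) auto
  show "continuous_on UNIV (\<lambda>w. LINT y|lborel. pd e k (w - y) * h y)" if e: "e = 1 \<or> e = \<i>"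
    unfolding I[OF Ck1_pd_cont[OF k e]] B_def
    by (rule integral_continuous_on_param[OF c2[OF Ck1_pd_cont[OF k e], unfolded B_def]])
  have j: "(\<lambda>y. u (w - y) * h y) integrable_on B" if "continuous_on UNIV u" for u w
  proof -
    have "continuous_on UNIV (\<lambda>y. u (w - y) * h y)" by (intro continuous_on_mult c1 that h)
    then show ?thesis unfolding B_def
      using integrable_continuous continuous_on_subset subset_UNIV by blast
  qed
  \<comment> \<open>The Leibniz rule expects the derivative as a continuous family of bounded linear
    maps; it is assembled from the two coordinate functionals.\<close>
  define bR where "bR = Blinfun (\<lambda>d. complex_of_real (Re d))"
  define bI where "bI = Blinfun (\<lambda>d. complex_of_real (Im d))"
  have bR: "blinfun_apply bR d = of_real (Re d)" for d
    unfolding bR_def by (subst bounded_linear_Blinfun_apply)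
      (auto intro: bounded_linear_compose[OF bounded_linear_of_real bounded_linear_Re])
  have bI: "blinfun_apply bI d = of_real (Im d)" for d
    unfolding bI_def by (subst bounded_linear_Blinfun_apply)
      (auto intro: bounded_linear_compose[OF bounded_linear_of_real bounded_linear_Im])
  define fx where "fx w t = (blinfun_mult_right (pdx k (w - t) * h t) o\<^sub>L bR) + (blinfun_mult_right (pdy k (w - t) * h t) o\<^sub>L bI)" for w t
  have fx: "blinfun_apply (fx w t) d = (pdx k (w - t) * h t) * of_real (Re d) + (pdy k (w - t) * h t) * of_real (Im d)" for w t d
    by (simp add: fx_def blinfun.bilinear_simps bR bI)
  have fxc: "continuous_on (UNIV \<times> B) (\<lambda>(x, t). fx x t)"
    unfolding case_prod_beta fx_def
    by (intro continuous_on_add bounded_bilinear.continuous_on[OF bounded_bilinear_blinfun_compose]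
        bounded_linear.continuous_on[OF bounded_linear_blinfun_mult_right] continuous_on_const
        c2[unfolded case_prod_beta] kc)
  have "((\<lambda>w. integral B (\<lambda>y. k (w - y) * h y)) has_derivative blinfun_apply (integral B (fx w))) (at w within UNIV)"
    unfolding B_def
  proof (rule leibniz_rule)
    show "continuous_on (UNIV \<times> cbox (Complex (- R) (- R)) (Complex R R)) (\<lambda>(x, t). fx x t)"
      using fxc unfolding B_def .
    show "(\<lambda>y. k (x - y) * h y) integrable_on cbox (Complex (- R) (- R)) (Complex R R)" for x
      using j[OF kc(1)] unfolding B_def .
    fix x t :: complex
    have "((\<lambda>x. k (x - t) * h t) has_derivative (\<lambda>d. (Re d *\<^sub>R pdx k (x - t) + Im d *\<^sub>R pdy k (x - t)) * h t)) (at x)"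
    proof -
      have "((\<lambda>x. x - t) has_derivative (\<lambda>d. d)) (at x)" by (auto intro!: derivative_eq_intros)
      from has_derivative_mult_left[OF has_derivative_compose[OF this has_derivative_pdx_pdy[OF Ck1_diff[OF k]]], of "h t"]
      show ?thesis .
    qed
    then show "((\<lambda>x. k (x - t) * h t) has_derivative blinfun_apply (fx x t)) (at x within UNIV)"
      by (simp add: fx[abs_def] scaleR_conv_of_real algebra_simps)
  qed auto
  moreover have ap: "blinfun_apply (integral B (fx w)) d =
     Re d *\<^sub>R (LINT y|lborel. pdx k (w - y) * h y) + Im d *\<^sub>R (LINT y|lborel. pdy k (w - y) * h y)" for d
  proof -
    have i: "fx w integrable_on B" 
    proof -
      have "continuous_on B (\<lambda>t. case (w, t) of (x, t) \<Rightarrow> fx x t)"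
        by (rule continuous_on_compose2[OF fxc]) (auto intro!: continuous_intros)
      then show ?thesis unfolding B_def by (simp add: integrable_continuous)
    qed
    have "blinfun_apply (integral B (fx w)) d = integral B (\<lambda>t. (pdx k (w - t) * h t) * of_real (Re d) + (pdy k (w - t) * h t) * of_real (Im d))"
      unfolding fx[symmetric] by (rule blinfun_apply_integral[OF i])
    also have "\<dots> = integral B (\<lambda>t. pdx k (w - t) * h t) * of_real (Re d) + integral B (\<lambda>t. pdy k (w - t) * h t) * of_real (Im d)"
      using j[OF kc(2)] j[OF kc(3)] by (subst Henstock_Kurzweil_Integration.integral_add) (auto intro: integrable_on_mult_left)
    finally show ?thesis using I[OF kc(2)] I[OF kc(3)] by (simp add: scaleR_conv_of_real mult.commute)
  qed
  ultimately show "((\<lambda>w. LINT y|lborel. k (w - y) * h y) has_derivative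
      (\<lambda>d. Re d *\<^sub>R (LINT y|lborel. pdx k (w - y) * h y) + Im d *\<^sub>R (LINT y|lborel. pdy k (w - y) * h y))) (at w)"
    unfolding I[OF kc(1)] ap[abs_def] by simp
qed


text \<open>The moduli of the two Wirtinger derivatives add up to exactly 1 / (|z|^2 + \<delta>^2),
  which gives a bound uniform in \<delta>. The factor sqrt |z| is the one that a Hoelder function
  will provide.\<close>

lemma norm_pd_reg_kernel_le:
  assumes \<delta>: "\<delta> \<noteq> 0" and e: "e = 1 \<or> e = \<i>"
  shows "cmod (pd e (reg_kernel \<delta>) z) * sqrt (cmod z) \<le> weight z"
proof (cases "z = 0")
  case False
  have p: "0 < nsq z + \<delta>\<^sup>2" by (rule nsq_pos[OF \<delta>])
  have p2: "0 < (cmod z)\<^sup>2" using False by simp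
  have "cmod (pd e (reg_kernel \<delta>) z) \<le> cmod (wirt (reg_kernel \<delta>) z) + cmod (wirt_bar (reg_kernel \<delta>) z)"
    unfolding wirt_eq_pd[OF e] by (rule order_trans[OF norm_triangle_ineq]) (use e in \<open>auto simp: norm_mult\<close>)
  also have "\<dots> = (nsq z) * (nsq z + \<delta>\<^sup>2) powr (-2) + \<delta>\<^sup>2 * (nsq z + \<delta>\<^sup>2) powr (-2)"
    unfolding wirt_reg_kernel[OF \<delta>] reg_delta_def
    by (simp only: norm_mult norm_minus_cancel norm_power complex_mod_cnj norm_of_real abs_mult abs_of_nonneg[OF powr_ge_zero] cmod_power2 abs_of_nonneg[OF zero_le_power2])
  also have "\<dots> = (nsq z + \<delta>\<^sup>2) powr (-1)"
    unfolding powr_m1_m2[OF p] by (simp only: distrib_right)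
  also have "\<dots> \<le> ((cmod z)\<^sup>2) powr (-1)"
    using p2 by (intro powr_mono2') (auto simp: cmod_power2)
  also have "\<dots> = cmod z powr (-2)" using nsq_powr_half[of z "-1"] by (simp add: cmod_power2)
  finally have "cmod (pd e (reg_kernel \<delta>) z) * sqrt (cmod z) \<le> cmod z powr (-2) * cmod z powr (1/2)"
    by (simp add: powr_half_sqrt mult_right_mono)
  also have "\<dots> = weight z" using powr_add[of "cmod z" "-2" "1/2"] by simp
  finally show ?thesis .
qed simp

text \<open>This is -e / z^2, the derivative of 1/z in the direction \<open>e\<close>, in the shape
  in which it arises from \<open>reg_kernel\<close>; at 0 it is 0.\<close>

definition kernel_pd :: "complex \<Rightarrow> complex \<Rightarrow> complex" where
  "kernel_pd e z = - e * (cnj z)\<^sup>2 * of_real (nsq z powr (-2))"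

text \<open>The factor sqrt |z| extends the convergence to the origin, where the derivatives alone
  grow like 1 / (eps n)^2.\<close>

lemma pd_reg_kernel_tendsto:
  assumes e: "e = 1 \<or> e = \<i>"
  shows "(\<lambda>n. pd e (reg_kernel (eps n)) z * of_real (sqrt (cmod z))) \<longlonglongrightarrow> kernel_pd e z * of_real (sqrt (cmod z))"
proof (cases "z = 0")
  case False
  then have n: "nsq z \<noteq> 0" by (simp add: complex_eq_iff)
  have eq: "pd e (reg_kernel (eps n)) z = e * (- (cnj z)\<^sup>2 * of_real ((nsq z + (eps n)\<^sup>2) powr (-2))) + cnj e * of_real ((eps n)\<^sup>2 * (nsq z + (eps n)\<^sup>2) powr (-2))" for n
    unfolding wirt_eq_pd[OF e] wirt_reg_kernel[OF eps(2)] reg_delta_def ..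
  have "(\<lambda>n. e * (- (cnj z)\<^sup>2 * of_real ((nsq z + (eps n)\<^sup>2) powr (-2))) + cnj e * of_real ((eps n)\<^sup>2 * (nsq z + (eps n)\<^sup>2) powr (-2)))
     \<longlonglongrightarrow> e * (- (cnj z)\<^sup>2 * of_real ((nsq z + 0\<^sup>2) powr (-2))) + cnj e * of_real (0\<^sup>2 * (nsq z + 0\<^sup>2) powr (-2))"
    using n by (intro tendsto_intros eps) auto
  then have "(\<lambda>n. pd e (reg_kernel (eps n)) z) \<longlonglongrightarrow> kernel_pd e z"
    unfolding eq by (simp add: kernel_pd_def mult.assoc)
  then show ?thesis by (intro tendsto_intros)
qed simp

lemma norm_kernel_pd_le:
  assumes e: "e = 1 \<or> e = \<i>"
  shows "cmod (kernel_pd e z) * sqrt (cmod z) \<le> weight z"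
proof -
  have "(\<lambda>n. cmod (pd e (reg_kernel (eps n)) z * of_real (sqrt (cmod z)))) \<longlonglongrightarrow> cmod (kernel_pd e z * of_real (sqrt (cmod z)))"
    by (rule tendsto_norm[OF pd_reg_kernel_tendsto[OF e]])
  then have "cmod (kernel_pd e z * of_real (sqrt (cmod z))) \<le> weight z"
    by (rule LIMSEQ_le_const2) (use norm_pd_reg_kernel_le[OF eps(2) e] in \<open>auto simp: norm_mult\<close>)
  then show ?thesis by (simp add: norm_mult)
qed

lemma chi_le_indicator: "R > 0 \<Longrightarrow> cmod (chi R z) \<le> indicator (cball 0 (2 * R)) z"
  using chi_eq_0[of R z] cmod_chi_le[of R z] by (auto simp: indicator_def)

lemma measurable_kernel_pd [measurable]: "kernel_pd e \<in> borel_measurable borel"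
proof -
  have [measurable]: "(\<lambda>z. nsq z powr (-2)) \<in> borel_measurable borel"
    by (intro powr_real_measurable borel_cont continuous_intros)
  have [measurable]: "(\<lambda>z. - e * (cnj z)\<^sup>2) \<in> borel_measurable borel"
    by (intro borel_cont continuous_intros)
  show ?thesis unfolding kernel_pd_def[abs_def] by measurable
qed

text \<open>Dominated convergence with majorant 2 * \<open>weight\<close>. The integrals involve no
  base point, and this is what makes the convergence of the derivatives of the transform
  uniform.\<close>

lemma chi_kernel_pd_diff_tendsto:
  assumes e: "e = 1 \<or> e = \<i>" and R: "R > 0"
  defines "I \<equiv> \<lambda>n. (\<lambda>z. cmod (chi R z) * (cmod (pd e (reg_kernel (eps n)) z - kernel_pd e z) * sqrt (cmod z)))"
  shows "(\<lambda>n. LINT z|lborel. I n z) \<longlonglongrightarrow> 0" "integrable lborel (I n)"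
proof -
  have [measurable]: "pd e (reg_kernel (eps n)) \<in> borel_measurable borel" "chi R \<in> borel_measurable borel" for n
    by (intro borel_cont Ck1_pd_cont[OF reg_kernel_Ck[OF eps(2)] e] Ck1_cont[OF chi_Ck(2)])+
  have g: "integrable lborel (\<lambda>z. 2 * (indicator (cball 0 (2 * R)) z *\<^sub>R weight z))"
    using R by (intro integrable_mult_right integrable_cmod_powr) simp
  have bd: "norm (I n z) \<le> 2 * (indicator (cball 0 (2 * R)) z *\<^sub>R weight z)" for n z
  proof -
    have "cmod (pd e (reg_kernel (eps n)) z - kernel_pd e z) * sqrt (cmod z) \<le> (cmod (pd e (reg_kernel (eps n)) z) + cmod (kernel_pd e z)) * sqrt (cmod z)"
      by (intro mult_right_mono norm_triangle_ineq4) auto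
    also have "\<dots> \<le> 2 * weight z"
      using norm_pd_reg_kernel_le[OF eps(2) e, of n z] norm_kernel_pd_le[OF e, of z] by (simp add: distrib_right)
    finally have "cmod (pd e (reg_kernel (eps n)) z - kernel_pd e z) * sqrt (cmod z) \<le> 2 * weight z" .
    from mult_mono[OF chi_le_indicator[OF R] this] have "I n z \<le> indicator (cball 0 (2 * R)) z * (2 * weight z)"
      unfolding I_def by simp
    then show ?thesis by (simp add: I_def mult.left_commute)
  qed
  have m: "I n \<in> borel_measurable lborel" for n unfolding I_def by measurable
  show "integrable lborel (I n)"
    by (rule Bochner_Integration.integrable_bound[OF g m]) (use bd in \<open>auto intro!: AE_I2 order_trans[OF _ abs_ge_self]\<close>)
  have "(\<lambda>n. LINT z|lborel. I n z) \<longlonglongrightarrow> (LINT z|(lborel :: complex measure). 0 :: real)"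
  proof (rule integral_dominated_convergence[OF _ m g])
    show "AE z in lborel. (\<lambda>n. I n z) \<longlonglongrightarrow> 0"
    proof (rule AE_I2)
      fix z
      have "(\<lambda>n. cmod (chi R z) * cmod (pd e (reg_kernel (eps n)) z * of_real (sqrt (cmod z)) - kernel_pd e z * of_real (sqrt (cmod z))))
        \<longlonglongrightarrow> cmod (chi R z) * cmod (kernel_pd e z * of_real (sqrt (cmod z)) - kernel_pd e z * of_real (sqrt (cmod z)))"
        by (intro tendsto_intros pd_reg_kernel_tendsto e)
      then have "(\<lambda>n. cmod (chi R z) * cmod ((pd e (reg_kernel (eps n)) z - kernel_pd e z) * of_real (sqrt (cmod z)))) \<longlonglongrightarrow> 0"
        by (simp add: left_diff_distrib)
      then show "(\<lambda>n. I n z) \<longlonglongrightarrow> 0" by (simp add: I_def norm_mult)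
    qed
  qed (use bd in auto)
  then show "(\<lambda>n. LINT z|lborel. I n z) \<longlonglongrightarrow> 0" by simp
qed

text \<open>The limit kernel 1/z^2 is not absolutely integrable, so the derivative is first moved to
  the cutoff; the kernels that remain are dominated by 1/|z|.\<close>

lemma chi_pd_reg_kernel_tendsto:
  assumes e: "e = 1 \<or> e = \<i>" and R: "R > 0"
  shows "(\<lambda>n. LINT z|lborel. chi R z * pd e (reg_kernel (eps n)) z) \<longlonglongrightarrow> - (LINT z|lborel. pd e (chi R) z * inverse z)"
proof -
  have "(LINT z|lborel. chi R z * pd e (reg_kernel (eps n)) z) = - (LINT z|lborel. pd e (chi R) z * reg_kernel (eps n) z)" for n
    by (rule integral_pd_parts[OF reg_kernel_Ck[OF eps(2)] chi_Ck(2) chi_bounded_supp[OF R] e])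
  moreover have "(\<lambda>n. LINT z|lborel. pd e (chi R) z * reg_kernel (eps n) z) \<longlonglongrightarrow> (LINT z|lborel. pd e (chi R) z * inverse z)"
  proof (rule integral_dominated_convergence[where w="\<lambda>z. cmod (pd e (chi R) z * inverse z)"])
    have c: "continuous_on UNIV (pd e (chi R))" by (rule Ck1_pd_cont[OF chi_Ck(2) e])
    note [measurable] = borel_cont[OF c]
    show "(\<lambda>z. pd e (chi R) z * inverse z) \<in> borel_measurable lborel" by measurable
    show "(\<lambda>z. pd e (chi R) z * reg_kernel (eps n) z) \<in> borel_measurable lborel" for n
    proof -
      have [measurable]: "reg_kernel (eps n) \<in> borel_measurable borel"
        by (intro borel_cont Ck1_cont reg_kernel_Ck eps)
      show ?thesis by measurable
    qed
    have "integrable lborel (\<lambda>y. inverse (0 - y) * pd e (chi R) y)"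
      by (rule cauchy_kernel_integrable[OF c bounded_supp_pd[OF chi_bounded_supp[OF R]]])
    from integrable_norm[OF this] show "integrable lborel (\<lambda>z. cmod (pd e (chi R) z * inverse z))"
      by (simp add: norm_mult mult.commute)
    show "AE y in lborel. (\<lambda>n. pd e (chi R) y * reg_kernel (eps n) y) \<longlonglongrightarrow> pd e (chi R) y * inverse y"
      by (intro AE_I2 tendsto_mult reg_kernel_tendsto tendsto_const)
    show "AE y in lborel. norm (pd e (chi R) y * reg_kernel (eps n) y) \<le> cmod (pd e (chi R) y * inverse y)" for n
      unfolding norm_mult by (intro AE_I2 mult_left_mono cmod_reg_kernel_le) auto
  qed
  ultimately show ?thesis by (simp add: tendsto_minus)
qed

lemma Ck_on_subset: "Ck_on k T f \<Longrightarrow> S \<subseteq> T \<Longrightarrow> Ck_on k S f"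
  by (induction k arbitrary: f) (auto intro: continuous_on_subset)

lemma Ck1_of_balls:
  assumes "\<And>S. S > 0 \<Longrightarrow> \<exists>g. continuous_on (ball 0 S) (g 1) \<and> continuous_on (ball 0 S) (g \<i>) \<and>
     (\<forall>w\<in>ball 0 S. (f has_derivative (\<lambda>d. Re d *\<^sub>R g 1 w + Im d *\<^sub>R g \<i> w)) (at w))"
  shows "Ck_on 1 UNIV f"
proof -
  have *: "f differentiable (at w) \<and> isCont (pdx f) w \<and> isCont (pdy f) w" for w
  proof -
    have wS: "w \<in> ball 0 (cmod w + 1)" by simp
    obtain g where c: "continuous_on (ball 0 (cmod w + 1)) (g 1)" "continuous_on (ball 0 (cmod w + 1)) (g \<i>)"
      and g: "\<And>w'. w' \<in> ball 0 (cmod w + 1) \<Longrightarrow> (f has_derivative (\<lambda>d. Re d *\<^sub>R g 1 w' + Im d *\<^sub>R g \<i> w')) (at w')"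
      using assms[of "cmod w + 1"] by (auto simp: add_nonneg_pos)
    have d: "f differentiable (at w)" using g[OF wS] unfolding differentiable_def by blast
    have p: "pdx f w' = g 1 w'" "pdy f w' = g \<i> w'" if "w' \<in> ball 0 (cmod w + 1)" for w'
      using pd_eqI[OF g[OF that]] by (simp_all add: pdx_eq_pd pdy_eq_pd)
    have "continuous_on (ball 0 (cmod w + 1)) (pdx f)" "continuous_on (ball 0 (cmod w + 1)) (pdy f)"
      using c p by (metis continuous_on_cong)+
    then show ?thesis using d wS by (auto simp: continuous_on_eq_continuous_at)
  qed
  then show ?thesis
    by (simp add: One_nat_def continuous_on_eq_continuous_at)
qed

text \<open>The derivative of the kernel is of order \<open>\<bar>z\<bar>\<^sup>-\<^sup>2\<close>, which is not integrable; subtracting \<open>h w\<close> gains a factor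
  \<open>sqrt \<bar>z\<bar>\<close>, and the subtracted term is integrated by parts against a cutoff.\<close>

lemma cauchy_transform_Ck1:
  assumes h: "continuous_on UNIV h" "bounded_supp h" and hl: "locally_hoelder h"
  shows "Ck_on 1 UNIV (cauchy_transform h)"
proof (rule Ck1_of_balls)
  fix S :: real assume S: "S > 0"
  obtain R where R: "R > 0" "\<And>z. R \<le> cmod z \<Longrightarrow> h z = 0" using bounded_suppE[OF h(2)] by blast
  obtain M where M: "M > 0" "\<And>z. norm (h z) \<le> M" using bounded_bounded_supp[OF h] by blast
  \<comment> \<open>For |w| < S and |z| > \<rho> the point w - z lies outside the support of
    \<open>h\<close>, so \<open>chi \<rho>\<close> can be inserted for free. Since
    \<open>chi \<rho>\<close> reaches out to 2 * \<rho>, the Hoelder constant is taken on radius S +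
    2 * \<rho>.\<close>
  define \<rho> where "\<rho> = S + R"
  have \<rho>: "\<rho> > 0" using S R by (simp add: \<rho>_def)
  obtain L where L: "L \<ge> 0" "\<And>x y. cmod x \<le> S + 2 * \<rho> \<Longrightarrow> cmod y \<le> S + 2 * \<rho> \<Longrightarrow> cmod (h x - h y) \<le> L * sqrt (cmod (x - y))"
    using locally_hoelderE[OF hl, where R="S + 2 * \<rho>"] by blast
  define u where "u n w = (LINT y|lborel. reg_kernel (eps n) (w - y) * h y)" for n w
  define v where "v e n w = (LINT y|lborel. pd e (reg_kernel (eps n)) (w - y) * h y)" for e n w
  define B where "B e = - (LINT z|lborel. pd e (chi \<rho>) z * inverse z)" for e
  define g where "g e w = (LINT z|lborel. chi \<rho> z * (kernel_pd e z * (h (w - z) - h w))) + h w * B e" for e w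
  have hw: "cmod (h (w - z) - h w) \<le> L * sqrt (cmod z)" if "w \<in> ball 0 S" "cmod z \<le> 2 * \<rho>" for w z :: complex
    using L(2)[of "w - z" w] that norm_triangle_ineq4[of w z] \<rho> by simp
  have hc: "continuous_on UNIV (\<lambda>z. h (w - z))" for w
    by (intro continuous_on_compose2[OF h(1)] continuous_intros) auto
  have rkd: "(u n has_derivative (\<lambda>d. Re d *\<^sub>R v 1 n w + Im d *\<^sub>R v \<i> n w)) (at w)" for n and w :: complex
    using conv_derivative(1)[OF reg_kernel_Ck[OF eps(2)] h, where w=w] unfolding u_def[abs_def] v_def pdx_eq_pd pdy_eq_pd .
  \<comment> \<open>The error splits into a singular part, at most the Hoelder constant times an
    integral free of \<open>w\<close>, and \<open>h w\<close> times a number free of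
    \<open>w\<close>. Both tend to 0 uniformly in \<open>w\<close>.\<close>
  have ul: "uniform_limit (ball 0 S) (v e) (g e) sequentially" if e: "e = 1 \<or> e = \<i>" for e
  proof (rule uniform_limitI)
    fix \<epsilon> :: real assume \<epsilon>: "\<epsilon> > 0"
    define I where "I n = (LINT z|lborel. cmod (chi \<rho> z) * (cmod (pd e (reg_kernel (eps n)) z - kernel_pd e z) * sqrt (cmod z)))" for n
    define Bn where "Bn n = (LINT z|lborel. chi \<rho> z * pd e (reg_kernel (eps n)) z)" for n
    have "(\<lambda>n. L * I n + M * cmod (Bn n - B e)) \<longlonglongrightarrow> L * 0 + M * cmod (B e - B e)"
      unfolding I_def Bn_def
      by (intro tendsto_intros chi_kernel_pd_diff_tendsto(1)[OF e \<rho>] chi_pd_reg_kernel_tendsto[OF e \<rho>, folded B_def])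
    then have "\<forall>\<^sub>F n in sequentially. L * I n + M * cmod (Bn n - B e) < \<epsilon>"
      using order_tendstoD(2) \<epsilon> by fastforce
    then show "\<forall>\<^sub>F n in sequentially. \<forall>w\<in>ball 0 S. dist (v e n w) (g e w) < \<epsilon>"
    proof (rule eventually_mono, intro ballI)
      fix n and w :: complex assume n: "L * I n + M * cmod (Bn n - B e) < \<epsilon>" and w: "w \<in> ball 0 S"
      let ?D = "pd e (reg_kernel (eps n))"
      have Dc: "continuous_on UNIV ?D" by (rule Ck1_pd_cont[OF reg_kernel_Ck[OF eps(2)] e])
      have cc: "continuous_on UNIV (chi \<rho>)" by (rule Ck1_cont[OF chi_Ck(2)])
      have i1: "integrable lborel (\<lambda>z. chi \<rho> z * (?D z * (h (w - z) - h w)))"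
        by (intro integrable_mult_bounded_supp(2) continuous_intros Dc hc cc chi_bounded_supp \<rho>)
      have i2: "integrable lborel (\<lambda>z. chi \<rho> z * ?D z)"
        by (intro integrable_mult_bounded_supp(2) Dc cc chi_bounded_supp \<rho>)
      have i3: "integrable lborel (\<lambda>z. chi \<rho> z * (kernel_pd e z * (h (w - z) - h w)))"
      proof (rule integrable_weight_bounded[where C=L and R="2 * \<rho>"])
        note [measurable] = borel_cont[OF hc] borel_cont[OF cc]
        show "(\<lambda>z. chi \<rho> z * (kernel_pd e z * (h (w - z) - h w))) \<in> borel_measurable borel" by measurable
        fix z
        show "cmod (chi \<rho> z * (kernel_pd e z * (h (w - z) - h w))) \<le> L * (indicator (cball 0 (2 * \<rho>)) z * weight z)"
        proof (cases "cmod z \<le> 2 * \<rho>")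
          case True
          have "cmod (kernel_pd e z) * cmod (h (w - z) - h w) \<le> cmod (kernel_pd e z) * (L * sqrt (cmod z))"
            by (intro mult_left_mono hw w True) auto
          also have "\<dots> \<le> L * weight z"
            using mult_left_mono[OF norm_kernel_pd_le[OF e, of z] L(1)] by (simp add: mult.left_commute)
          finally have "cmod (kernel_pd e z) * cmod (h (w - z) - h w) \<le> L * weight z" .
          from mult_mono[OF cmod_chi_le[of \<rho> z] this]
          have "cmod (chi \<rho> z) * (cmod (kernel_pd e z) * cmod (h (w - z) - h w)) \<le> 1 * (L * weight z)" by simp
          then show ?thesis using True by (simp add: norm_mult)
        qed (use chi_eq_0[OF \<rho>] in simp)
      qed
      have "v e n w = (LINT z|lborel. ?D z * h (w - z))"
      proof -
        have "(\<lambda>z. ?D z * h (w - z)) \<in> borel_measurable borel"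
          by (intro borel_cont continuous_intros Dc hc)
        from lebesgue_integral_reflect[OF this, of w] show ?thesis by (simp add: v_def)
      qed
      also have "\<dots> = (LINT z|lborel. chi \<rho> z * (?D z * (h (w - z) - h w)) + h w * (chi \<rho> z * ?D z))"
      proof (intro Bochner_Integration.integral_cong refl)
        fix z
        have "chi \<rho> z = 1 \<or> h (w - z) = 0"
        proof (cases "cmod z \<le> \<rho>")
          case False
          then show ?thesis using R(2)[of "w - z"] w norm_triangle_ineq2[of z w] by (simp add: \<rho>_def norm_minus_commute)
        qed (use chi_eq_1[OF \<rho>] in simp)
        then show "?D z * h (w - z) = chi \<rho> z * (?D z * (h (w - z) - h w)) + h w * (chi \<rho> z * ?D z)"
          by (auto simp: algebra_simps)
      qed
      also have "\<dots> = (LINT z|lborel. chi \<rho> z * (?D z * (h (w - z) - h w))) + h w * Bn n"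
        unfolding Bn_def using i1 i2 by simp
      finally have vv: "v e n w = (LINT z|lborel. chi \<rho> z * (?D z * (h (w - z) - h w))) + h w * Bn n" .
      have alg: "A + c * b - (C + c * d) = (A - C) + c * (b - d)" for A C c b d :: complex
        by (simp add: algebra_simps)
      have vg: "v e n w - g e w = (LINT z|lborel. chi \<rho> z * (?D z * (h (w - z) - h w)) - chi \<rho> z * (kernel_pd e z * (h (w - z) - h w))) + h w * (Bn n - B e)"
        unfolding vv g_def Bochner_Integration.integral_diff[OF i1 i3] by (rule alg)
      have "cmod (v e n w - g e w) \<le> cmod (LINT z|lborel. chi \<rho> z * (?D z * (h (w - z) - h w)) - chi \<rho> z * (kernel_pd e z * (h (w - z) - h w))) + cmod (h w) * cmod (Bn n - B e)"
        unfolding vg by (rule order_trans[OF norm_triangle_ineq]) (simp add: norm_mult)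
      also have "\<dots> \<le> L * I n + M * cmod (Bn n - B e)"
      proof (rule add_mono[OF _ mult_right_mono[OF M(2) norm_ge_zero]])
        have "cmod (LINT z|lborel. chi \<rho> z * (?D z * (h (w - z) - h w)) - chi \<rho> z * (kernel_pd e z * (h (w - z) - h w)))
          \<le> (LINT z|lborel. L * (cmod (chi \<rho> z) * (cmod (?D z - kernel_pd e z) * sqrt (cmod z))))"
        proof (rule norm_integral_le)
          show "integrable lborel (\<lambda>z. L * (cmod (chi \<rho> z) * (cmod (?D z - kernel_pd e z) * sqrt (cmod z))))"
            by (rule integrable_mult_right[OF chi_kernel_pd_diff_tendsto(2)[OF e \<rho>]])
          fix z
          show "norm (chi \<rho> z * (?D z * (h (w - z) - h w)) - chi \<rho> z * (kernel_pd e z * (h (w - z) - h w)))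
             \<le> L * (cmod (chi \<rho> z) * (cmod (?D z - kernel_pd e z) * sqrt (cmod z)))"
          proof (cases "cmod z \<le> 2 * \<rho>")
            case True
            have "norm (chi \<rho> z * (?D z * (h (w - z) - h w)) - chi \<rho> z * (kernel_pd e z * (h (w - z) - h w)))
              = cmod (chi \<rho> z) * cmod (?D z - kernel_pd e z) * cmod (h (w - z) - h w)"
            proof -
              have "x * (y * c) - x * (d * c) = x * (y - d) * c" for x y c d :: complex
                by (simp add: algebra_simps)
              then show ?thesis by (simp only: norm_mult)
            qed
            also have "\<dots> \<le> cmod (chi \<rho> z) * cmod (?D z - kernel_pd e z) * (L * sqrt (cmod z))"
              by (intro mult_left_mono hw w True) auto
            finally show ?thesis by (simp add: algebra_simps)
          qed (use chi_eq_0[OF \<rho>] in simp)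
        qed
        then show "cmod (LINT z|lborel. chi \<rho> z * (?D z * (h (w - z) - h w)) - chi \<rho> z * (kernel_pd e z * (h (w - z) - h w))) \<le> L * I n"
          by (simp add: I_def)
      qed
      finally show "dist (v e n w) (g e w) < \<epsilon>" using n by (simp add: dist_norm)
    qed
  qed
  have gc: "continuous_on (ball 0 S) (g e)" if e: "e = 1 \<or> e = \<i>" for e
  proof (rule uniform_limit_theorem[OF _ ul[OF e]])
    have "continuous_on UNIV (v e n)" for n
      unfolding v_def[abs_def] by (rule conv_derivative(2)[OF reg_kernel_Ck[OF eps(2)] h e])
    then show "\<forall>\<^sub>F n in sequentially. continuous_on (ball 0 S) (v e n)"
      by (intro always_eventually allI) (auto intro: continuous_on_subset)
  qed simp
  \<comment> \<open>Termwise differentiation: the derivatives converge uniformly on the convex ball,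
    and the functions converge at its centre.\<close>
  have "\<exists>G. \<forall>w\<in>ball 0 S. (\<lambda>n. u n w) \<longlonglongrightarrow> G w \<and>
     (G has_derivative (\<lambda>d. Re d *\<^sub>R g 1 w + Im d *\<^sub>R g \<i> w)) (at w within ball 0 S)"
  proof (rule has_derivative_sequence)
    show "(u n has_derivative (\<lambda>d. Re d *\<^sub>R v 1 n w + Im d *\<^sub>R v \<i> n w)) (at w within ball 0 S)" for n and w :: complex
      by (rule has_derivative_at_withinI[OF rkd])
    show "0 \<in> ball 0 S" using S by simp
    show "(\<lambda>n. u n 0) \<longlonglongrightarrow> cauchy_transform h 0" unfolding u_def by (rule reg_kernel_conv_tendsto[OF h])
    fix \<epsilon> :: real assume "\<epsilon> > 0"
    then have e2: "\<epsilon> / 2 > 0" by simp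
    have "\<forall>\<^sub>F n in sequentially. (\<forall>w\<in>ball 0 S. dist (v 1 n w) (g 1 w) < \<epsilon>/2) \<and> (\<forall>w\<in>ball 0 S. dist (v \<i> n w) (g \<i> w) < \<epsilon>/2)"
      using uniform_limitD[OF ul e2, of 1] uniform_limitD[OF ul e2, of \<i>] by (simp add: eventually_conj)
    then show "\<forall>\<^sub>F n in sequentially. \<forall>w\<in>ball 0 S. \<forall>d.
       norm (Re d *\<^sub>R v 1 n w + Im d *\<^sub>R v \<i> n w - (Re d *\<^sub>R g 1 w + Im d *\<^sub>R g \<i> w)) \<le> \<epsilon> * norm d"
    proof (rule eventually_mono, intro ballI allI)
      fix n and w d :: complex
      assume a: "(\<forall>w\<in>ball 0 S. dist (v 1 n w) (g 1 w) < \<epsilon>/2) \<and> (\<forall>w\<in>ball 0 S. dist (v \<i> n w) (g \<i> w) < \<epsilon>/2)" and w: "w \<in> ball 0 S"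
      have "norm (Re d *\<^sub>R v 1 n w + Im d *\<^sub>R v \<i> n w - (Re d *\<^sub>R g 1 w + Im d *\<^sub>R g \<i> w))
        = norm (Re d *\<^sub>R (v 1 n w - g 1 w) + Im d *\<^sub>R (v \<i> n w - g \<i> w))"
        by (simp add: algebra_simps)
      also have "\<dots> \<le> \<bar>Re d\<bar> * norm (v 1 n w - g 1 w) + \<bar>Im d\<bar> * norm (v \<i> n w - g \<i> w)"
        by (rule order_trans[OF norm_triangle_ineq]) simp
      also have "\<dots> \<le> norm d * (\<epsilon>/2) + norm d * (\<epsilon>/2)"
        using a w by (intro add_mono mult_mono abs_Re_le_cmod abs_Im_le_cmod) (auto simp: dist_norm less_imp_le)
      finally show "norm (Re d *\<^sub>R v 1 n w + Im d *\<^sub>R v \<i> n w - (Re d *\<^sub>R g 1 w + Im d *\<^sub>R g \<i> w)) \<le> \<epsilon> * norm d"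
        by (simp add: mult.commute)
    qed
  qed auto
  then obtain G where G: "\<And>w. w \<in> ball 0 S \<Longrightarrow> (\<lambda>n. u n w) \<longlonglongrightarrow> G w"
    "\<And>w. w \<in> ball 0 S \<Longrightarrow> (G has_derivative (\<lambda>d. Re d *\<^sub>R g 1 w + Im d *\<^sub>R g \<i> w)) (at w within ball 0 S)"
    by blast
  have GC: "G w = cauchy_transform h w" if "w \<in> ball 0 S" for w :: complex
    using LIMSEQ_unique[OF G(1)[OF that]] reg_kernel_conv_tendsto[OF h, of w] unfolding u_def by blast
  have "(cauchy_transform h has_derivative (\<lambda>d. Re d *\<^sub>R g 1 w + Im d *\<^sub>R g \<i> w)) (at w)" if w: "w \<in> ball 0 S" for w :: complex
  proof -
    have "(G has_derivative (\<lambda>d. Re d *\<^sub>R g 1 w + Im d *\<^sub>R g \<i> w)) (at w)"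
      using G(2)[OF w] unfolding at_within_open[OF w open_ball] .
    then show ?thesis by (rule has_derivative_transform_within_open[OF _ open_ball w GC])
  qed
  then show "\<exists>g. continuous_on (ball 0 S) (g 1) \<and> continuous_on (ball 0 S) (g \<i>) \<and>
     (\<forall>w\<in>ball 0 S. (cauchy_transform h has_derivative (\<lambda>d. Re d *\<^sub>R g 1 w + Im d *\<^sub>R g \<i> w)) (at w))"
    using gc by (intro exI[of _ g]) simp
qed

text \<open>On the ball of radius \<open>R\<close> the function \<open>P\<close> is a multiple of
  the Cauchy transform of \<open>h R\<close>. Continuity of \<open>h R\<close> gives the first
  claim. Since \<open>h R\<close> contains \<open>P\<close> itself, that claim is what makes
  \<open>h R\<close> Hoelder continuous when \<open>Q\<close> is, and the transform gains a
  derivative.\<close>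

lemma weak_dbar_regularity:
  fixes P Q :: "complex \<Rightarrow> complex"
  assumes P: "continuous_on UNIV P" and Q: "continuous_on UNIV Q"
    and weak: "\<And>\<phi>. Ck_on 1 UNIV \<phi> \<Longrightarrow> bounded_supp \<phi> \<Longrightarrow> (LINT z|lborel. wirt_bar \<phi> z * P z) = - (LINT z|lborel. \<phi> z * Q z)"
  shows "locally_hoelder P" and "locally_hoelder Q \<Longrightarrow> Ck_on 1 UNIV P"
proof -
  define h where "h R = (\<lambda>y. chi R y * Q y + wirt_bar (chi R) y * P y)" for R
  have hb: "bounded_supp (h R)" if "R > 0" for R
    unfolding h_def by (intro bounded_supp_add bounded_supp_mono[OF chi_bounded_supp[OF that]] bounded_supp_mono[OF bounded_supp_wirt(2)[OF chi_bounded_supp[OF that]]]) simp_all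
  have hc: "continuous_on UNIV (h R)" for R
    unfolding h_def by (intro continuous_intros P Q Ck1_cont[OF chi_Ck(2)] Ck1_wirt_cont(2)[OF chi_Ck(2)])
  have eq: "P w = inverse (of_real c0) * cauchy_transform (h R) w" if "R > 0" "cmod w \<le> R" for R w
  proof -
    have "of_real c0 * P w = cauchy_transform (h R) w"
      using cauchy_pompeiu_weak[OF P Q weak chi_Ck(2) chi_bounded_supp[OF that(1)], of w] chi_eq_1[OF that]
      by (simp add: h_def)
    from this[symmetric] show ?thesis using c0_pos by simp
  qed
  show Pl: "locally_hoelder P"
  proof (rule locally_hoelderI)
    fix R :: real assume R: "R > 0"
    have "locally_hoelder (\<lambda>w. inverse (of_real c0) * cauchy_transform (h R) w)"
      by (intro locally_hoelder_mult locally_hoelder_C1[OF Ck_const] cauchy_transform_locally_hoelder hc hb R)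
    then show "\<exists>L. \<forall>x y. cmod x \<le> R \<longrightarrow> cmod y \<le> R \<longrightarrow> cmod (P x - P y) \<le> L * sqrt (cmod (x - y))"
      using locally_hoelderE[where R=R] eq[OF R] by metis
  qed
  assume Ql: "locally_hoelder Q"
  have hl: "locally_hoelder (h R)" for R
    unfolding h_def
    by (intro locally_hoelder_add locally_hoelder_mult Pl Ql locally_hoelder_C1 chi_Ck(2) Ck_wirt(2)) (use chi_Ck(1)[of R] in \<open>simp add: numeral_2_eq_2\<close>)
  have c: "Ck_on 1 UNIV (\<lambda>w. inverse (of_real c0) * cauchy_transform (h R) w)" if "R > 0" for R
    by (intro Ck_mult Ck_const cauchy_transform_Ck1 hc hb hl that)
  show "Ck_on 1 UNIV P"
  proof (rule Ck_on_local)
    fix z :: complex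
    have p: "cmod z + 1 > 0" by (simp add: add_nonneg_pos)
    show "\<exists>U g. open U \<and> z \<in> U \<and> Ck_on 1 U g \<and> (\<forall>\<zeta>\<in>U. P \<zeta> = g \<zeta>)"
      using eq[OF p] Ck_on_subset[OF c[OF p]]
      by (intro exI[of _ "ball 0 (cmod z + 1)"] exI[of _ "\<lambda>w. inverse (of_real c0) * cauchy_transform (h (cmod z + 1)) w"]) auto
  qed simp
qed

text \<open>With a = \<mu> o G, formal differentiation gives wirt_bar P + a * cnj (wirt_bar P) = q0.
  Eliminating the conjugate yields (1 - |a|^2) * wirt_bar P = q0 - a * cnj q0, so \<open>m\<close>
  is the determinant of the system and \<open>Q\<close> its solution. The regularity lemma is then
  used twice: first to make \<open>P\<close> Hoelder continuous, then, \<open>Q\<close> having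
  inherited this, to make it C^1.\<close>

theorem conjugate_beltrami_regularity:
  fixes G \<mu> :: "complex \<Rightarrow> complex"
  assumes G: "Ck_on 1 UNIV G" and \<mu>: "Ck_on 2 UNIV \<mu>"
    and eq: "\<And>z. wirt_bar G z = - \<mu> (G z) * cnj (wirt G z)" and lt: "\<And>z. cmod (\<mu> (G z)) < 1"
  shows "Ck_on 2 UNIV G"
proof -
  define a where "a z = \<mu> (G z)" for z
  define P where "P = wirt G"
  have \<mu>1: "Ck_on 1 UNIV \<mu>" by (rule Ck_on_mono[OF \<mu>]) auto
  have a1: "Ck_on 1 UNIV a" unfolding a_def[abs_def] by (rule Ck_compose_plane[OF \<mu>1 G])
  have Pc: "continuous_on UNIV P" unfolding P_def by (rule Ck1_wirt_cont[OF G])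
  have wbG: "wirt_bar G = (\<lambda>z. - a z * cnj (P z))" using eq by (auto simp: a_def P_def)
  define q0 where "q0 z = - (wirt a z * cnj (P z))" for z
  have q0c: "continuous_on UNIV q0" unfolding q0_def[abs_def] by (intro continuous_intros Pc Ck1_wirt_cont a1)
  define m where "m z = 1 - a z * cnj (a z)" for z
  have m0: "m z \<noteq> 0" for z
  proof -
    have "cmod (a z) * cmod (a z) < 1" using lt[of z] mult_strict_mono[of "cmod (a z)" 1 "cmod (a z)" 1] by (simp add: a_def)
    then have "cmod (a z * cnj (a z)) \<noteq> 1" by (simp add: norm_mult)
    then show ?thesis unfolding m_def by (metis norm_one right_minus_eq)
  qed
  have m1: "Ck_on 1 UNIV (\<lambda>z. inverse (m z))"
  proof (rule Ck_inverse[OF m0])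
    show "Ck_on 1 UNIV m" unfolding m_def[abs_def] by (intro Ck_minus_diff Ck_const Ck_mult Ck_cnj a1)
  qed
  define Q where "Q z = inverse (m z) * (q0 z - a z * cnj (q0 z))" for z
  have Qc: "continuous_on UNIV Q"
    unfolding Q_def[abs_def] by (intro continuous_intros Ck1_cont[OF m1] q0c Ck1_cont[OF a1])
  \<comment> \<open>the distribution \<open>wirt_bar P\<close>; \<open>Tid\<close> below is the weak \<open>wirt\<close>-derivative of the conjugate Beltrami equation\<close>
  define T where "T \<phi> = - (LINT z|lborel. wirt_bar \<phi> z * P z)" for \<phi>
  have Tid: "T \<phi> + cnj (T (\<lambda>z. cnj (\<phi> z * a z))) = (LINT z|lborel. \<phi> z * q0 z)"
    if \<phi>: "Ck_on 1 UNIV \<phi>" "bounded_supp \<phi>" for \<phi>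
  proof -
    have \<phi>a: "Ck_on 1 UNIV (\<lambda>z. \<phi> z * a z)" "bounded_supp (\<lambda>z. \<phi> z * a z)"
      by (intro Ck_mult \<phi> a1, rule bounded_supp_mono[OF \<phi>(2)], simp)
    have cPc: "continuous_on UNIV (\<lambda>z. cnj (P z))" by (intro continuous_intros Pc)
    have i1: "integrable lborel (\<lambda>z. wirt (\<lambda>z. \<phi> z * a z) z * cnj (P z))"
      by (rule integrable_mult_bounded_supp(2)[OF cPc Ck1_wirt_cont(1)[OF \<phi>a(1)] bounded_supp_wirt(1)[OF \<phi>a(2)]])
    have i2: "integrable lborel (\<lambda>z. \<phi> z * q0 z)"
      by (rule integrable_mult_bounded_supp(2)[OF q0c Ck1_cont[OF \<phi>(1)] \<phi>(2)])
    have "T \<phi> = - (LINT z|lborel. wirt \<phi> z * wirt_bar G z)"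
      unfolding T_def P_def integral_wirt_commute[OF G \<phi>] ..
    also have "\<dots> = (LINT z|lborel. - (wirt \<phi> z * wirt_bar G z))" by simp
    also have "\<dots> = (LINT z|lborel. wirt (\<lambda>z. \<phi> z * a z) z * cnj (P z) + \<phi> z * q0 z)"
      using wirt_mult(1)[OF Ck1_diff[OF \<phi>(1)] Ck1_diff[OF a1]]
      by (intro Bochner_Integration.integral_cong refl) (simp add: wbG q0_def algebra_simps)
    also have "\<dots> = (LINT z|lborel. wirt (\<lambda>z. \<phi> z * a z) z * cnj (P z)) + (LINT z|lborel. \<phi> z * q0 z)"
      using i1 i2 by simp
    also have "(LINT z|lborel. wirt (\<lambda>z. \<phi> z * a z) z * cnj (P z)) = - cnj (T (\<lambda>z. cnj (\<phi> z * a z)))"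
    proof -
      have "wirt_bar (\<lambda>z. cnj (\<phi> z * a z)) z = cnj (wirt (\<lambda>z. \<phi> z * a z) z)" for z
        by (rule wirt_cnj(2)[OF Ck1_diff[OF \<phi>a(1)]])
      then have "T (\<lambda>z. cnj (\<phi> z * a z)) = - (LINT z|lborel. cnj (wirt (\<lambda>z. \<phi> z * a z) z * cnj (P z)))"
        unfolding T_def by simp
      also have "(LINT z|lborel. cnj (wirt (\<lambda>z. \<phi> z * a z) z * cnj (P z))) = cnj (LINT z|lborel. wirt (\<lambda>z. \<phi> z * a z) z * cnj (P z))"
        by (rule integral_bounded_linear[OF bounded_linear_cnj i1])
      finally show ?thesis by simp
    qed
    finally show ?thesis by simp
  qed
  have weak: "(LINT z|lborel. wirt_bar \<phi> z * P z) = - (LINT z|lborel. \<phi> z * Q z)"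
    if \<phi>: "Ck_on 1 UNIV \<phi>" "bounded_supp \<phi>" for \<phi>
  proof -
    \<comment> \<open>The elimination is carried out on test functions, which may be multiplied by
      the C^1 functions \<open>a\<close> and \<open>inverse m\<close>. The identity for
      \<open>\<phi>1\<close> involves \<open>\<phi>2\<close>, the one for \<open>\<phi>2\<close>
      involves \<open>\<phi>3\<close>, and \<open>\<phi>1 - \<phi>3\<close> is \<phi> by the choice
      of \<open>m\<close>.\<close>
    define \<phi>1 where "\<phi>1 z = \<phi> z * inverse (m z)" for z
    have \<phi>1: "Ck_on 1 UNIV \<phi>1" "bounded_supp \<phi>1"
      unfolding \<phi>1_def[abs_def] by (intro Ck_mult \<phi> m1, rule bounded_supp_mono[OF \<phi>(2)], simp)
    define \<phi>2 where "\<phi>2 z = cnj (\<phi>1 z * a z)" for z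
    have \<phi>2: "Ck_on 1 UNIV \<phi>2" "bounded_supp \<phi>2"
      unfolding \<phi>2_def[abs_def] by (intro Ck_mult Ck_cnj \<phi>1 a1, rule bounded_supp_mono[OF \<phi>1(2)], simp)
    define \<phi>3 where "\<phi>3 z = \<phi>1 z * a z * cnj (a z)" for z
    have \<phi>3: "Ck_on 1 UNIV \<phi>3" "bounded_supp \<phi>3"
      unfolding \<phi>3_def[abs_def] by (intro Ck_mult Ck_cnj Ck_ident \<phi>1 a1, rule bounded_supp_mono[OF \<phi>1(2)], simp)
    have 1: "T \<phi>1 + cnj (T \<phi>2) = (LINT z|lborel. \<phi>1 z * q0 z)"
      using Tid[OF \<phi>1] by (simp add: \<phi>2_def[abs_def])
    have 2: "T \<phi>2 + cnj (T \<phi>3) = (LINT z|lborel. \<phi>2 z * q0 z)"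
      using Tid[OF \<phi>2] by (simp add: \<phi>2_def[abs_def] \<phi>3_def[abs_def])
    have 3: "cnj (LINT z|lborel. \<phi>2 z * q0 z) = (LINT z|lborel. \<phi>1 z * (a z * cnj (q0 z)))"
      using integral_bounded_linear[OF bounded_linear_cnj
          integrable_mult_bounded_supp(2)[OF q0c Ck1_cont[OF \<phi>2(1)] \<phi>2(2)]]
      by (simp add: \<phi>2_def mult.assoc)
    have 4: "cnj (T \<phi>2) + T \<phi>3 = (LINT z|lborel. \<phi>1 z * (a z * cnj (q0 z)))"
      using arg_cong[OF 2, of cnj] unfolding 3 by simp
    have i: "integrable lborel (\<lambda>z. \<phi>1 z * q0 z)" "integrable lborel (\<lambda>z. \<phi>1 z * (a z * cnj (q0 z)))"
      by (intro integrable_mult_bounded_supp(2) continuous_intros q0c Ck1_cont[OF a1] Ck1_cont[OF \<phi>1(1)] \<phi>1(2))+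
    have "T \<phi>1 - T \<phi>3 = (LINT z|lborel. \<phi>1 z * q0 z) - (LINT z|lborel. \<phi>1 z * (a z * cnj (q0 z)))"
      using 1 4 by (metis add_diff_cancel_left add.commute)
    also have "\<dots> = (LINT z|lborel. \<phi> z * Q z)"
      using i by (subst Bochner_Integration.integral_diff[symmetric])
        (auto intro!: Bochner_Integration.integral_cong simp: \<phi>1_def Q_def algebra_simps)
    finally have 5: "T \<phi>1 - T \<phi>3 = (LINT z|lborel. \<phi> z * Q z)" .
    have j: "integrable lborel (\<lambda>z. wirt_bar \<phi>1 z * P z)" "integrable lborel (\<lambda>z. wirt_bar \<phi>3 z * P z)"
      by (intro integrable_mult_bounded_supp(2) Pc Ck1_wirt_cont \<phi>1 \<phi>3 bounded_supp_wirt)+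
    have \<phi>eq: "\<phi> = (\<lambda>z. \<phi>1 z - \<phi>3 z)"
    proof
      fix z
      have "\<phi>1 z - \<phi>3 z = \<phi> z * (inverse (m z) * m z)"
        by (simp add: \<phi>1_def \<phi>3_def m_def algebra_simps)
      then show "\<phi> z = \<phi>1 z - \<phi>3 z" using m0[of z] by simp
    qed
    have "wirt_bar \<phi> z = wirt_bar \<phi>1 z - wirt_bar \<phi>3 z" for z
      by (subst \<phi>eq) (rule wirt_diff(2)[OF Ck1_diff[OF \<phi>1(1)] Ck1_diff[OF \<phi>3(1)]])
    then have "T \<phi> = T \<phi>1 - T \<phi>3"
      unfolding T_def using j by (simp add: left_diff_distrib)
    then have "T \<phi> = (LINT z|lborel. \<phi> z * Q z)" using 5 by simp
    then show ?thesis by (metis T_def minus_minus)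
  qed
  have Pl: "locally_hoelder P" by (rule weak_dbar_regularity(1)[OF Pc Qc weak])
  \<comment> \<open>So far \<open>wirt a\<close> is known to be continuous only. The chain rule
    expresses it through \<open>P\<close> and the derivatives of \<mu> at \<open>G\<close>, which
    are C^1 because \<mu> is C^2; Hoelder continuity of \<open>P\<close> thus passes to
    \<open>q0\<close> and \<open>Q\<close>.\<close>
  have wa: "wirt a z = wirt \<mu> (G z) * P z + wirt_bar \<mu> (G z) * cnj (- a z * cnj (P z))" for z
    unfolding a_def[abs_def] using wirt_compose(1)[OF Ck1_diff[OF \<mu>1] Ck1_diff[OF G], of z] wbG
    by (simp add: P_def a_def)
  have wm: "Ck_on 1 UNIV (\<lambda>z. wirt \<mu> (G z))" "Ck_on 1 UNIV (\<lambda>z. wirt_bar \<mu> (G z))"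
    by (intro Ck_compose_plane[OF _ G] Ck_wirt; use \<mu> in \<open>simp only: numeral_2_eq_2 One_nat_def\<close>)+
  have "locally_hoelder (\<lambda>z. (-1) * ((wirt \<mu> (G z) * P z + wirt_bar \<mu> (G z) * cnj ((-1) * (a z * cnj (P z)))) * cnj (P z)))"
    by (intro locally_hoelder_mult locally_hoelder_add locally_hoelder_cnj locally_hoelder_C1[OF Ck_const] locally_hoelder_C1[OF wm(1)] locally_hoelder_C1[OF wm(2)] locally_hoelder_C1[OF a1] Pl)
  then have q0l: "locally_hoelder q0" by (simp add: q0_def[abs_def] wa)
  have "locally_hoelder (\<lambda>z. inverse (m z) * (q0 z + (-1) * (a z * cnj (q0 z))))"
    by (intro locally_hoelder_mult locally_hoelder_add locally_hoelder_cnj locally_hoelder_C1[OF Ck_const] locally_hoelder_C1[OF m1] locally_hoelder_C1[OF a1] q0l)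
  then have Ql: "locally_hoelder Q" by (simp add: Q_def[abs_def])
  have P1: "Ck_on 1 UNIV P" by (rule weak_dbar_regularity(2)[OF Pc Qc weak Ql])
  have wb1: "Ck_on 1 UNIV (wirt_bar G)"
    unfolding wbG using Ck_mult[OF Ck_minus[OF a1] Ck_cnj[OF P1]] by simp
  have "pdx G = (\<lambda>z. P z + wirt_bar G z)" "pdy G = (\<lambda>z. \<i> * (P z - wirt_bar G z))"
    by (auto simp: pdx_wirt P_def)
  then have "Ck_on 1 UNIV (pdx G)" "Ck_on 1 UNIV (pdy G)"
    by (simp_all only: Ck_add[OF P1 wb1] Ck_mult[OF Ck_const Ck_minus_diff[OF P1 wb1]])
  then show ?thesis using Ck1_diff[OF G] by (simp add: numeral_2_eq_2)
qed

section \<open>Harmonic functions\<close>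

text \<open>The test functions are the approximate identity centred at \<open>w\<close>, cut off by
  \<open>chi R\<close> because it has unbounded support.\<close>

lemma weakly_zero_imp_zero:
  fixes f :: "complex \<Rightarrow> complex"
  assumes f: "continuous_on UNIV f"
    and weak: "\<And>\<phi>. Ck_on 1 UNIV \<phi> \<Longrightarrow> bounded_supp \<phi> \<Longrightarrow> (LINT z|lborel. \<phi> z * f z) = 0"
  shows "f w = 0"
proof -
  define R where "R = cmod w + 1"
  have R: "R > 0" "cmod w \<le> R" by (simp_all add: R_def add_nonneg_pos)
  have jk1: "Ck_on 1 UNIV (reg_delta (eps n))" for n
    unfolding reg_delta_def[abs_def] by (intro Ck_mult Ck_const Ck_nsq_powr eps)
  have "(LINT y|lborel. of_real (reg_delta (eps n) (w - y)) * (chi R y * f y)) = 0" for n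
  proof -
    have 1: "Ck_on 1 UNIV (\<lambda>y. of_real (reg_delta (eps n) (w - y)) * chi R y)"
      by (intro Ck_mult Ck_of_real chi_Ck Ck_compose_plane[OF jk1] Ck_minus_diff Ck_const Ck_ident)
    have 2: "bounded_supp (\<lambda>y. of_real (reg_delta (eps n) (w - y)) * chi R y)"
      by (rule bounded_supp_mono[OF chi_bounded_supp[OF R(1)]]) simp
    show ?thesis using weak[OF 1 2] by (simp add: mult.assoc)
  qed
  moreover have "(\<lambda>n. LINT y|lborel. of_real (reg_delta (eps n) (w - y)) * (chi R y * f y)) \<longlonglongrightarrow> of_real c0 * (chi R w * f w)"
    by (rule reg_delta_conv_tendsto)
      (intro continuous_intros f Ck1_cont chi_Ck, rule bounded_supp_mono[OF chi_bounded_supp[OF R(1)]], simp)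
  ultimately have "of_real c0 * (chi R w * f w) = 0"
    by (simp only: LIMSEQ_const_iff)
  then show ?thesis using c0_pos chi_eq_1[OF R] by simp
qed

text \<open>The difference of the mixed derivatives is continuous and, by the weak symmetry,
  annihilates every test function.\<close>

lemma pd_commute:
  fixes u :: "complex \<Rightarrow> complex"
  assumes u: "Ck_on 2 UNIV u"
  shows "pdx (pdy u) z = pdy (pdx u) z"
proof -
  have u1: "Ck_on 1 UNIV u" by (rule Ck_on_mono[OF u]) auto
  have x1: "Ck_on 1 UNIV (pdx u)" and y1: "Ck_on 1 UNIV (pdy u)"
    using u by (simp_all add: numeral_2_eq_2)
  define f where "f z = pdx (pdy u) z - pdy (pdx u) z" for z
  have c: "continuous_on UNIV (pdx (pdy u))" "continuous_on UNIV (pdy (pdx u))"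
    using x1 y1 by (simp_all add: One_nat_def)
  have "f z = 0"
  proof (rule weakly_zero_imp_zero[of f])
    show "continuous_on UNIV f" unfolding f_def[abs_def] by (intro continuous_intros c)
    fix \<phi> :: "complex \<Rightarrow> complex" assume \<phi>: "Ck_on 1 UNIV \<phi>" "bounded_supp \<phi>"
    have i: "integrable lborel (\<lambda>z. \<phi> z * pdx (pdy u) z)" "integrable lborel (\<lambda>z. \<phi> z * pdy (pdx u) z)"
      by (intro integrable_mult_bounded_supp(2) c Ck1_cont[OF \<phi>(1)] \<phi>(2))+
    have "(LINT z|lborel. \<phi> z * f z) = (LINT z|lborel. \<phi> z * pdx (pdy u) z) - (LINT z|lborel. \<phi> z * pdy (pdx u) z)"
      unfolding f_def using i by (simp add: right_diff_distrib)
    also have "\<dots> = - (LINT z|lborel. pdx \<phi> z * pdy u z) + (LINT z|lborel. pdy \<phi> z * pdx u z)"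
      using integral_pd_parts[OF y1 \<phi>, of 1] integral_pd_parts[OF x1 \<phi>, of \<i>] by (simp add: pdx_eq_pd pdy_eq_pd)
    also have "\<dots> = 0" using integral_pd_commute[OF u1 \<phi>] by simp
    finally show "(LINT z|lborel. \<phi> z * f z) = 0" .
  qed
  then show ?thesis by (simp add: f_def)
qed

lemma laplacian_eq_wirt:
  assumes u: "Ck_on 2 UNIV u"
  shows "laplacian u z = 4 * wirt (wirt_bar u) z" "laplacian u z = 4 * wirt_bar (wirt u) z"
proof -
  have d: "pdx u differentiable (at z)" "pdy u differentiable (at z)" for z
    using u by (simp_all add: numeral_2_eq_2)
  have L: "bounded_linear (\<lambda>z::complex. \<i> * z)" by (rule bounded_linear_mult_right)
  have H: "bounded_linear (\<lambda>z::complex. z / 2)" by (rule bounded_linear_divide)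
  have d2: "(\<lambda>z. \<i> * pdy u z) differentiable (at z)" for z
    by (rule differentiable_bounded_linear[OF L d(2)])
  have p: "pd e (wirt_bar u) z = (pd e (pdx u) z + \<i> * pd e (pdy u) z) / 2" 
    "pd e (wirt u) z = (pd e (pdx u) z - \<i> * pd e (pdy u) z) / 2" for e z
    unfolding wirt_bar_def[abs_def] wirt_def[abs_def]
    by (subst pd_bounded_linear[OF H], (intro differentiable_add differentiable_diff d d2)[1],
        subst pd_add[OF d(1) d2] pd_diff[OF d(1) d2], subst pd_bounded_linear[OF L d(2)], rule refl)+
  have c: "pd 1 (pdy u) z = pd \<i> (pdx u) z" using pd_commute[OF u] by (simp add: pdx_eq_pd pdy_eq_pd)
  show "laplacian u z = 4 * wirt (wirt_bar u) z" "laplacian u z = 4 * wirt_bar (wirt u) z"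
    unfolding laplacian_def wirt_def[of "wirt_bar u"] wirt_bar_def[of "wirt u"]
      pdx_eq_pd[of "wirt_bar u"] pdy_eq_pd[of "wirt_bar u"] pdx_eq_pd[of "wirt u"] pdy_eq_pd[of "wirt u"] p
    using c by (simp_all add: pdx_eq_pd[of "pdx u"] pdy_eq_pd[of "pdy u"] field_simps)
qed

lemma wirt_shift:
  assumes "f differentiable (at (z - a))"
  shows "wirt (\<lambda>z. f (z - a)) z = wirt f (z - a)" "wirt_bar (\<lambda>z. f (z - a)) z = wirt_bar f (z - a)"
proof -
  have d: "(\<lambda>z. z - a) differentiable (at z)" by simp
  have "wirt (\<lambda>z. z - a) z = 1" "wirt_bar (\<lambda>z. z - a) z = 0"
    by (subst wirt_diff; simp add: wirt_def wirt_bar_def pdx_eq_pd pdy_eq_pd)+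
  then show "wirt (\<lambda>z. f (z - a)) z = wirt f (z - a)" "wirt_bar (\<lambda>z. f (z - a)) z = wirt_bar f (z - a)"
    using wirt_compose[where G="\<lambda>z. z - a", OF assms d] by simp_all
qed

lemma Ck_shift: "Ck_on k UNIV f \<Longrightarrow> Ck_on k UNIV (\<lambda>z. f (z - a))"
  by (rule Ck_compose_plane[OF _ Ck_minus_diff[OF Ck_ident Ck_const]])

lemma bounded_supp_shift_minus: "bounded_supp f \<Longrightarrow> bounded_supp (\<lambda>z. f (z - a))"
  using bounded_supp_shift[of f "- a"] by simp

text \<open>For radial \<open>\<chi>\<close>, \<open>wirt_bar \<chi>\<close> is \<open>z\<close> times a radial function, which cancels the pole of the Cauchy kernel. The
  Cauchy-Pompeiu formula thus becomes a mean value property, and integrating it by parts needs no derivative of \<open>r\<close>.\<close>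

lemma harmonic_interior_estimate:
  "\<exists>C\<ge>0. \<forall>r w M. Ck_on 2 UNIV r \<longrightarrow> (\<forall>z. cmod (z - w) < 2 \<longrightarrow> laplacian r z = 0 \<and> cmod (r z) \<le> M)
    \<longrightarrow> cmod (wirt_bar r w) \<le> C * M"
proof -
  define \<kappa> :: "complex \<Rightarrow> complex" where "\<kappa> z = of_real (cutoff' (nsq z))" for z
  have \<kappa>: "Ck_on 1 UNIV \<kappa>" "bounded_supp \<kappa>"
    unfolding \<kappa>_def[abs_def] by (intro Ck_of_real cutoff'_nsq) (rule bounded_supp_mono[OF cutoff'_nsq(2)], simp)
  have \<kappa>0: "\<kappa> z = 0" if "2 \<le> cmod z" for z
    using cutoff'_normsq_eq_0[of 1 z] that by (simp add: \<kappa>_def)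
  \<comment> \<open>The assumptions on \<open>r\<close> concern an open disc, so this derivative
    must vanish on the boundary circle as well; it does so by continuity from outside.\<close>
  have w\<kappa>0: "wirt \<kappa> z = 0" if "2 \<le> cmod z" for z
  proof -
    have "wirt \<kappa> z = 0" if "2 < cmod z" for z
    proof -
      have "pdx \<kappa> z = pdx (\<lambda>_. 0) z" "pdy \<kappa> z = pdy (\<lambda>_. 0) z"
        by (rule pdx_cong_open[of "- cball 0 2"]; use that \<kappa>0 in auto)+
      then show ?thesis by (simp add: wirt_def pdx_eq_pd pdy_eq_pd)
    qed
    moreover have "z \<in> closure (- cball 0 2)"
      using that by (simp add: closure_complement interior_cball)
    ultimately show ?thesis
      using continuous_constant_on_closure[of "- cball 0 2" "wirt \<kappa>" 0 z] continuous_on_subset[OF Ck1_wirt_cont(1)[OF \<kappa>(1)]]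
      by auto
  qed
  define K where "K = (LINT z|lborel. cmod (wirt \<kappa> z))"
  have wc: "continuous_on UNIV (wirt \<kappa>)" by (rule Ck1_wirt_cont[OF \<kappa>(1)])
  have K0: "K \<ge> 0" unfolding K_def by simp
  have main: "cmod (wirt_bar r w) \<le> K / c0 * M"
    if r: "Ck_on 2 UNIV r" and lap: "\<And>z. cmod (z - w) < 2 \<Longrightarrow> laplacian r z = 0"
      and M: "\<And>z. cmod (z - w) < 2 \<Longrightarrow> cmod (r z) \<le> M" for r w M
  proof -
    have cr: "Ck_on 2 UNIV (\<lambda>z. cnj (r z))" by (rule Ck_cnj[OF r])
    have cr1: "Ck_on 1 UNIV (\<lambda>z. cnj (r z))" by (rule Ck_on_mono[OF cr]) auto
    have r1: "Ck_on 1 UNIV r" by (rule Ck_on_mono[OF r]) auto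
    \<comment> \<open>The conjugate of \<open>wirt_bar r\<close>. For harmonic \<open>r\<close> the
      derivative \<open>wirt_bar r\<close> is antiholomorphic, so \<open>d\<close> satisfies the
      homogeneous equation \<open>wirt_bar d = 0\<close> on the disc.\<close>
    define d where "d = wirt (\<lambda>z. cnj (r z))"
    have d1: "Ck_on 1 UNIV d"
      unfolding d_def by (rule Ck_wirt) (use cr in \<open>simp only: numeral_2_eq_2 One_nat_def\<close>)
    have dw: "d z = cnj (wirt_bar r z)" for z
      unfolding d_def by (rule wirt_cnj(1)[OF Ck1_diff[OF r1]])
    have wbd: "wirt_bar d z = 0" if "cmod (z - w) < 2" for z
    proof -
      have wb1: "Ck_on 1 UNIV (wirt_bar r)"
        by (rule Ck_wirt) (use r in \<open>simp only: numeral_2_eq_2 One_nat_def\<close>)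
      have "wirt_bar d z = cnj (wirt (wirt_bar r) z)"
        unfolding dw[abs_def] by (rule wirt_cnj(2)[OF Ck1_diff[OF wb1]])
      then show ?thesis using laplacian_eq_wirt(1)[OF r, of z] lap[OF that] by simp
    qed
    let ?X = "\<lambda>y. chi 1 (y - w)"
    have X: "Ck_on 1 UNIV ?X" "bounded_supp ?X"
      by (intro Ck_shift chi_Ck bounded_supp_shift_minus chi_bounded_supp; simp)+
    have X0: "?X y = 0" if "2 \<le> cmod (y - w)" for y using chi_eq_0[of 1 "y - w"] that by simp
    have "of_real c0 * (?X w * d w) = cauchy_transform (\<lambda>y. ?X y * wirt_bar d y + wirt_bar ?X y * d y) w"
    proof (rule cauchy_pompeiu_weak[OF Ck1_cont[OF d1] Ck1_wirt_cont(2)[OF d1] _ X])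
      fix \<phi> :: "complex \<Rightarrow> complex" assume "Ck_on 1 UNIV \<phi>" "bounded_supp \<phi>"
      from integral_wirt_parts(2)[OF d1 this]
      show "(LINT z|lborel. wirt_bar \<phi> z * d z) = - (LINT z|lborel. \<phi> z * wirt_bar d z)" by simp
    qed
    also have "\<dots> = (LINT y|lborel. - (\<kappa> (y - w) * d y))"
      unfolding cauchy_transform_def
    proof (intro Bochner_Integration.integral_cong refl)
      fix y
      have a: "wirt_bar ?X y = \<kappa> (y - w) * (y - w)"
        using wirt_shift(2)[where f="chi 1" and a=w and z=y, OF Ck1_diff[OF chi_Ck(2)]] wirt_chi(2)[of 1 "y - w"] by (simp add: \<kappa>_def)
      moreover have b: "?X y * wirt_bar d y = 0"
        using X0[of y] wbd[of y] by (cases "cmod (y - w) < 2") auto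
      moreover have c: "inverse (w - y) * (\<kappa> (y - w) * (y - w)) = - \<kappa> (y - w)"
      proof (cases "y = w")
        case False
        then have "inverse (w - y) * (w - y) = 1" by simp
        then show ?thesis by algebra
      qed (simp add: \<kappa>_def cutoff'_simps)
      ultimately show "inverse (w - y) * (?X y * wirt_bar d y + wirt_bar ?X y * d y) = - (\<kappa> (y - w) * d y)"
      proof -
        have "inverse (w - y) * (?X y * wirt_bar d y + wirt_bar ?X y * d y) = (inverse (w - y) * (\<kappa> (y - w) * (y - w))) * d y"
          unfolding a b by (simp only: add_0_left mult.assoc)
        then show ?thesis unfolding c by simp
      qed
    qed
    also have "\<dots> = - (LINT y|lborel. \<kappa> (y - w) * wirt (\<lambda>z. cnj (r z)) y)"
      by (simp add: d_def)
    also have "\<dots> = (LINT y|lborel. wirt (\<lambda>y. \<kappa> (y - w)) y * cnj (r y))"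
      using integral_wirt_parts(1)[OF cr1 Ck_shift[OF \<kappa>(1)] bounded_supp_shift_minus[OF \<kappa>(2)]] by simp
    also have "\<dots> = (LINT y|lborel. wirt \<kappa> (y - w) * cnj (r y))"
      using wirt_shift(1)[OF Ck1_diff[OF \<kappa>(1)]] by simp
    finally have e: "of_real c0 * d w = (LINT y|lborel. wirt \<kappa> (y - w) * cnj (r y))"
      using chi_eq_1[of 1 0] by simp
    have m: "(\<lambda>z. cmod (wirt \<kappa> z)) \<in> borel_measurable borel" using borel_cont[OF wc] by measurable
    have ish: "integrable lborel (\<lambda>y. cmod (wirt \<kappa> (y - w)))"
    proof -
      have "integrable lborel (\<lambda>y. wirt \<kappa> (y - w))"
        by (intro integrable_bounded_supp bounded_supp_shift_minus bounded_supp_wirt \<kappa> continuous_on_compose2[OF wc] continuous_intros) auto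
      then show ?thesis by (rule integrable_norm)
    qed
    have "cmod (of_real c0 * d w) \<le> (LINT y|lborel. cmod (wirt \<kappa> (y - w)) * M)"
      unfolding e
    proof (rule norm_integral_le)
      show "integrable lborel (\<lambda>y. cmod (wirt \<kappa> (y - w)) * M)" by (intro integrable_mult_left ish)
      fix y
      show "norm (wirt \<kappa> (y - w) * cnj (r y)) \<le> cmod (wirt \<kappa> (y - w)) * M"
        using M[of y] w\<kappa>0[of "y - w"] by (cases "cmod (y - w) < 2") (auto simp: norm_mult intro!: mult_left_mono)
    qed
    also have "\<dots> = K * M"
      using lebesgue_integral_shift[OF m, of "- w"] by (simp add: K_def)
    finally have "c0 * cmod (wirt_bar r w) \<le> K * M"
      using c0_pos by (simp add: dw norm_mult)
    then show ?thesis using c0_pos by (simp add: field_simps)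
  qed
  show ?thesis
    by (rule exI[of _ "K / c0"]) (use main K0 c0_pos in \<open>auto simp del: Ck_on.simps\<close>)
qed

section \<open>Scattering amplitudes at infinity\<close>

lemma bigo_at_infinityE:
  assumes "f \<in> O[at_infinity](\<lambda>z::complex. 1 / z)"
  obtains C R where "C > 0" "R > 0" "\<And>z. R \<le> cmod z \<Longrightarrow> cmod (f z) \<le> C / cmod z"
proof -
  obtain c where c: "c > 0" "\<forall>\<^sub>F z in at_infinity. norm (f z) \<le> c * norm (1 / z)"
    using assms by (auto elim: landau_o.bigE)
  then obtain b where b: "\<And>z. b \<le> norm z \<Longrightarrow> norm (f z) \<le> c * norm (1 / z)"
    unfolding eventually_at_infinity by blast
  show ?thesis
    by (rule that[of c "max b 1"]) (use c b in \<open>auto simp: norm_divide less_max_iff_disj\<close>)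
qed

lemma bigo_at_infinityI:
  assumes "\<And>z::complex. R \<le> cmod z \<Longrightarrow> cmod (f z) \<le> C / cmod z"
  shows "f \<in> O[at_infinity](\<lambda>z. 1 / z)"
  by (rule bigoI[of _ C], unfold eventually_at_infinity, rule exI[of _ R]) (use assms in \<open>auto simp: norm_divide\<close>)

lemma cmod_exp_minus_1_le: "cmod (exp h - 1) \<le> exp (cmod h) * cmod h"
proof -
  have "cmod (exp h - exp 0) \<le> exp (cmod h) * cmod (h - 0)"
  proof (rule field_differentiable_bound[of "cball 0 (cmod h)" exp exp])
    fix z :: complex assume "z \<in> cball 0 (cmod h)"
    then show "cmod (exp z) \<le> exp (cmod h)" using norm_exp[of z] by (auto intro: order_trans)
    show "(exp has_field_derivative exp z) (at z within cball 0 (cmod h))"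
      by (rule has_field_derivative_at_within[OF DERIV_exp])
  qed auto
  then show ?thesis by simp
qed

text \<open>A primitive of the amplitude integrand: the exponential is antiholomorphic, so
  \<open>wirt\<close> of this density is the exponential times a quarter of the Laplacian. Where
  \<open>u\<close> is harmonic, the conjugate of the density is holomorphic.\<close>

definition amp_density :: "complex \<Rightarrow> (complex \<Rightarrow> complex) \<Rightarrow> complex \<Rightarrow> complex" where
  "amp_density l u z = exp (- cnj l * cnj z) * wirt_bar u z"

lemma wirt_exp_cnj:
  "wirt (\<lambda>z. exp (- cnj l * cnj z)) z = 0" "Ck_on k UNIV (\<lambda>z. exp (- cnj l * cnj z))"
proof -
  have e: "(\<lambda>z. exp (- cnj l * cnj z)) = (\<lambda>z. cnj (exp (- l * z)))"
    by (simp add: exp_cnj)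
  have d: "((\<lambda>z. exp (- l * z)) has_field_derivative exp (- l * z) * (- l)) (at z)" for z
    by (auto intro!: derivative_eq_intros)
  have c: "Ck_on k UNIV (\<lambda>z. exp (- l * z))" for k by (intro Ck_exp Ck_mult Ck_const Ck_ident)
  show "wirt (\<lambda>z. exp (- cnj l * cnj z)) z = 0"
    unfolding e using wirt_cnj(1)[OF Ck1_diff[OF c]] wirt_holomorphic(2)[OF d] by simp
  show "Ck_on k UNIV (\<lambda>z. exp (- cnj l * cnj z))"
    unfolding e by (rule Ck_cnj[OF c])
qed

lemma Ck2_wirt:
  assumes "Ck_on 2 UNIV u" shows "Ck_on 1 UNIV (wirt u)" "Ck_on 1 UNIV (wirt_bar u)"
  by (rule Ck_wirt, use assms in \<open>simp only: numeral_2_eq_2 One_nat_def\<close>)+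

lemma amp_density_Ck1: "Ck_on 2 UNIV u \<Longrightarrow> Ck_on 1 UNIV (amp_density l u)"
  unfolding amp_density_def[abs_def] by (intro Ck_mult wirt_exp_cnj Ck2_wirt)

lemma wirt_amp_density:
  assumes u: "Ck_on 2 UNIV u"
  shows "wirt (amp_density l u) z = exp (- cnj l * cnj z) * laplacian u z / 4"
  unfolding amp_density_def[abs_def]
  by (subst wirt_mult(1)[OF Ck1_diff[OF wirt_exp_cnj(2)] Ck1_diff[OF Ck2_wirt(2)[OF u]]])
    (simp only: wirt_exp_cnj(1) laplacian_eq_wirt(1)[OF u], simp)

text \<open>As \<open>chi R\<close> is 1 on \<open>D\<close> and the Laplacian vanishes off
  \<open>D\<close>, the cutoff can be inserted and integration by parts leaves an integral over an
  annulus. The left-hand side does not depend on \<open>R\<close>, which is later sent to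
  infinity.\<close>

lemma laplacian_integral_eq:
  assumes u: "Ck_on 2 UNIV u" and lap: "\<And>z. z \<notin> D \<Longrightarrow> laplacian u z = 0"
    and D: "D \<subseteq> cball 0 R" and R: "R > 0"
  shows "(LINT z:D|lborel. exp (- cnj l * cnj z) * laplacian u z)
    = - 4 * (LINT z|lborel. wirt (chi R) z * amp_density l u z)"
proof -
  have "(LINT z:D|lborel. exp (- cnj l * cnj z) * laplacian u z)
    = (LINT z|lborel. 4 * (chi R z * wirt (amp_density l u) z))"
    unfolding set_lebesgue_integral_def
  proof (intro Bochner_Integration.integral_cong refl)
    fix z
    show "indicator D z *\<^sub>R (exp (- cnj l * cnj z) * laplacian u z) = 4 * (chi R z * wirt (amp_density l u) z)"
    proof (cases "z \<in> D")
      case True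
      then have "chi R z = 1" using D chi_eq_1[OF R] by auto
      then show ?thesis using True by (simp add: wirt_amp_density[OF u])
    next
      case False
      then show ?thesis unfolding wirt_amp_density[OF u] lap[OF False] by simp
    qed
  qed
  also have "\<dots> = 4 * (LINT z|lborel. chi R z * wirt (amp_density l u) z)" by (rule integral_mult_right_zero)
  also have "\<dots> = - 4 * (LINT z|lborel. wirt (chi R) z * amp_density l u z)"
    unfolding integral_wirt_parts(1)[OF amp_density_Ck1[OF u] chi_Ck(2) chi_bounded_supp[OF R]] by simp
  finally show ?thesis .
qed

lemma cnj_amp_density_derivative:
  assumes u: "Ck_on 2 UNIV u" and "laplacian u z = 0"
  shows "\<exists>d. ((\<lambda>z. cnj (amp_density l u z)) has_field_derivative d) (at z)"
proof -
  have "wirt_bar (\<lambda>z. cnj (amp_density l u z)) z = 0"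
    unfolding wirt_cnj(2)[OF Ck1_diff[OF amp_density_Ck1[OF u]]] wirt_amp_density[OF u] assms(2) by simp
  then show ?thesis
    using has_field_derivative_wirt[OF Ck1_diff[OF Ck_cnj[OF amp_density_Ck1[OF u]]]] by blast
qed

text \<open>\<open>wirt_bar\<close> annihilates the holomorphic exponential, so only the remainder
  \<open>r\<close> counts. Near \<open>w\<close> it is of order |exp (l * w)| / |w|, the interior
  estimate carries this over to its derivative, and the exponential in the density cancels |exp (l *
  w)|.\<close>

lemma amp_density_decay:
  assumes u: "Ck_on 2 UNIV u" and lap: "\<And>z. \<rho> \<le> cmod z \<Longrightarrow> laplacian u z = 0"
    and asy: "exp_asymptotics l u"
  obtains C R where "C > 0" "R > 0" "\<And>z. R \<le> cmod z \<Longrightarrow> cmod (amp_density l u z) \<le> C / cmod z"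
proof -
  obtain C0 R0 where C0: "C0 > 0" "R0 > 0" "\<And>z. R0 \<le> cmod z \<Longrightarrow> cmod (u z / exp (l * z) - 1) \<le> C0 / cmod z"
    using bigo_at_infinityE[OF asy[unfolded exp_asymptotics_def]] by blast
  obtain C1 where C1: "C1 \<ge> 0" "\<And>r w M. Ck_on 2 UNIV r \<Longrightarrow> (\<And>z. cmod (z - w) < 2 \<Longrightarrow> laplacian r z = 0 \<and> cmod (r z) \<le> M)
    \<Longrightarrow> cmod (wirt_bar r w) \<le> C1 * M"
    using harmonic_interior_estimate by metis
  define r where "r z = u z - exp (l * z)" for z
  have ed: "((\<lambda>z. exp (l * z)) has_field_derivative l * exp (l * z)) (at z)" for z
    by (auto intro!: derivative_eq_intros)
  have ec: "Ck_on k UNIV (\<lambda>z. exp (l * z))" for k by (intro Ck_exp Ck_mult Ck_const Ck_ident)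
  have r2: "Ck_on 2 UNIV r" unfolding r_def[abs_def] by (intro Ck_minus_diff u ec)
  have u1: "Ck_on 1 UNIV u" by (rule Ck_on_mono[OF u]) auto
  have wr: "wirt_bar r = wirt_bar u"
    unfolding r_def[abs_def] using wirt_diff(2)[OF Ck1_diff[OF u1] Ck1_diff[OF ec]] wirt_holomorphic(2)[OF ed]
    by (auto simp: fun_eq_iff)
  have lr: "laplacian r z = laplacian u z" for z
    by (simp add: laplacian_eq_wirt(1)[OF u] laplacian_eq_wirt(1)[OF r2] wr)
  \<comment> \<open>The 4 makes |w| - 2 at least |w| / 2, so a disc of radius 2 about
    \<open>w\<close> stays beyond |\<rho>| and \<open>R0\<close>. In \<open>C\<close> the factor exp
    (2 |l|) is the variation of the exponential over that disc, and 2 * C0 comes from |z| >= |w| /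
    2.\<close>
  define R where "R = \<bar>\<rho>\<bar> + R0 + 4"
  define C where "C = C1 * exp (2 * cmod l) * (2 * C0) + 1"
  have "cmod (amp_density l u w) \<le> C / cmod w" if w: "R \<le> cmod w" for w
  proof -
    have w4: "cmod w \<ge> 4" using w C0 by (simp add: R_def)
    define M where "M = cmod (exp (l * w)) * exp (2 * cmod l) * (2 * C0 / cmod w)"
    have "laplacian r z = 0 \<and> cmod (r z) \<le> M" if z: "cmod (z - w) < 2" for z
    proof
      have zz: "cmod z \<ge> cmod w - 2" using z norm_triangle_ineq2[of w z] by (simp add: norm_minus_commute)
      show "laplacian r z = 0" unfolding lr by (rule lap) (use zz w C0 in \<open>simp add: R_def\<close>)
      have zR: "R0 \<le> cmod z" using zz w C0 by (simp add: R_def)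
      have "r z = exp (l * z) * (u z / exp (l * z) - 1)" by (simp add: r_def field_simps)
      then have "cmod (r z) = cmod (exp (l * z)) * cmod (u z / exp (l * z) - 1)" by (simp only: norm_mult)
      also have "\<dots> \<le> (cmod (exp (l * w)) * exp (2 * cmod l)) * (2 * C0 / cmod w)"
      proof (rule mult_mono)
        have "exp (l * z) = exp (l * w) * exp (l * (z - w))"
          by (simp add: exp_add[symmetric] algebra_simps)
        then have "cmod (exp (l * z)) = cmod (exp (l * w)) * cmod (exp (l * (z - w)))" by (simp only: norm_mult)
        moreover have "cmod (exp (l * (z - w))) \<le> exp (2 * cmod l)"
        proof -
          have "cmod (l * (z - w)) \<le> cmod l * 2" unfolding norm_mult using z by (intro mult_left_mono) auto
          then show ?thesis by (intro order_trans[OF norm_exp]) simp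
        qed
        ultimately show "cmod (exp (l * z)) \<le> cmod (exp (l * w)) * exp (2 * cmod l)"
          by (simp only: mult_left_mono norm_ge_zero)
        have "cmod (u z / exp (l * z) - 1) \<le> C0 / cmod z" by (rule C0(3)[OF zR])
        also have "\<dots> \<le> C0 / (cmod w / 2)"
          using zz w4 C0 by (intro divide_left_mono mult_pos_pos) auto
        finally show "cmod (u z / exp (l * z) - 1) \<le> 2 * C0 / cmod w" by (simp add: mult.commute)
      qed auto
      finally show "cmod (r z) \<le> M" by (simp add: M_def)
    qed
    then have "cmod (wirt_bar u w) \<le> C1 * M" using C1(2)[OF r2] wr by simp
    then have "cmod (amp_density l u w) \<le> cmod (exp (- cnj l * cnj w)) * (C1 * M)"
      unfolding amp_density_def norm_mult by (intro mult_left_mono) auto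
    also have "cmod (exp (- cnj l * cnj w)) = inverse (cmod (exp (l * w)))"
      by (simp add: exp_minus[symmetric])
    also have "inverse (cmod (exp (l * w))) * (C1 * M) = (C1 * exp (2 * cmod l) * (2 * C0)) / cmod w"
      by (simp add: M_def)
    also have "\<dots> \<le> C / cmod w" using w4 by (intro divide_right_mono) (auto simp: C_def)
    finally show ?thesis .
  qed
  moreover have "R > 0" "C > 0" using C0 C1 by (auto simp: R_def C_def add_nonneg_pos)
  ultimately show ?thesis using that by blast
qed

lemma cauchy_deriv_bound:
  assumes "f holomorphic_on ball z 2" "\<And>x. cmod (x - z) \<le> 1 \<Longrightarrow> cmod (f x) \<le> B"
  shows "cmod (deriv f z) \<le> B"
proof -
  have "norm ((deriv ^^ 1) f z) \<le> fact 1 * B / 1 ^ 1"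
  proof (rule Cauchy_inequality)
    show "f holomorphic_on ball z 1" using assms(1) by (rule holomorphic_on_subset) auto
    show "continuous_on (cball z 1) f"
      using holomorphic_on_imp_continuous_on[OF assms(1)] by (rule continuous_on_subset) auto
    show "cmod (f x) \<le> B" if "cmod (z - x) = 1" for x using assms(2)[of x] that by (simp add: norm_minus_commute)
  qed simp
  then show ?thesis by simp
qed

text \<open>Four quantities are O(1/|z|): \<open>F z - z\<close>, its derivative
  \<open>deriv F z - 1\<close>, \<open>g\<close>, and \<open>deriv g\<close>; the two on derivatives
  follow from Cauchy's inequality. Each term of \<open>gh - g\<close> contains two such
  factors.\<close>

lemma substitution_estimate:
  fixes g F gh :: "complex \<Rightarrow> complex"
  assumes g: "g holomorphic_on - cball 0 \<rho>" and F: "F holomorphic_on - cball 0 \<rho>" and \<rho>: "\<rho> > 0"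
    and C: "C > 0" "\<And>z. \<rho> < cmod z \<Longrightarrow> cmod (g z) \<le> C / cmod z" "\<And>z. \<rho> < cmod z \<Longrightarrow> cmod (F z - z) \<le> C / cmod z"
    and gh: "\<And>z. \<rho> < cmod z \<Longrightarrow> gh z = exp (l * (F z - z)) * g (F z) * deriv F z"
  obtains K R where "R > 0" "K \<ge> 0" "\<And>z. R \<le> cmod z \<Longrightarrow> cmod (gh z - g z) \<le> K / (cmod z)\<^sup>2"
proof -
  \<comment> \<open>Beyond \<open>R\<close>, points within distance 3 of \<open>z\<close> stay
    outside the disc of radius \<rho>, and both the displacement \<open>F z - z\<close> and the
    exponent \<open>l * (F z - z)\<close> have modulus at most 1.\<close>
  define R where "R = \<rho> + C + cmod l * C + 4"
  define E where "E = exp 1 * (cmod l * C)"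
  define K where "K = (E * (1 + 2 * C) + 2 * C) * (2 * C) + 2 * C * C"
  have E0: "E \<ge> 0" using C by (simp add: E_def)
  have "cmod (gh z - g z) \<le> K / (cmod z)\<^sup>2" if z: "R \<le> cmod z" for z
  proof -
    define n where "n = cmod z"
    have lC: "cmod l * C \<ge> 0" using C by simp
    have n: "n \<ge> 4" "n \<ge> \<rho> + 4" "n \<ge> C" "n \<ge> cmod l * C" "n > 0"
      using z lC C(1) \<rho> unfolding R_def n_def by linarith+
    have far: "\<rho> < cmod x \<and> n / 2 \<le> cmod x" if "cmod (x - z) \<le> 2" for x
      using that n norm_triangle_ineq2[of z x] by (simp add: n_def norm_minus_commute)
    have bd: "C / cmod x \<le> 2 * C / n" if "cmod (x - z) \<le> 2" for x
    proof -
      have "C / cmod x \<le> C / (n / 2)" using far[OF that] n C by (intro divide_left_mono mult_pos_pos) auto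
      then show ?thesis by (simp add: mult.commute)
    qed
    have hol: "f holomorphic_on ball x 2" if "f holomorphic_on - cball 0 \<rho>" "cmod (x - z) \<le> 1" for f x
    proof (rule holomorphic_on_subset[OF that(1)], rule subsetI)
      fix y assume "y \<in> ball x 2"
      then have "cmod (y - z) < 3" using that(2) norm_triangle_ineq[of "y - x" "x - z"] by (simp add: dist_norm norm_minus_commute)
      then show "y \<in> - cball 0 \<rho>" using n norm_triangle_ineq2[of z y] by (simp add: n_def norm_minus_commute)
    qed
    have z0: "\<rho> < cmod z" using n \<rho> by (simp add: n_def)
    have Fz: "cmod (F z - z) \<le> C / n" using C(3)[OF z0] by (simp add: n_def)
    have Fz1: "cmod (F z - z) \<le> 1" using n C(1) by (intro order_trans[OF Fz]) simp
    have dF: "cmod (deriv F z - 1) \<le> 2 * C / n"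
    proof -
      have "cmod (deriv (\<lambda>z. F z - z) z) \<le> 2 * C / n"
      proof (rule cauchy_deriv_bound)
        show "(\<lambda>z. F z - z) holomorphic_on ball z 2" using hol[OF F, of z] by (intro holomorphic_intros) simp
        fix x assume x: "cmod (x - z) \<le> 1"
        then have x2: "cmod (x - z) \<le> 2" by simp
        show "cmod (F x - x) \<le> 2 * C / n" using C(3)[of x] far[OF x2] bd[OF x2] by simp
      qed
      moreover have "deriv (\<lambda>z. F z - z) z = deriv F z - 1"
      proof -
        have "F field_differentiable at z" using holomorphic_on_imp_differentiable_at[OF F, of z] z0 by auto
        then show ?thesis by (simp add: deriv_diff)
      qed
      ultimately show ?thesis by simp
    qed
    have e: "cmod (exp (l * (F z - z)) - 1) \<le> E / n"
    proof -
      have a: "cmod (l * (F z - z)) \<le> cmod l * C / n"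
        unfolding norm_mult using mult_left_mono[OF Fz, of "cmod l"] by simp
      also have "\<dots> \<le> 1" using n by simp
      finally have "exp (cmod (l * (F z - z))) \<le> exp 1" by simp
      then have "exp (cmod (l * (F z - z))) * cmod (l * (F z - z)) \<le> exp 1 * (cmod l * C / n)"
        using a by (intro mult_mono) auto
      then show ?thesis using cmod_exp_minus_1_le[of "l * (F z - z)"] by (simp add: E_def)
    qed
    have gF: "cmod (g (F z)) \<le> 2 * C / n"
      using C(2)[of "F z"] far[of "F z"] bd[of "F z"] Fz1 by simp
    have gg: "cmod (g (F z) - g z) \<le> (2 * C / n) * cmod (F z - z)"
    proof (rule field_differentiable_bound[of "cball z 1" g "deriv g"])
      fix x assume "x \<in> cball z 1"
      then have x: "cmod (x - z) \<le> 1" by (simp add: dist_norm norm_minus_commute)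
      then have x2: "cmod (x - z) \<le> 2" by simp
      have "g field_differentiable at x" using holomorphic_on_imp_differentiable_at[OF g, of x] far[OF x2] by auto
      then show "(g has_field_derivative deriv g x) (at x within cball z 1)"
        by (rule has_field_derivative_at_within[OF DERIV_deriv_iff_field_differentiable[THEN iffD2]])
      show "cmod (deriv g x) \<le> 2 * C / n"
      proof (rule cauchy_deriv_bound[OF hol[OF g x]])
        fix y assume "cmod (y - x) \<le> 1"
        then have "cmod (y - z) \<le> 2" using x norm_triangle_ineq[of "y - x" "x - z"] by simp
        then show "cmod (g y) \<le> 2 * C / n" using C(2)[of y] far[of y] bd[of y] by simp
      qed
    qed (use Fz1 in \<open>auto simp: dist_norm norm_minus_commute\<close>)
    have dF2: "cmod (deriv F z) \<le> 1 + 2 * C"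
    proof -
      have "2 * C / n \<le> 2 * C" using n C(1) by (simp add: divide_le_eq mult_le_cancel_left1)
      then show ?thesis using dF norm_triangle_ineq[of "deriv F z - 1" 1] by simp
    qed
    define x where "x = exp (l * (F z - z))"
    have xeq: "x * deriv F z - 1 = (x - 1) * deriv F z + (deriv F z - 1)" by (simp add: algebra_simps)
    have "cmod (x * deriv F z - 1) \<le> cmod (x - 1) * cmod (deriv F z) + cmod (deriv F z - 1)"
      unfolding xeq by (rule order_trans[OF norm_triangle_ineq]) (simp add: norm_mult)
    also have "\<dots> \<le> (E / n) * (1 + 2 * C) + 2 * C / n"
      using e dF2 dF n E0 C by (intro add_mono mult_mono) (auto simp: x_def)
    finally have xd: "cmod (x * deriv F z - 1) \<le> (E * (1 + 2 * C) + 2 * C) / n" by (simp add: add_divide_distrib)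
    \<comment> \<open>The first term collects the change of the prefactor, the second the
      displacement of the argument of \<open>g\<close>.\<close>
    have "gh z - g z = (x * deriv F z - 1) * g (F z) + (g (F z) - g z)"
      unfolding gh[OF z0] x_def by (simp add: algebra_simps)
    then have "cmod (gh z - g z) \<le> cmod (x * deriv F z - 1) * cmod (g (F z)) + cmod (g (F z) - g z)"
      using norm_triangle_ineq[of "(x * deriv F z - 1) * g (F z)" "g (F z) - g z"] by (simp only: norm_mult)
    also have "\<dots> \<le> ((E * (1 + 2 * C) + 2 * C) / n) * (2 * C / n) + (2 * C / n) * (C / n)"
    proof (intro add_mono mult_mono xd gF)
      show "cmod (g (F z) - g z) \<le> (2 * C / n) * (C / n)"
        using gg mult_left_mono[OF Fz, of "2 * C / n"] n C by simp
    qed (use E0 C n in auto)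
    also have "\<dots> = K / n\<^sup>2" using n(5) by (simp add: K_def power2_eq_square field_simps)
    finally show ?thesis by (simp add: n_def)
  qed
  moreover have "R > 0" "K \<ge> 0" using C \<rho> E0 by (auto simp: R_def K_def add_nonneg_pos add_pos_nonneg)
  ultimately show ?thesis using that by blast
qed

text \<open>Gradient 18 / R, decay K / R^2 and area 4 * R^2 * V bound the integral by 72 * K * V /
  R, while its value \<open>X\<close> is the same for all large \<open>R\<close>.\<close>

lemma wirt_chi_integral_zero:
  fixes D :: "complex \<Rightarrow> complex"
  assumes R0: "R0 > 0" and K: "K \<ge> 0" "\<And>z. R0 \<le> cmod z \<Longrightarrow> cmod (D z) \<le> K / (cmod z)\<^sup>2"
    and X: "\<And>R. R0 \<le> R \<Longrightarrow> (LINT z|lborel. wirt (chi R) z * D z) = X"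
  shows "X = 0"
proof -
  define V where "V = measure lborel (ball (0::complex) 1)"
  have bound: "cmod X \<le> 72 * K * V / R" if R: "R0 \<le> R" for R
  proof -
    have Rp: "R > 0" using R R0 by simp
    have i: "integrable lborel (\<lambda>z::complex. (18 * K / R ^ 3) * indicator (ball 0 (2 * R)) z)"
      using emeasure_lborel_ball_finite[of "0::complex" "2 * R"]
      by (intro integrable_mult_right integrable_real_indicator) (simp_all add: less_top)
    have "cmod X \<le> (LINT z|(lborel :: complex measure). (18 * K / R ^ 3) * indicator (ball 0 (2 * R)) z)"
      unfolding X[OF R, symmetric]
    proof (rule norm_integral_le[OF i])
      fix z :: complex
      show "norm (wirt (chi R) z * D z) \<le> (18 * K / R ^ 3) * indicator (ball 0 (2 * R)) z"
      proof (cases "cmod z \<le> R \<or> 2 * R \<le> cmod z")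
        case True
        then show ?thesis using wirt_chi_bounds(2)[OF Rp True] K Rp by simp
      next
        case False
        have "cmod (D z) \<le> K / (cmod z)\<^sup>2" by (rule K(2)) (use False R in simp)
        also have "\<dots> \<le> K / R\<^sup>2" using False Rp K by (intro divide_left_mono power_mono mult_pos_pos) auto
        finally have "cmod (D z) \<le> K / R\<^sup>2" .
        then have "norm (wirt (chi R) z * D z) \<le> (18 / R) * (K / R\<^sup>2)"
          unfolding norm_mult using Rp by (intro mult_mono wirt_chi_bounds) auto
        also have "\<dots> = 18 * K / R ^ 3" by (simp add: power2_eq_square power3_eq_cube)
        finally show ?thesis using False by simp
      qed
    qed
    also have "\<dots> = (18 * K / R ^ 3) * measure lborel (ball (0::complex) (2 * R))" by simp
    also have "measure lborel (ball (0::complex) (2 * R)) = (2 * R)\<^sup>2 * V"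
      unfolding V_def using content_ball_conv_unit_ball[of "2 * R" "0::complex"] Rp by simp
    also have "(18 * K / R ^ 3) * ((2 * R)\<^sup>2 * V) = 72 * K * V / R"
      using Rp by (simp add: power2_eq_square power3_eq_cube)
    finally show ?thesis .
  qed
  have "((\<lambda>R. 72 * K * V / R) \<longlongrightarrow> 0) at_top"
    by (intro tendsto_divide_0[OF tendsto_const] filterlim_at_top_imp_at_infinity filterlim_ident)
  then have "cmod X \<le> 0"
    by (rule tendsto_lowerbound) (auto intro!: eventually_mono[OF eventually_ge_at_top[of R0]] bound)
  then show ?thesis by simp
qed

section \<open>Change of variables\<close>

text \<open>Piola's identity: the rows of the cofactor matrix of the derivative of \<open>G\<close>
  are divergence free by symmetry of the second derivatives, so every term in which
  \<open>V1\<close> and \<open>V2\<close> are not differentiated cancels.\<close>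

lemma piola_divergence:
  fixes G V1 V2 :: "complex \<Rightarrow> complex"
  assumes G: "Ck_on 2 UNIV G" and V: "Ck_on 1 UNIV V1" "Ck_on 1 UNIV V2"
  shows "pdx (\<lambda>w. V1 (G w) * of_real (Im (pdy G w)) - V2 (G w) * of_real (Re (pdy G w))) w
     + pdy (\<lambda>w. V2 (G w) * of_real (Re (pdx G w)) - V1 (G w) * of_real (Im (pdx G w))) w
    = of_real (Re (pdx G w) * Im (pdy G w) - Im (pdx G w) * Re (pdy G w)) * (pdx V1 (G w) + pdy V2 (G w))"
proof -
  have G1: "Ck_on 1 UNIV G" by (rule Ck_on_mono[OF G]) auto
  have gx: "Ck_on 1 UNIV (pdx G)" "Ck_on 1 UNIV (pdy G)" using G by (simp_all add: numeral_2_eq_2)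
  have VG: "(\<lambda>w. V1 (G w)) differentiable (at w)" "(\<lambda>w. V2 (G w)) differentiable (at w)"
    by (rule Ck1_diff[OF Ck_compose_plane[OF V(1) G1]], rule Ck1_diff[OF Ck_compose_plane[OF V(2) G1]])
  have D: "(\<lambda>w. complex_of_real (Re (pdx G w))) differentiable (at w)" "(\<lambda>w. complex_of_real (Im (pdx G w))) differentiable (at w)"
     "(\<lambda>w. complex_of_real (Re (pdy G w))) differentiable (at w)" "(\<lambda>w. complex_of_real (Im (pdy G w))) differentiable (at w)"
    by (intro Ck1_diff Ck_of_real Ck_Re Ck_Im gx)+
  have pD: "pd e (\<lambda>w. complex_of_real (Re (g w))) w = of_real (Re (pd e g w))" 
     "pd e (\<lambda>w. complex_of_real (Im (g w))) w = of_real (Im (pd e g w))" if "Ck_on 1 UNIV g" for g e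
  proof -
    have L: "bounded_linear (\<lambda>z. complex_of_real (Re z))" "bounded_linear (\<lambda>z. complex_of_real (Im z))"
      by (rule bounded_linear_compose[OF bounded_linear_of_real bounded_linear_Re],
          rule bounded_linear_compose[OF bounded_linear_of_real bounded_linear_Im])
    show "pd e (\<lambda>w. complex_of_real (Re (g w))) w = of_real (Re (pd e g w))"
     "pd e (\<lambda>w. complex_of_real (Im (g w))) w = of_real (Im (pd e g w))"
      by (rule pd_bounded_linear[OF L(1) Ck1_diff[OF that]], rule pd_bounded_linear[OF L(2) Ck1_diff[OF that]])
  qed
  have VGp: "pd e (\<lambda>w. V1 (G w)) w = Re (pd e G w) *\<^sub>R pdx V1 (G w) + Im (pd e G w) *\<^sub>R pdy V1 (G w)"
    "pd e (\<lambda>w. V2 (G w)) w = Re (pd e G w) *\<^sub>R pdx V2 (G w) + Im (pd e G w) *\<^sub>R pdy V2 (G w)" for e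
    by (rule pd_compose_plane[OF Ck1_diff[OF V(1)] Ck1_diff[OF G1]], rule pd_compose_plane[OF Ck1_diff[OF V(2)] Ck1_diff[OF G1]])
  have c: "pd 1 (pdy G) w = pd \<i> (pdx G) w" using pd_commute[OF G] by (simp add: pdx_eq_pd pdy_eq_pd)
  have E1: "pd 1 (\<lambda>w. V1 (G w) * of_real (Im (pdy G w)) - V2 (G w) * of_real (Re (pdy G w))) w
     = V1 (G w) * of_real (Im (pd 1 (pdy G) w)) + pd 1 (\<lambda>w. V1 (G w)) w * of_real (Im (pdy G w))
      - (V2 (G w) * of_real (Re (pd 1 (pdy G) w)) + pd 1 (\<lambda>w. V2 (G w)) w * of_real (Re (pdy G w)))"
    by (subst pd_diff[OF differentiable_bilinear[OF bounded_bilinear_mult VG(1) D(4)] differentiable_bilinear[OF bounded_bilinear_mult VG(2) D(3)]],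
        subst pd_mult[OF VG(1) D(4)], subst pd_mult[OF VG(2) D(3)]) (simp only: pD[OF gx(2)])
  have E2: "pd \<i> (\<lambda>w. V2 (G w) * of_real (Re (pdx G w)) - V1 (G w) * of_real (Im (pdx G w))) w
     = V2 (G w) * of_real (Re (pd \<i> (pdx G) w)) + pd \<i> (\<lambda>w. V2 (G w)) w * of_real (Re (pdx G w))
      - (V1 (G w) * of_real (Im (pd \<i> (pdx G) w)) + pd \<i> (\<lambda>w. V1 (G w)) w * of_real (Im (pdx G w)))"
    by (subst pd_diff[OF differentiable_bilinear[OF bounded_bilinear_mult VG(2) D(1)] differentiable_bilinear[OF bounded_bilinear_mult VG(1) D(2)]],
        subst pd_mult[OF VG(2) D(1)], subst pd_mult[OF VG(1) D(2)]) (simp only: pD[OF gx(1)])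
  show ?thesis
    unfolding pdx_eq_pd[of "\<lambda>w. V1 (G w) * of_real (Im (pdy G w)) - V2 (G w) * of_real (Re (pdy G w))"]
      pdy_eq_pd[of "\<lambda>w. V2 (G w) * of_real (Re (pdx G w)) - V1 (G w) * of_real (Im (pdx G w))"] E1 E2 c VGp
      pdx_eq_pd[of G, symmetric] pdy_eq_pd[of G, symmetric]
    by (simp add: scaleR_conv_of_real algebra_simps)
qed

text \<open>The Liouville substitution: div (s^2 grad u) = s (s \<Delta>u + 2 grad s . grad u), and
  the bracket is exactly \<Delta>(s u) - u \<Delta>s.\<close>

lemma liouville_transform:
  fixes s :: "complex \<Rightarrow> real" and u :: "complex \<Rightarrow> complex"
  assumes s: "Ck_on 2 UNIV s" "s w > 0" and u: "Ck_on 2 UNIV u"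
    and div: "pdx (\<lambda>w. of_real ((s w)\<^sup>2) * pdx u w) w + pdy (\<lambda>w. of_real ((s w)\<^sup>2) * pdy u w) w = 0"
  shows "laplacian (\<lambda>w. of_real (s w) * u w) w = of_real (laplacian s w) * u w"
proof -
  define S where "S w = complex_of_real (s w)" for w
  have S2: "Ck_on 2 UNIV S" unfolding S_def[abs_def] by (rule Ck_of_real[OF s(1)])
  have S1: "Ck_on 1 UNIV S" and u1: "Ck_on 1 UNIV u" and s1: "Ck_on 1 UNIV s"
    by (rule Ck_on_mono[OF S2] Ck_on_mono[OF u] Ck_on_mono[OF s(1)]; auto)+
  have P: "Ck_on 1 UNIV (pd e S)" "Ck_on 1 UNIV (pd e u)" "Ck_on 1 UNIV (pd e s)" if "e = 1 \<or> e = \<i>" for e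
    using Ck_pd[of 1 S e] Ck_pd[of 1 u e] Ck_pd[of 1 s e] S2 u s(1) that by (simp_all only: numeral_2_eq_2 One_nat_def)
  have Ss: "pd e S = (\<lambda>w. of_real (pd e s w))" for e
    unfolding S_def[abs_def] using pd_bounded_linear[OF bounded_linear_of_real Ck1_diff[OF s1]] by auto
  have Sss: "pd e (pd e S) w = of_real (pd e (pd e s) w)" if "e = 1 \<or> e = \<i>" for e
    unfolding Ss using pd_bounded_linear[OF bounded_linear_of_real Ck1_diff[OF P(3)[OF that]]] by auto
  have A: "pd e (pd e (\<lambda>w. S w * u w)) w = S w * pd e (pd e u) w + 2 * (pd e S w * pd e u w) + pd e (pd e S) w * u w"
    if e: "e = 1 \<or> e = \<i>" for e
  proof -
    have 1: "pd e (\<lambda>w. S w * u w) = (\<lambda>w. S w * pd e u w + pd e S w * u w)"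
      using pd_mult[OF Ck1_diff[OF S1] Ck1_diff[OF u1]] by auto
    show ?thesis
      unfolding 1
      by (subst pd_add[OF Ck1_diff[OF Ck_mult[OF S1 P(2)[OF e]]] Ck1_diff[OF Ck_mult[OF P(1)[OF e] u1]]],
          subst pd_mult[OF Ck1_diff[OF S1] Ck1_diff[OF P(2)[OF e]]], subst pd_mult[OF Ck1_diff[OF P(1)[OF e]] Ck1_diff[OF u1]])
        (simp add: algebra_simps)
  qed
  have B: "pd e (\<lambda>w. of_real ((s w)\<^sup>2) * pd e u w) w = S w * (S w * pd e (pd e u) w + 2 * (pd e S w * pd e u w))"
    if e: "e = 1 \<or> e = \<i>" for e
  proof -
    have 1: "(\<lambda>w. of_real ((s w)\<^sup>2) * pd e u w) = (\<lambda>w. S w * (S w * pd e u w))"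
      by (auto simp: S_def power2_eq_square)
    show ?thesis
      unfolding 1
      by (subst pd_mult[OF Ck1_diff[OF S1] Ck1_diff[OF Ck_mult[OF S1 P(2)[OF e]]]],
          subst pd_mult[OF Ck1_diff[OF S1] Ck1_diff[OF P(2)[OF e]]])
        (simp add: algebra_simps)
  qed
  note A1 = A[of 1, OF disjI1[OF refl]] and Ai = A[of \<i>, OF disjI2[OF refl]]
    and B1 = B[of 1, OF disjI1[OF refl]] and Bi = B[of \<i>, OF disjI2[OF refl]]
  have "S w * ((S w * pd 1 (pd 1 u) w + 2 * (pd 1 S w * pd 1 u w)) + (S w * pd \<i> (pd \<i> u) w + 2 * (pd \<i> S w * pd \<i> u w))) = 0"
    using div unfolding pdx_eq_pd pdy_eq_pd B1 Bi by (simp only: distrib_left)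
  then have z: "(S w * pd 1 (pd 1 u) w + 2 * (pd 1 S w * pd 1 u w)) + (S w * pd \<i> (pd \<i> u) w + 2 * (pd \<i> S w * pd \<i> u w)) = 0"
    using s(2) by (simp add: S_def)
  have "laplacian (\<lambda>w. S w * u w) w = (pd 1 (pd 1 S) w + pd \<i> (pd \<i> S) w) * u w"
  proof -
    have "a + b + c + (d + e + f) = (c + f)" if "(a + b) + (d + e) = 0" for a b c d e f :: complex
      using that by algebra
    from this[OF z] show ?thesis
      unfolding laplacian_def pdx_eq_pd pdy_eq_pd A1 Ai by (simp only: distrib_right)
  qed
  also have "\<dots> = of_real (laplacian s w) * u w"
    unfolding laplacian_def pdx_eq_pd pdy_eq_pd using Sss by simp
  finally show ?thesis by (simp add: S_def)
qed

lemma posdef_2_2: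
  fixes A :: "real^2^2"
  assumes pos: "\<And>v. v \<noteq> 0 \<Longrightarrow> v \<bullet> (A *v v) > 0"
  shows "A $ 1 $ 1 > 0" "A $ 2 $ 2 > 0" "det A > 0"
proof -
  have q: "vector [x, y] \<bullet> (A *v vector [x, y]) = x * (A $ 1 $ 1 * x + A $ 1 $ 2 * y) + y * (A $ 2 $ 1 * x + A $ 2 $ 2 * y)" for x y :: real
    by (simp add: inner_vec_def matrix_vector_mult_def sum_2)
  have nz: "vector [x, y] \<noteq> (0 :: real^2)" if "x \<noteq> 0 \<or> y \<noteq> 0" for x y :: real
  proof
    assume e: "vector [x, y] = (0 :: real^2)"
    have "x = (vector [x, y] :: real^2) $ 1" "y = (vector [x, y] :: real^2) $ 2" by simp_all
    then show False using that unfolding e by simp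
  qed
  have p: "0 < x * (A $ 1 $ 1 * x + A $ 1 $ 2 * y) + y * (A $ 2 $ 1 * x + A $ 2 $ 2 * y)" if "x \<noteq> 0 \<or> y \<noteq> 0" for x y
    using pos[OF nz[OF that]] unfolding q .
  show 1: "A $ 1 $ 1 > 0" using p[of 1 0] by simp
  show "A $ 2 $ 2 > 0" using p[of 0 1] by simp
  \<comment> \<open>The quadratic form at the vector (- A12, A11) equals A11 times the
    determinant.\<close>
  have "0 < A $ 1 $ 1 * (A $ 1 $ 1 * A $ 2 $ 2 - A $ 1 $ 2 * A $ 2 $ 1)"
  proof -
    have "(- y) * (x * (- y) + y * x) + x * (z * (- y) + v * x) = x * (x * v - y * z)" for x y z v :: real
      by (simp add: algebra_simps)
    then show ?thesis using p[of "- A $ 1 $ 2" "A $ 1 $ 1"] 1 by (simp add: mult.commute)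
  qed
  then show "det A > 0" using 1 by (simp add: det_2 zero_less_mult_iff)
qed

lemma bounded_linear_entry: "bounded_linear (\<lambda>A :: real^2^2. A $ i $ j)"
  by (rule bounded_linear_compose[OF bounded_linear_vec_nth bounded_linear_vec_nth])

text \<open>For M = (a b; c d) with determinant J the hypotheses say that the transpose of M times S
  times M is t J I, and that (x1 x2; y1 y2) is the inverse of M. Hence the transpose of M times S is
  t times the adjugate of M, and the claim expresses t times the inverse of M through S. The
  auxiliary fact \<open>cr\<close> is Cramer's rule.\<close>

lemma flux_algebra:
  fixes a b c d s11 s12 s21 s22 t J x1 x2 y1 y2 :: real and p1 p2 :: complex
  assumes m: "(a * s11 + c * s21) * a + (a * s12 + c * s22) * c = t * J"
    "(a * s11 + c * s21) * b + (a * s12 + c * s22) * d = 0"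
    "(b * s11 + d * s21) * a + (b * s12 + d * s22) * c = 0"
    "(b * s11 + d * s21) * b + (b * s12 + d * s22) * d = t * J"
    and J: "J = a * d - b * c" "J \<noteq> 0"
    and i: "x1 * a + x2 * c = 1" "x1 * b + x2 * d = 0" "y1 * a + y2 * c = 0" "y1 * b + y2 * d = 1"
  shows "of_real t * (of_real x1 * p1 + of_real x2 * p2)
      = (of_real s11 * p1 + of_real s12 * p2) * of_real y2 - (of_real s21 * p1 + of_real s22 * p2) * of_real y1"
    "of_real t * (of_real y1 * p1 + of_real y2 * p2)
      = (of_real s21 * p1 + of_real s22 * p2) * of_real x1 - (of_real s11 * p1 + of_real s12 * p2) * of_real x2"
proof -
  have cr: "J * r = d * (r * a + r' * c) - c * (r * b + r' * d)" "J * r = a * (r' * b + r * d) - b * (r' * a + r * c)" for r r'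
    unfolding J(1) by (simp_all add: algebra_simps)
  have x: "x1 * J = d" "x2 * J = - b" "y1 * J = - c" "y2 * J = a"
    using cr(1)[of x1 x2] cr(2)[of x2 x1] cr(1)[of y1 y2] cr(2)[of y2 y1] unfolding i by (simp_all add: mult.commute)
  have r: "a * s11 + c * s21 = t * d" "a * s12 + c * s22 = - (t * b)" "b * s11 + d * s21 = - (t * c)" "b * s12 + d * s22 = t * a"
  proof -
    have "J * (a * s11 + c * s21) = J * (t * d)" "J * (a * s12 + c * s22) = J * (- (t * b))"
      "J * (b * s11 + d * s21) = J * (- (t * c))" "J * (b * s12 + d * s22) = J * (t * a)"
      using cr(1)[of "a * s11 + c * s21" "a * s12 + c * s22"] cr(2)[of "a * s12 + c * s22" "a * s11 + c * s21"]
        cr(1)[of "b * s11 + d * s21" "b * s12 + d * s22"] cr(2)[of "b * s12 + d * s22" "b * s11 + d * s21"]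
      unfolding m by (simp_all only: mult_zero_right diff_0_right diff_0 mult_minus_right mult.assoc mult.commute mult.left_commute)
    then show "a * s11 + c * s21 = t * d" "a * s12 + c * s22 = - (t * b)" "b * s11 + d * s21 = - (t * c)" "b * s12 + d * s22 = t * a"
      by (simp_all only: mult_left_cancel[OF J(2)])
  qed
  have k: "t * x1 = s11 * y2 - s21 * y1" "t * x2 = s12 * y2 - s22 * y1" "t * y1 = s21 * x1 - s11 * x2" "t * y2 = s22 * x1 - s12 * x2"
  proof -
    have e: "J * (t * v) = t * (v * J)" "J * (v * v' - w * w') = v * (v' * J) - w * (w' * J)" for v v' w w' :: real
      by (simp_all add: algebra_simps)
    have "J * (t * x1) = J * (s11 * y2 - s21 * y1)" "J * (t * x2) = J * (s12 * y2 - s22 * y1)"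
      "J * (t * y1) = J * (s21 * x1 - s11 * x2)" "J * (t * y2) = J * (s22 * x1 - s12 * x2)"
      unfolding e x using r by (simp_all add: mult.commute)
    then show "t * x1 = s11 * y2 - s21 * y1" "t * x2 = s12 * y2 - s22 * y1" "t * y1 = s21 * x1 - s11 * x2" "t * y2 = s22 * x1 - s12 * x2"
      by (simp_all only: mult_left_cancel[OF J(2)])
  qed
  have k': "of_real t * of_real x1 = (of_real s11 * of_real y2 - of_real s21 * of_real y1 :: complex)"
    "of_real t * of_real x2 = (of_real s12 * of_real y2 - of_real s22 * of_real y1 :: complex)"
    "of_real t * of_real y1 = (of_real s21 * of_real x1 - of_real s11 * of_real x2 :: complex)"
    "of_real t * of_real y2 = (of_real s22 * of_real x1 - of_real s12 * of_real x2 :: complex)"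
    unfolding of_real_mult[symmetric] of_real_diff[symmetric] k by simp_all
  show "of_real t * (of_real x1 * p1 + of_real x2 * p2)
      = (of_real s11 * p1 + of_real s12 * p2) * of_real y2 - (of_real s21 * p1 + of_real s22 * p2) * of_real y1"
    "of_real t * (of_real y1 * p1 + of_real y2 * p2)
      = (of_real s21 * p1 + of_real s22 * p2) * of_real x1 - (of_real s11 * p1 + of_real s12 * p2) * of_real x2"
    unfolding distrib_left mult.assoc[symmetric] k' by (simp_all add: algebra_simps)
qed

section \<open>The conductivity, the Beltrami coefficient and the inverse map\<close>

lemma laplacian_cong_open:
  assumes U: "open U" "z \<in> U" "\<And>\<zeta>. \<zeta> \<in> U \<Longrightarrow> f \<zeta> = g \<zeta>"
  shows "laplacian f z = laplacian g z"
proof -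
  have "pdx f \<zeta> = pdx g \<zeta>" "pdy f \<zeta> = pdy g \<zeta>" if "\<zeta> \<in> U" for \<zeta>
    using pdx_cong_open[OF U(1) that U(3)] by auto
  then show ?thesis
    unfolding laplacian_def using pdx_cong_open[OF U(1,2), of "pdx f" "pdx g"] pdx_cong_open[OF U(1,2), of "pdy f" "pdy g"] by simp
qed

lemma laplacian_const [simp]: "laplacian (\<lambda>_. c) z = 0"
  by (simp add: laplacian_def pdx_eq_pd pdy_eq_pd)

lemma div_grad_identity:
  assumes U: "open U" "z \<in> U" "\<And>\<zeta>. \<zeta> \<in> U \<Longrightarrow> sig \<zeta> = mat 1"
  shows "div_grad sig u z = laplacian u z"
proof -
  have "pdx (\<lambda>\<zeta>. (sig \<zeta> $ 1 $ 1) *\<^sub>R pdx u \<zeta> + (sig \<zeta> $ 1 $ 2) *\<^sub>R pdy u \<zeta>) z = pdx (pdx u) z"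
    by (rule pdx_cong_open(1)[OF U(1,2)]) (simp add: U(3) mat_def)
  moreover have "pdy (\<lambda>\<zeta>. (sig \<zeta> $ 2 $ 1) *\<^sub>R pdx u \<zeta> + (sig \<zeta> $ 2 $ 2) *\<^sub>R pdy u \<zeta>) z = pdy (pdy u) z"
    by (rule pdx_cong_open(2)[OF U(1,2)]) (simp add: U(3) mat_def)
  ultimately show ?thesis unfolding div_grad_def laplacian_def by simp
qed

lemma det_DF_matrix: "det (DF_matrix F z) = (cmod (wirt F z))\<^sup>2 - (cmod (wirt_bar F z))\<^sup>2"
proof -
  have w: "Re (wirt F z) = (Re (pdx F z) + Im (pdy F z)) / 2" "Im (wirt F z) = (Im (pdx F z) - Re (pdy F z)) / 2"
    "Re (wirt_bar F z) = (Re (pdx F z) - Im (pdy F z)) / 2" "Im (wirt_bar F z) = (Im (pdx F z) + Re (pdy F z)) / 2"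
    by (simp_all add: wirt_def wirt_bar_def)
  show ?thesis
    unfolding cmod_power2 w by (simp add: det_2 DF_matrix_def field_simps power2_eq_square)
qed

text \<open>Both Wirtinger derivatives of \<open>F o inv F = id\<close> are taken. The first shows
  that \<open>wirt F\<close> cannot vanish, since \<open>wirt_bar F\<close> would vanish with it;
  dividing the second by it gives the conjugate equation. The strict bound on \<mu> and the positive
  Jacobian come from the dilatation constant \<open>k\<close>.\<close>

lemma inverse_beltrami:
  assumes F: "quasiconformal_C1_diffeo F" and bel: "\<And>z. wirt_bar F z = \<mu> z * wirt F z"
  shows "wirt_bar (inv F) w = - \<mu> (inv F w) * cnj (wirt (inv F) w)" "cmod (\<mu> (inv F w)) < 1"
    "det (DF_matrix F (inv F w)) > 0"
proof -
  have d: "bij F" "Ck_on 1 UNIV F" "Ck_on 1 UNIV (inv F)"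
    using F by (auto simp: quasiconformal_C1_diffeo_def C1_diffeo_def simp del: Ck_on.simps One_nat_def)
  obtain k where k: "0 \<le> k" "k < 1" "\<And>z. cmod (wirt_bar F z) \<le> k * cmod (wirt F z)"
    using F by (auto simp: quasiconformal_C1_diffeo_def)
  define z where "z = inv F w"
  have FG: "(\<lambda>w. F (inv F w)) = (\<lambda>w. w)" using d(1) by (simp add: bij_is_surj surj_f_inv_f)
  have 1: "1 = wirt F z * wirt (inv F) w + wirt_bar F z * cnj (wirt_bar (inv F) w)"
    and 2: "0 = wirt F z * wirt_bar (inv F) w + wirt_bar F z * cnj (wirt (inv F) w)"
    using wirt_compose[OF Ck1_diff[OF d(2)] Ck1_diff[OF d(3)], of w] unfolding FG z_def by simp_all
  have nz: "wirt F z \<noteq> 0" using 1 bel[of z] by auto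
  have "cmod (\<mu> z) * cmod (wirt F z) \<le> k * cmod (wirt F z)" using k(3)[of z] unfolding bel norm_mult .
  then have "cmod (\<mu> z) \<le> k" using nz by simp
  then show "cmod (\<mu> (inv F w)) < 1" using k(2) by (simp add: z_def)
  have "wirt F z * (wirt_bar (inv F) w + \<mu> z * cnj (wirt (inv F) w)) = 0"
    using 2 unfolding bel by (simp add: algebra_simps)
  then show "wirt_bar (inv F) w = - \<mu> (inv F w) * cnj (wirt (inv F) w)"
    using nz by (simp add: z_def eq_neg_iff_add_eq_0)
  have "cmod (wirt_bar F z) < cmod (wirt F z)"
    using k(2) nz by (intro le_less_trans[OF k(3)]) simp
  then have "(cmod (wirt_bar F z))\<^sup>2 < (cmod (wirt F z))\<^sup>2" by (intro power_strict_mono) auto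
  then show "det (DF_matrix F (inv F w)) > 0" by (simp add: det_DF_matrix z_def)
qed

text \<open>At a boundary point the neighbourhood \<open>U\<close> works for the extension too: its
  points in \<open>D\<close> lie in the closure, and off \<open>D\<close> the extension is the
  identity anyway.\<close>

lemma extend_by_identity_near:
  assumes D: "open D" and id: "identity_near_boundary D sig" and z: "z \<notin> D"
  shows "\<exists>U. open U \<and> z \<in> U \<and> (\<forall>\<zeta>\<in>U. extend_by_identity D sig \<zeta> = mat 1)"
proof (cases "z \<in> closure D")
  case True
  then have zf: "z \<in> frontier D" using D z by (simp add: frontier_def interior_open)
  obtain U where U: "open U" "frontier D \<subseteq> U" "\<forall>z \<in> U \<inter> closure D. sig z = mat 1"
    using id by (auto simp: identity_near_boundary_def)
  show ?thesis
    by (rule exI[of _ U]) (use U zf closure_subset[of D] in \<open>auto simp: extend_by_identity_def\<close>)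
next
  case False
  then show ?thesis using closure_subset[of D]
    by (intro exI[of _ "- closure D"]) (auto simp: extend_by_identity_def)
qed

lemma extend_by_identity_Ck2:
  assumes D: "open D" and sig: "C2_conductivity D sig" and id: "identity_near_boundary D sig"
  shows "Ck_on 2 UNIV (extend_by_identity D sig)"
proof (rule Ck_on_local)
  fix z
  show "\<exists>U g. open U \<and> z \<in> U \<and> Ck_on 2 U g \<and> (\<forall>\<zeta>\<in>U. extend_by_identity D sig \<zeta> = g \<zeta>)"
  proof (cases "z \<in> D")
    case True
    obtain V g where V: "closure D \<subseteq> V" "Ck_on 2 V g" "\<And>z. z \<in> closure D \<Longrightarrow> g z = sig z"
      using sig unfolding C2_conductivity_def by blast
    have "Ck_on 2 D g" using Ck_on_subset[OF V(2)] V(1) closure_subset[of D] by blast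
    then show ?thesis using D True V(3) closure_subset[of D]
      by (intro exI[of _ D] exI[of _ g]) (auto simp: extend_by_identity_def simp del: Ck_on.simps)
  next
    case False
    obtain U where U: "open U" "z \<in> U" "\<forall>\<zeta>\<in>U. extend_by_identity D sig \<zeta> = mat 1"
      using extend_by_identity_near[OF D id False] by blast
    have "Ck_on 2 U (\<lambda>_. mat 1 :: real^2^2)" by (rule Ck_on_subset[OF Ck_const]) auto
    then show ?thesis using U by (intro exI[of _ U] exI[of _ "\<lambda>_. mat 1"]) (auto simp del: Ck_on.simps)
  qed
qed simp

lemma extend_by_identity_posdef:
  assumes "C2_conductivity D sig"
  shows "extend_by_identity D sig z $ 1 $ 1 > 0" "extend_by_identity D sig z $ 2 $ 2 > 0"
    "det (extend_by_identity D sig z) > 0"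
proof -
  have "v \<bullet> (extend_by_identity D sig z *v v) > 0" if "v \<noteq> 0" for v
  proof (cases "z \<in> D")
    case True
    then show ?thesis using assms that closure_subset[of D] by (auto simp: C2_conductivity_def extend_by_identity_def)
  next
    case False
    then show ?thesis using that by (simp add: extend_by_identity_def)
  qed
  then show "extend_by_identity D sig z $ 1 $ 1 > 0" "extend_by_identity D sig z $ 2 $ 2 > 0"
    "det (extend_by_identity D sig z) > 0"
    by (auto intro!: posdef_2_2)
qed

lemma beltrami_coeff_Ck2:
  assumes sig: "Ck_on 2 UNIV sig" and pos: "\<And>z. sig z $ 1 $ 1 > 0" "\<And>z. sig z $ 2 $ 2 > 0" "\<And>z. det (sig z) > 0"
  shows "Ck_on 2 UNIV (beltrami_coeff sig)" "Ck_on 2 UNIV (\<lambda>z. det (sig z))" 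
proof -
  have e: "Ck_on 2 UNIV (\<lambda>z. sig z $ i $ j)" for i j
    by (rule Ck_bounded_linear[OF bounded_linear_entry sig])
  show d: "Ck_on 2 UNIV (\<lambda>z. det (sig z))"
    unfolding det_2 by (intro Ck_minus_diff Ck_mult e)
  show "Ck_on 2 UNIV (beltrami_coeff sig)"
    unfolding beltrami_coeff_def[abs_def]
  proof (rule Ck_divide)
    show "Ck_on 2 UNIV (\<lambda>z. - complex_of_real (sig z $ 1 $ 1) + of_real (sig z $ 2 $ 2) - 2 * \<i> * of_real (sig z $ 1 $ 2))"
      by (intro Ck_minus_diff Ck_add Ck_minus Ck_mult Ck_const Ck_of_real e)
    show "Ck_on 2 UNIV (\<lambda>z. complex_of_real (sig z $ 1 $ 1 + sig z $ 2 $ 2 + 2 * sqrt (det (sig z))))"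
      by (intro Ck_add Ck_mult Ck_const Ck_of_real e Ck_sqrt d pos)
    fix z
    have "0 < sig z $ 1 $ 1 + sig z $ 2 $ 2 + 2 * sqrt (det (sig z))"
      using pos[of z] by (intro add_pos_pos) auto
    then show "complex_of_real (sig z $ 1 $ 1 + sig z $ 2 $ 2 + 2 * sqrt (det (sig z))) \<noteq> 0"
      by (metis less_irrefl of_real_eq_0_iff)
  qed
qed

text \<open>Isotropy of the push-forward means that \<open>t\<close> times the gradient of
  \<open>p o inv F\<close> is the Piola transform of the flux of \<open>p\<close>. In this form its
  divergence can be computed by \<open>piola_divergence\<close>.\<close>

lemma push_forward_flux:
  fixes p :: "complex \<Rightarrow> complex"
  assumes bij: "bij F" and C1: "Ck_on 1 UNIV F" "Ck_on 1 UNIV (inv F)" and det: "det (DF_matrix F (inv F w)) > 0"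
    and push: "push_forward F sig w = t *\<^sub>R mat 1" and p: "p differentiable (at (inv F w))"
  defines "V1 \<equiv> \<lambda>\<zeta>. (sig \<zeta> $ 1 $ 1) *\<^sub>R pdx p \<zeta> + (sig \<zeta> $ 1 $ 2) *\<^sub>R pdy p \<zeta>"
    and "V2 \<equiv> \<lambda>\<zeta>. (sig \<zeta> $ 2 $ 1) *\<^sub>R pdx p \<zeta> + (sig \<zeta> $ 2 $ 2) *\<^sub>R pdy p \<zeta>"
  shows "of_real t * pdx (\<lambda>w. p (inv F w)) w
      = V1 (inv F w) * of_real (Im (pdy (inv F) w)) - V2 (inv F w) * of_real (Re (pdy (inv F) w))"
    "of_real t * pdy (\<lambda>w. p (inv F w)) w
      = V2 (inv F w) * of_real (Re (pdx (inv F) w)) - V1 (inv F w) * of_real (Im (pdx (inv F) w))"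
proof -
  define z where "z = inv F w"
  define a b c d where "a = Re (pdx F z)" and "b = Im (pdx F z)" and "c = Re (pdy F z)" and "d = Im (pdy F z)"
  define J where "J = det (DF_matrix F z)"
  have J: "J = a * d - b * c" "J > 0" 
    using det by (simp_all add: J_def z_def det_2 DF_matrix_def a_def b_def c_def d_def)
  define M where "M = transpose (DF_matrix F z) ** sig z ** DF_matrix F z"
  have "(1 / J) *\<^sub>R M = t *\<^sub>R mat 1"
    using push J(2) by (simp add: push_forward_def Let_def M_def J_def z_def)
  then have "J *\<^sub>R ((1 / J) *\<^sub>R M) = J *\<^sub>R (t *\<^sub>R mat 1)" by (rule arg_cong)
  then have M: "M = (t * J) *\<^sub>R mat 1" using J(2) by (simp add: mult.commute)
  have Me: "M $ 1 $ 1 = t * J" "M $ 1 $ 2 = 0" "M $ 2 $ 1 = 0" "M $ 2 $ 2 = t * J"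
    unfolding M by (simp_all add: mat_def)
  have entries: "M $ 1 $ 1 = (a * sig z $ 1 $ 1 + c * sig z $ 2 $ 1) * a + (a * sig z $ 1 $ 2 + c * sig z $ 2 $ 2) * c"
    "M $ 1 $ 2 = (a * sig z $ 1 $ 1 + c * sig z $ 2 $ 1) * b + (a * sig z $ 1 $ 2 + c * sig z $ 2 $ 2) * d"
    "M $ 2 $ 1 = (b * sig z $ 1 $ 1 + d * sig z $ 2 $ 1) * a + (b * sig z $ 1 $ 2 + d * sig z $ 2 $ 2) * c"
    "M $ 2 $ 2 = (b * sig z $ 1 $ 1 + d * sig z $ 2 $ 1) * b + (b * sig z $ 1 $ 2 + d * sig z $ 2 $ 2) * d"
    by (simp_all add: M_def matrix_matrix_mult_def transpose_def DF_matrix_def sum_2 a_def b_def c_def d_def)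
  have FG: "(\<lambda>w. F (inv F w)) = (\<lambda>w. w)" using bij by (simp add: bij_is_surj surj_f_inv_f)
  have i: "e = Re (pd e (inv F) w) *\<^sub>R pdx F z + Im (pd e (inv F) w) *\<^sub>R pdy F z" for e
    using pd_compose_plane[OF Ck1_diff[OF C1(1)] Ck1_diff[OF C1(2)], of e w] unfolding FG z_def by simp
  have i1: "Re (pdx (inv F) w) * a + Im (pdx (inv F) w) * c = 1" "Re (pdx (inv F) w) * b + Im (pdx (inv F) w) * d = 0"
    using arg_cong[OF i[of 1], of Re] arg_cong[OF i[of 1], of Im] by (simp_all add: pdx_eq_pd a_def b_def c_def d_def pdy_eq_pd)
  have i2: "Re (pdy (inv F) w) * a + Im (pdy (inv F) w) * c = 0" "Re (pdy (inv F) w) * b + Im (pdy (inv F) w) * d = 1"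
    using arg_cong[OF i[of \<i>], of Re] arg_cong[OF i[of \<i>], of Im] by (simp_all add: pdx_eq_pd a_def b_def c_def d_def pdy_eq_pd)
  have pp: "pd e (\<lambda>w. p (inv F w)) w = of_real (Re (pd e (inv F) w)) * pdx p z + of_real (Im (pd e (inv F) w)) * pdy p z" for e
    using pd_compose_plane[OF p Ck1_diff[OF C1(2)], of e] by (simp add: scaleR_conv_of_real z_def)
  have V: "V1 z = of_real (sig z $ 1 $ 1) * pdx p z + of_real (sig z $ 1 $ 2) * pdy p z"
    "V2 z = of_real (sig z $ 2 $ 1) * pdx p z + of_real (sig z $ 2 $ 2) * pdy p z"
    by (simp_all add: V1_def V2_def scaleR_conv_of_real)
  have J0: "J \<noteq> 0" using J(2) by simp
  note fl = flux_algebra[OF entries(1)[symmetric, unfolded Me] entries(2)[symmetric, unfolded Me]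
      entries(3)[symmetric, unfolded Me] entries(4)[symmetric, unfolded Me] J(1) J0 i1 i2, of "pdx p z" "pdy p z"]
  show "of_real t * pdx (\<lambda>w. p (inv F w)) w
      = V1 (inv F w) * of_real (Im (pdy (inv F) w)) - V2 (inv F w) * of_real (Re (pdy (inv F) w))"
    using fl(1) unfolding pdx_eq_pd[of "\<lambda>w. p (inv F w)"] pp z_def[symmetric] V pdx_eq_pd[of "inv F", symmetric] .
  show "of_real t * pdy (\<lambda>w. p (inv F w)) w
      = V2 (inv F w) * of_real (Re (pdx (inv F) w)) - V1 (inv F w) * of_real (Im (pdx (inv F) w))"
    using fl(2) unfolding pdy_eq_pd[of "\<lambda>w. p (inv F w)"] pp z_def[symmetric] V pdy_eq_pd[of "inv F", symmetric] .
qed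

text \<open>\<open>F\<close> maps each disc into a bounded set, so a distant \<open>w\<close> has a
  distant preimage, where the decay of \<open>F z - z\<close> can be read backwards. The constant is
  chosen before \<open>T\<close>; only the radius \<open>B\<close> depends on
  \<open>T\<close>.\<close>

lemma inverse_near_identity:
  assumes bij: "bij F" and Fc: "continuous_on UNIV F" and asy: "(\<lambda>z. F z - z) \<in> O[at_infinity](\<lambda>z. 1 / z)"
  obtains C where "C > 0" "\<And>T. \<exists>B. \<forall>w. B \<le> cmod w \<longrightarrow> T < cmod (inv F w) \<and> cmod w / 2 \<le> cmod (inv F w)
    \<and> cmod (inv F w - w) \<le> C / cmod w \<and> cmod (inv F w - w) \<le> 1"
proof -
  obtain C R where C: "C > 0" "R > 0" "\<And>z. R \<le> cmod z \<Longrightarrow> cmod (F z - z) \<le> C / cmod z"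
    using bigo_at_infinityE[OF asy] by blast
  have "\<exists>B. \<forall>w. B \<le> cmod w \<longrightarrow> T < cmod (inv F w) \<and> cmod w / 2 \<le> cmod (inv F w)
    \<and> cmod (inv F w - w) \<le> (2 * C) / cmod w \<and> cmod (inv F w - w) \<le> 1" for T
  proof -
    \<comment> \<open>Beyond |T| for the first claim, beyond \<open>R\<close> for the estimate on
      \<open>F\<close>, and beyond \<open>C\<close> so that the displacement is at most 1.\<close>
    define T' where "T' = \<bar>T\<bar> + R + C"
    have "compact (F ` cball 0 T')"
      by (intro compact_continuous_image continuous_on_subset[OF Fc]) auto
    then obtain B0 where B0: "\<forall>z\<in>cball 0 T'. cmod (F z) \<le> B0"
      by (auto dest!: compact_imp_bounded simp: bounded_iff)
    have "T < cmod (inv F w) \<and> cmod w / 2 \<le> cmod (inv F w)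
      \<and> cmod (inv F w - w) \<le> (2 * C) / cmod w \<and> cmod (inv F w - w) \<le> 1" if w: "\<bar>B0\<bar> + 2 \<le> cmod w" for w
    proof -
      define z where "z = inv F w"
      have Fz: "F z = w" using bij by (simp add: z_def bij_is_surj surj_f_inv_f)
      have zT: "T' < cmod z" using B0[rule_format, of z] w unfolding Fz by force
      then have zz: "R \<le> cmod z" "C \<le> cmod z" "T < cmod z" "0 < cmod z" using C unfolding T'_def by linarith+
      have d: "cmod (z - w) \<le> C / cmod z" using C(3)[OF zz(1)] unfolding Fz by (simp add: norm_minus_commute)
      also have "\<dots> \<le> 1" using zz by simp
      finally have d1: "cmod (z - w) \<le> 1" .
      have h: "cmod w / 2 \<le> cmod z" using d1 w norm_triangle_ineq2[of w z] by (simp add: norm_minus_commute)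
      have "C / cmod z \<le> C / (cmod w / 2)" using h zz C(1) w by (intro divide_left_mono mult_pos_pos) auto
      then have "cmod (z - w) \<le> (2 * C) / cmod w" using d by (simp add: mult.commute)
      then show ?thesis using zz h d1 by (simp add: z_def)
    qed
    then show ?thesis by blast
  qed
  then show ?thesis using that[of "2 * C"] C(1) by simp
qed

text \<open>The quotient v w / exp (l * w) factors as y * x, with \<open>y\<close> the normalized
  \<open>p\<close> at the preimage of \<open>w\<close> and \<open>x\<close> the exponential of
  \<open>l\<close> times the displacement; both are 1 + O(1/w).\<close>

lemma exp_asymptotics_transform:
  assumes bij: "bij F" and Fc: "continuous_on UNIV F" and asy: "(\<lambda>z. F z - z) \<in> O[at_infinity](\<lambda>z. 1 / z)"
    and p: "exp_asymptotics l p" and v: "\<And>w. T \<le> cmod (inv F w) \<Longrightarrow> v w = p (inv F w)"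
  shows "exp_asymptotics l v"
proof -
  obtain C1 where C1: "C1 > 0" "\<And>T. \<exists>B. \<forall>w. B \<le> cmod w \<longrightarrow> T < cmod (inv F w) \<and> cmod w / 2 \<le> cmod (inv F w)
    \<and> cmod (inv F w - w) \<le> C1 / cmod w \<and> cmod (inv F w - w) \<le> 1"
    using inverse_near_identity[OF bij Fc asy] by blast
  obtain C2 R where C2: "C2 > 0" "R > 0" "\<And>z. R \<le> cmod z \<Longrightarrow> cmod (p z / exp (l * z) - 1) \<le> C2 / cmod z"
    using bigo_at_infinityE[OF p[unfolded exp_asymptotics_def]] by blast
  obtain B where B: "\<And>w. B \<le> cmod w \<Longrightarrow> max T R < cmod (inv F w) \<and> cmod w / 2 \<le> cmod (inv F w)
    \<and> cmod (inv F w - w) \<le> C1 / cmod w \<and> cmod (inv F w - w) \<le> 1"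
    using C1(2)[of "max T R"] by blast
  define K where "K = 2 * C2 * exp (cmod l) + exp (cmod l) * (cmod l * C1)"
  show ?thesis
    unfolding exp_asymptotics_def
  proof (rule bigo_at_infinityI)
    fix w :: complex assume w: "max B 1 \<le> cmod w"
    define z where "z = inv F w"
    have z: "T \<le> cmod z" "R \<le> cmod z" "cmod w / 2 \<le> cmod z" "cmod (z - w) \<le> C1 / cmod w" "cmod (z - w) \<le> 1"
      using B[of w] w by (auto simp: z_def)
    define x where "x = exp (l * (z - w))"
    define y where "y = p z / exp (l * z)"
    have eq: "v w / exp (l * w) - 1 = (y - 1) * x + (x - 1)"
    proof -
      have "v w / exp (l * w) = y * x"
        using v[of w] z(1) by (simp add: z_def x_def y_def exp_diff right_diff_distrib)
      then show ?thesis by (simp add: algebra_simps)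
    qed
    have lz: "cmod (l * (z - w)) \<le> cmod l" using z(5) mult_left_mono[OF z(5), of "cmod l"] by (simp add: norm_mult)
    have x: "cmod x \<le> exp (cmod l)" unfolding x_def using lz by (intro order_trans[OF norm_exp]) simp
    have x1: "cmod (x - 1) \<le> exp (cmod l) * (cmod l * (C1 / cmod w))"
    proof -
      have "cmod (x - 1) \<le> exp (cmod (l * (z - w))) * cmod (l * (z - w))"
        unfolding x_def by (rule cmod_exp_minus_1_le)
      also have "\<dots> \<le> exp (cmod l) * (cmod l * (C1 / cmod w))"
        using lz mult_left_mono[OF z(4), of "cmod l"] by (intro mult_mono) (simp_all add: norm_mult)
      finally show ?thesis .
    qed
    have y: "cmod (y - 1) \<le> 2 * C2 / cmod w"
    proof -
      have "cmod (y - 1) \<le> C2 / cmod z" unfolding y_def by (rule C2(3)[OF z(2)])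
      also have "\<dots> \<le> C2 / (cmod w / 2)" using z(3) w C2 by (intro divide_left_mono mult_pos_pos) auto
      finally show ?thesis by (simp add: mult.commute)
    qed
    have "cmod (v w / exp (l * w) - 1) \<le> cmod (y - 1) * cmod x + cmod (x - 1)"
      unfolding eq norm_mult[symmetric] by (rule norm_triangle_ineq)
    also have "\<dots> \<le> (2 * C2 / cmod w) * exp (cmod l) + exp (cmod l) * (cmod l * (C1 / cmod w))"
      using C2(1) by (intro add_mono mult_mono x y x1) auto
    also have "\<dots> = K / cmod w" by (simp add: K_def add_divide_distrib)
    finally show "cmod (v w / exp (l * w) - 1) \<le> K / cmod w" .
  qed
qed

theorem proposition6:
  fixes Omega_hat Omega :: "complex set"
    and sig0 sig_hat :: "complex \<Rightarrow> real^2^2"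
    and F :: "complex \<Rightarrow> complex"
    and sigma q :: "complex \<Rightarrow> real"
    and psi psi_hat :: "complex \<Rightarrow> complex \<Rightarrow> complex"
    and lam :: complex
  assumes "bounded_C1_domain Omega_hat"
    and "C2_conductivity Omega_hat sig0"
    and "identity_near_boundary Omega_hat sig0"
    and "sig_hat = extend_by_identity Omega_hat sig0"
    and "normalized_beltrami_solution (beltrami_coeff sig_hat) F"
    and "sigma = iso_conductivity F sig_hat"
    and "\<And>w. push_forward F sig_hat w = sigma w *\<^sub>R mat 1"
    and "Omega = F ` Omega_hat"
    and "q = potential sigma"
    and "\<And>l. is_unique_solution (schroedinger_solution q l) (\<lambda>w. psi w l)"
    and "\<And>l. is_unique_solution (conductivity_solution sig_hat l) (\<lambda>z. psi_hat z l)"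
  shows "iso_amplitude Omega q psi lam = aniso_amplitude Omega_hat sig_hat psi_hat lam"
proof -
  define G where "G = inv F"
  define p where "p z = psi_hat z lam" for z
  define f where "f w = psi w lam" for w
  have D: "open Omega_hat" "bounded Omega_hat" using assms(1) by (auto simp: bounded_C1_domain_def)
  have qc: "quasiconformal_C1_diffeo F" and bel: "\<And>z. wirt_bar F z = beltrami_coeff sig_hat z * wirt F z"
    and asy: "(\<lambda>z. F z - z) \<in> O[at_infinity](\<lambda>z. 1 / z)"
    using assms(5) by (auto simp: normalized_beltrami_solution_def)
  have bij: "bij F" and F1: "Ck_on 1 UNIV F" and G1: "Ck_on 1 UNIV G"
    using qc by (auto simp: quasiconformal_C1_diffeo_def C1_diffeo_def G_def simp del: Ck_on.simps One_nat_def)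
  have FG: "F (G w) = w" and GF: "G (F z) = z" for w z
    using bij by (simp_all add: G_def bij_is_surj surj_f_inv_f bij_is_inj)
  have sig2: "Ck_on 2 UNIV sig_hat" unfolding assms(4) by (rule extend_by_identity_Ck2[OF D(1) assms(2,3)])
  note pos = extend_by_identity_posdef[OF assms(2), folded assms(4)]
  note mu2 = beltrami_coeff_Ck2(1)[OF sig2 pos] and det2 = beltrami_coeff_Ck2(2)[OF sig2 pos]
  note near = extend_by_identity_near[OF D(1) assms(3), folded assms(4)]
  note inv_bel = inverse_beltrami[OF qc bel, folded G_def]
  \<comment> \<open>With this \<open>sigma\<close> and \<open>u = p o G\<close> are of class C^2, so
    that \<open>s * u\<close> can compete as a classical solution of the Schroedinger
    equation.\<close>
  have G2: "Ck_on 2 UNIV G"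
    by (rule conjugate_beltrami_regularity[OF G1 mu2 inv_bel(1,2)])
  have sigma: "sigma w = sqrt (det (sig_hat (G w)))" for w
    by (simp add: assms(6) iso_conductivity_def G_def)
  define s where "s w = sqrt (sigma w)" for w
  have sigma_pos: "sigma w > 0" for w using pos(3) by (simp add: sigma)
  have sigma2: "Ck_on 2 UNIV sigma"
    unfolding sigma[abs_def] by (rule Ck_sqrt[OF pos(3) Ck_compose_plane[OF det2 G2]])
  have s2: "Ck_on 2 UNIV s" and s_pos: "s w > 0" for w
    using Ck_sqrt[OF sigma_pos sigma2] sigma_pos by (simp_all add: s_def[abs_def] s_def del: Ck_on.simps)
  have ssq: "(s w)\<^sup>2 = sigma w" for w using sigma_pos[of w] by (simp add: s_def)
  have q: "q w = laplacian s w / s w" for w by (simp add: assms(9) potential_def s_def[abs_def])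
  have "conductivity_solution sig_hat lam p" using assms(11)[of lam] by (simp add: is_unique_solution_def p_def[abs_def])
  then have p2: "Ck_on 2 UNIV p" and pdiv: "\<And>z. div_grad sig_hat p z = 0" and pasy: "exp_asymptotics lam p"
    by (simp_all only: conductivity_solution_def)
  have fsol: "schroedinger_solution q lam f" and f_unique: "\<And>v. schroedinger_solution q lam v \<Longrightarrow> v = f"
    using assms(10)[of lam] by (simp_all add: is_unique_solution_def f_def[abs_def])
  from fsol have f2: "Ck_on 2 UNIV f" and feq: "\<And>w. - laplacian f w + of_real (q w) * f w = 0" and fasy: "exp_asymptotics lam f"
    by (simp_all only: schroedinger_solution_def)
  have p1: "Ck_on 1 UNIV p" by (rule Ck_on_mono[OF p2]) auto
  have px1: "Ck_on 1 UNIV (pdx p)" "Ck_on 1 UNIV (pdy p)" using p2 by (simp_all add: numeral_2_eq_2)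
  obtain \<rho>0 where \<rho>0: "\<rho>0 > 0" "\<And>z. z \<in> Omega_hat \<Longrightarrow> cmod z \<le> \<rho>0"
    using D(2) by (auto simp: bounded_pos)
  have s_out: "s w = 1" if "G w \<notin> Omega_hat" for w
    using near[OF that] by (auto simp: s_def sigma det_I)
  have plap: "laplacian p z = 0" if z: "z \<notin> Omega_hat" for z
  proof -
    obtain U where "open U" "z \<in> U" "\<forall>\<zeta>\<in>U. sig_hat \<zeta> = mat 1" using near[OF z] by blast
    then show ?thesis using div_grad_identity[of U z sig_hat p] pdiv by simp
  qed
  have q_out: "q w = 0" if w: "G w \<notin> Omega_hat" for w
  proof -
    obtain U where U: "open U" "G w \<in> U" "\<forall>\<zeta>\<in>U. sig_hat \<zeta> = mat 1" using near[OF w] by blast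
    have "open (G -` U)" using open_vimage[OF U(1) Ck1_cont[OF G1]] .
    then have "laplacian s w = laplacian (\<lambda>_. 1) w"
      by (rule laplacian_cong_open) (use U in \<open>auto simp: s_def sigma det_I\<close>)
    then show ?thesis by (simp add: q)
  qed
  have flap: "laplacian f w = of_real (q w) * f w" for w using feq[of w] by (simp add: add_eq_0_iff)
  define V1 where "V1 = (\<lambda>\<zeta>. (sig_hat \<zeta> $ 1 $ 1) *\<^sub>R pdx p \<zeta> + (sig_hat \<zeta> $ 1 $ 2) *\<^sub>R pdy p \<zeta>)"
  define V2 where "V2 = (\<lambda>\<zeta>. (sig_hat \<zeta> $ 2 $ 1) *\<^sub>R pdx p \<zeta> + (sig_hat \<zeta> $ 2 $ 2) *\<^sub>R pdy p \<zeta>)"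
  have sig1: "Ck_on 1 UNIV (\<lambda>z. sig_hat z $ i $ j)" for i j
    by (rule Ck_bounded_linear[OF bounded_linear_entry Ck_on_mono[OF sig2]]) auto
  have V: "Ck_on 1 UNIV V1" "Ck_on 1 UNIV V2"
    unfolding V1_def V2_def by (intro Ck_add Ck_scaleR sig1 px1)+
  have Vdiv: "pdx V1 z + pdy V2 z = 0" for z using pdiv[of z] by (simp add: div_grad_def V1_def V2_def)
  define u where "u w = p (G w)" for w
  have u2: "Ck_on 2 UNIV u" unfolding u_def[abs_def] by (rule Ck_compose_plane[OF p2 G2])
  note flux = push_forward_flux[OF bij F1 G1[unfolded G_def] inv_bel(3)[unfolded G_def] assms(7) Ck1_diff[OF p1],
      folded G_def V1_def V2_def u_def]
  \<comment> \<open>By the flux identity and Piola's identity the divergence of s^2 grad u is the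
    Jacobian of \<open>G\<close> times \<open>div_grad sig_hat p\<close>, which is zero; the
    Liouville substitution then removes the weight s^2.\<close>
  have lap_su: "laplacian (\<lambda>w. of_real (s w) * u w) w = of_real (laplacian s w) * u w" for w
  proof (rule liouville_transform[OF s2 s_pos u2])
    show "pdx (\<lambda>w. of_real ((s w)\<^sup>2) * pdx u w) w + pdy (\<lambda>w. of_real ((s w)\<^sup>2) * pdy u w) w = 0"
      unfolding ssq flux[folded u_def[abs_def]] using piola_divergence[OF G2 V, of w, unfolded Vdiv mult_zero_right] unfolding V1_def V2_def .
  qed
  have "schroedinger_solution q lam (\<lambda>w. of_real (s w) * u w)"
    unfolding schroedinger_solution_def
  proof (intro conjI allI)
    show "Ck_on 2 UNIV (\<lambda>w. of_real (s w) * u w)" by (intro Ck_mult Ck_of_real s2 u2)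
    show "- laplacian (\<lambda>w. of_real (s w) * u w) w + of_real (q w) * (of_real (s w) * u w) = 0" for w
      unfolding lap_su q using s_pos[of w] by simp
    show "exp_asymptotics lam (\<lambda>w. of_real (s w) * u w)"
    proof (rule exp_asymptotics_transform[OF bij Ck1_cont[OF F1] asy pasy, folded G_def])
      fix w assume "\<rho>0 + 1 \<le> cmod (G w)"
      then have "G w \<notin> Omega_hat" using \<rho>0(2)[of "G w"] by auto
      then show "of_real (s w) * u w = p (G w)" by (simp add: s_out u_def)
    qed
  qed
  \<comment> \<open>Uniqueness for the Schroedinger equation identifies the transformed solution.
    Outside \<open>Omega_hat\<close> the factor \<open>s\<close> is 1, which leaves a pure change of
    variables.\<close>
  then have "f = (\<lambda>w. of_real (s w) * u w)" using f_unique by metis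
  then have pf: "p z = f (F z)" if "z \<notin> Omega_hat" for z
    using s_out[of "F z"] that by (simp add: u_def GF)
  have flap0: "laplacian f w = 0" if "w \<notin> Omega" for w
  proof -
    have "G w \<notin> Omega_hat" using that FG[of w] by (metis assms(8) imageI)
    then show ?thesis by (simp add: flap q_out)
  qed
  have "compact (F ` cball 0 \<rho>0)"
    by (intro compact_continuous_image continuous_on_subset[OF Ck1_cont[OF F1]]) auto
  then obtain \<rho>1 where \<rho>1: "\<forall>z\<in>cball 0 \<rho>0. cmod (F z) \<le> \<rho>1"
    by (auto dest!: compact_imp_bounded simp: bounded_iff)
  have Om: "cmod w \<le> \<rho>1" if "w \<in> Omega" for w using that \<rho>0(2) \<rho>1 by (auto simp: assms(8))
  obtain C1 R1 where C1: "C1 > 0" "R1 > 0" "\<And>z. R1 \<le> cmod z \<Longrightarrow> cmod (amp_density lam f z) \<le> C1 / cmod z"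
  proof -
    have "laplacian f z = 0" if "\<rho>1 + 1 \<le> cmod z" for z
      by (rule flap0) (use Om[of z] that in auto)
    from amp_density_decay[OF f2 this fasy] show ?thesis using that by blast
  qed
  obtain C2 R2 where C2: "C2 > 0" "R2 > 0" "\<And>z. R2 \<le> cmod z \<Longrightarrow> cmod (F z - z) \<le> C2 / cmod z"
    using bigo_at_infinityE[OF asy] by blast
  \<comment> \<open>Beyond this radius points lie outside both domains, so that \<open>F\<close> is
    holomorphic and \<open>p\<close> and \<open>f\<close> are harmonic, and both decay estimates
    hold.\<close>
  define \<rho> where "\<rho> = \<rho>0 + \<bar>\<rho>1\<bar> + R1 + R2"
  have \<rho>: "\<rho> > 0" "\<rho>0 \<le> \<rho>" "\<rho>1 \<le> \<rho>" "R1 \<le> \<rho>" "R2 \<le> \<rho>" using \<rho>0 C1 C2 by (simp_all add: \<rho>_def)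
  have out: "z \<notin> Omega_hat" "z \<notin> Omega" if "\<rho> < cmod z" for z
    using that \<rho>0(2)[of z] Om[of z] \<rho> by auto
  define g where "g z = cnj (amp_density lam f z)" for z
  have Fd: "(F has_field_derivative wirt F z) (at z)" if "\<rho> < cmod z" for z
  proof (rule has_field_derivative_wirt[OF Ck1_diff[OF F1]])
    \<comment> \<open>The Beltrami coefficient of the identity matrix is 0.\<close>
    show "wirt_bar F z = 0" using near[OF out(1)[OF that]] by (auto simp: bel beltrami_coeff_def mat_def)
  qed
  \<comment> \<open>The densities are antiholomorphic outside the disc, so the estimate for
    holomorphic functions is applied to their conjugates.\<close>
  obtain K R where K: "R > 0" "K \<ge> 0" "\<And>z. R \<le> cmod z \<Longrightarrow> cmod (cnj (amp_density lam p z) - g z) \<le> K / (cmod z)\<^sup>2"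
  proof (rule substitution_estimate[where g=g and F=F and \<rho>=\<rho> and C="max C1 C2" and l=lam and gh="\<lambda>z. cnj (amp_density lam p z)"])
    show "g holomorphic_on - cball 0 \<rho>"
      unfolding g_def
    proof (rule holomorphic_onI)
      fix x assume "x \<in> - cball (0::complex) \<rho>"
      then have "laplacian f x = 0" using out[of x] flap0 by auto
      then show "(\<lambda>z. cnj (amp_density lam f z)) field_differentiable at x within - cball 0 \<rho>"
        using cnj_amp_density_derivative[OF f2] by (metis field_differentiable_def field_differentiable_at_within)
    qed
    show "F holomorphic_on - cball 0 \<rho>"
    proof (rule holomorphic_onI)
      fix x assume "x \<in> - cball (0::complex) \<rho>"
      then have "\<rho> < cmod x" by simp
      from Fd[OF this] show "F field_differentiable at x within - cball 0 \<rho>"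
        by (metis field_differentiable_def field_differentiable_at_within)
    qed
    show "cmod (g z) \<le> max C1 C2 / cmod z" if "\<rho> < cmod z" for z
      unfolding g_def complex_mod_cnj using that \<rho> by (intro order_trans[OF C1(3)] divide_right_mono) auto
    show "cmod (F z - z) \<le> max C1 C2 / cmod z" if "\<rho> < cmod z" for z
      using that \<rho> by (intro order_trans[OF C2(3)] divide_right_mono) auto
    show "cnj (amp_density lam p z) = exp (lam * (F z - z)) * g (F z) * deriv F z" if z: "\<rho> < cmod z" for z
    proof -
      have f1: "Ck_on 1 UNIV f" by (rule Ck_on_mono[OF f2]) auto
      have "pdx p z = pdx (\<lambda>z. f (F z)) z" "pdy p z = pdy (\<lambda>z. f (F z)) z"
        by (rule pdx_cong_open[of "- cball 0 \<rho>"]; use z pf out in auto)+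
      then have "wirt_bar p z = wirt_bar (\<lambda>z. f (F z)) z" by (simp add: wirt_bar_def)
      \<comment> \<open>As \<open>wirt_bar F z\<close> is 0, the chain rule keeps only this term;
        conjugation turns its last factor into \<open>deriv F z\<close>.\<close>
      also have "\<dots> = wirt_bar f (F z) * cnj (wirt F z)"
        using wirt_compose(2)[OF Ck1_diff[OF f1] Ck1_diff[OF F1], of z] wirt_holomorphic(2)[OF Fd[OF z]] by simp
      finally have wp: "wirt_bar p z = wirt_bar f (F z) * cnj (deriv F z)"
        using DERIV_imp_deriv[OF Fd[OF z]] by simp
      have "exp (- lam * z) = exp (lam * (F z - z)) * exp (- lam * F z)"
        by (simp add: exp_add[symmetric] algebra_simps)
      then show ?thesis by (simp add: amp_density_def g_def wp exp_cnj mult.assoc mult.left_commute)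
    qed
  qed (use \<rho> C1 C2 in \<open>auto simp: less_max_iff_disj\<close>)
  have iso: "iso_amplitude Omega q psi lam = - 4 * (LINT z|lborel. wirt (chi R') z * amp_density lam f z)" if "\<rho> \<le> R'" for R'
  proof -
    have "iso_amplitude Omega q psi lam = (LINT w:Omega|lborel. exp (- cnj lam * cnj w) * laplacian f w)"
      unfolding iso_amplitude_def flap by (simp only: f_def mult.assoc)
    also have "\<dots> = - 4 * (LINT z|lborel. wirt (chi R') z * amp_density lam f z)"
    proof (rule laplacian_integral_eq[OF f2 flap0])
      show "Omega \<subseteq> cball 0 R'" using order_trans[OF Om order_trans[OF \<rho>(3) that]] by auto
      show "R' > 0" using that \<rho>(1) by simp
    qed
    finally show ?thesis .
  qed
  have aniso: "aniso_amplitude Omega_hat sig_hat psi_hat lam = - 4 * (LINT z|lborel. wirt (chi R') z * amp_density lam p z)" if "\<rho> \<le> R'" for R'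
  proof -
    have "aniso_amplitude Omega_hat sig_hat psi_hat lam = (LINT w:Omega_hat|lborel. exp (- cnj lam * cnj w) * laplacian p w)"
      unfolding aniso_amplitude_def M_op_def p_def[symmetric] pdiv by (simp only: diff_0_right)
    also have "\<dots> = - 4 * (LINT z|lborel. wirt (chi R') z * amp_density lam p z)"
    proof (rule laplacian_integral_eq[OF p2 plap])
      show "Omega_hat \<subseteq> cball 0 R'" using order_trans[OF \<rho>0(2) order_trans[OF \<rho>(2) that]] by auto
      show "R' > 0" using that \<rho>(1) by simp
    qed
    finally show ?thesis .
  qed
  \<comment> \<open>The common value, for every radius from \<open>max \<rho> R\<close> on, of the
    integral of \<open>wirt (chi R')\<close> against the difference of the two densities.\<close>
  define X where "X = (aniso_amplitude Omega_hat sig_hat psi_hat lam - iso_amplitude Omega q psi lam) / (- 4)"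
  have "X = 0"
  proof (rule wirt_chi_integral_zero[where ?R0.0="max \<rho> R" and D="\<lambda>z. amp_density lam p z - amp_density lam f z" and K=K])
    show "max \<rho> R > 0" using \<rho> by (simp add: less_max_iff_disj)
    show "cmod (amp_density lam p z - amp_density lam f z) \<le> K / (cmod z)\<^sup>2" if "max \<rho> R \<le> cmod z" for z
      using K(3)[of z] that by (simp add: g_def complex_cnj_diff[symmetric] del: complex_cnj_diff)
    fix R' assume R': "max \<rho> R \<le> R'"
    have "R' > 0" using R' \<rho> by simp
    then have i: "integrable lborel (\<lambda>z. wirt (chi R') z * amp_density lam u z)" if "Ck_on 2 UNIV u" for u
      by (intro integrable_mult_bounded_supp(2) Ck1_cont[OF amp_density_Ck1[OF that]] Ck1_wirt_cont chi_Ck bounded_supp_wirt chi_bounded_supp)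
    have "(LINT z|lborel. wirt (chi R') z * (amp_density lam p z - amp_density lam f z))
      = (LINT z|lborel. wirt (chi R') z * amp_density lam p z) - (LINT z|lborel. wirt (chi R') z * amp_density lam f z)"
      using i[OF p2] i[OF f2] by (simp add: right_diff_distrib)
    also have "\<dots> = X"
    proof -
      have "a - b = (- 4 * a - - 4 * b) / (- 4)" for a b :: complex by (simp add: field_simps)
      moreover have "\<rho> \<le> R'" using R' by simp
      ultimately show ?thesis unfolding X_def iso[OF \<open>\<rho> \<le> R'\<close>] aniso[OF \<open>\<rho> \<le> R'\<close>] by blast
    qed
    finally show "(LINT z|lborel. wirt (chi R') z * (amp_density lam p z - amp_density lam f z)) = X" .
  qed (use K in auto)
  then show ?thesis by (simp add: X_def)
qed

end
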